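(* Consider the volatility model $X_t=\sigma_tZ_t$, $h(\sigma_{t+1}^2)=\psi_t(h(\sigma_t^2),\theta_0)$, $t\in\mathbb Z$, its inverted maps $\phi_t$ and the set $\mathcal K$, as described in the context, and let $\Theta$ be a compact set. Assume: (1) the recursion $h(\sigma_{t+1}^2)=\psi_t(h(\sigma_t^2),\theta_0)$, $t\in\mathbb Z$, admits a unique stationary solution $(\sigma_t^2)$; it is non anticipative (for every $t\in\mathbb Z$, $\sigma_t^2$ is independent of $(Z_t,Z_{t+1},Z_{t+2},\ldots)$) and $\mathbb E[\log^+\sigma_0^2]<\infty$; (2) $\mathbb E[\log^+(\|\phi_0(y,\cdot)\|_\Theta)]<\infty$ for some $y\in\mathcal K$, $\mathbb E[\log^+(\|\Lambda_{\phi_0}\|_\Theta)]<\infty$, and, for some integer $r\ge1$, $\mathbb E[\log(\Lambda_{\phi_0^{(r)}}(\theta))]<0$ for every $\theta\in\Theta$. Then the model is continuously invertible on $\Theta$: $\|\hat g_t-g_t\|_\Theta\to0$ a.s. as $t\to\infty$.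
   Context: The innovations $(Z_t)_{t\in\mathbb Z}$ are iid real random variables with $\mathbb E[Z_0]=0$, $\mathbb E[Z_0^2]=1$. The observations are $X_t=\sigma_tZ_t$, where $h(\sigma_{t+1}^2)=\psi_t(h(\sigma_t^2),\theta_0)$ for all $t\in\mathbb Z$; here $h$ is a bijection from a subset of $\mathbb R^+$ onto a subset of $\mathbb R$, with inverse $\ell>0$ (the link function), and $\psi_t(x,\theta)=\psi(x,Z_t,\theta)$ depends on randomness only through $Z_t$ (the same function $\psi$ for all $t$). Inverted model: $\phi_t(x,\theta)$ is obtained from $\psi_t(x,\theta)$ by replacing $Z_t$ with $X_t/\sqrt{\ell(x)}$; it depends on randomness only through $X_t$, and $h(\sigma_{t+1}^2)=\phi_t(h(\sigma_t^2),\theta_0)$. Standing setting: $\Theta$ is a compact set of parameters in some $\mathbb R^d$, and $\mathcal K\subset\mathbb R$ is a set such that the random functions $(x,\theta)\mapsto\phi_t(x,\theta)$ restricted to $\mathcal K\times\Theta$ take values in $\mathcal K$. $\mathcal C_\Theta$ is the space of continuous functions from $\Theta$ to $\mathcal K$, and $\|\cdot\|_\Theta$ is the uniform norm over $\Theta$. The approximations are $\hat g_{t+1}(\theta)=\phi_t(\hat g_t(\theta),\theta)$, $t\ge0$, $\theta\in\Theta$, started at an arbitrary function $\hat g_0\in\mathcal C_\Theta$; it is assumed that the recursion produces functions $\hat g_t\in\mathcal C_\Theta$. For each $\theta\in\Theta$, $(g_t(\theta))_{t\in\mathbb Z}$ denotes the unique stationary solution of $g_{t+1}(\theta)=\phi_t(g_t(\theta),\theta)$,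 $t\in\mathbb Z$ (it does not depend on $\hat g_0$). Continuous invertibility on $\Theta$: $\|\hat g_t-g_t\|_\Theta\to0$ a.s. as $t\to\infty$, regardless of the initial function $\hat g_0\in\mathcal C_\Theta$. Lipschitz functions: for a (random) function $f:\mathcal K\times\Theta\to\mathcal K$, $\Lambda_f$ denotes a continuous function on $\Theta$ (assumed to exist for the functions considered) such that $|f(x,\theta)-f(y,\theta)|\le\Lambda_f(\theta)|x-y|$ for all $x,y\in\mathcal K$, $\theta\in\Theta$. The iterate is $\phi_t^{(r)}(\cdot,\theta)=\phi_t(\cdot,\theta)\circ\phi_{t-1}(\cdot,\theta)\circ\cdots\circ\phi_{t-r+1}(\cdot,\theta)$. *)

theory Defs
  imports "HOL-Probability.Probability"
begin

definition stationary_process :: "'a measure \<Rightarrow> (int \<Rightarrow> 'a \<Rightarrow> real) \<Rightarrow> bool" where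
  "stationary_process M Y \<longleftrightarrow>
     (\<forall>t. Y t \<in> borel_measurable M) \<and>
     (\<forall>k. distr M (PiM UNIV (\<lambda>_::int. borel)) (\<lambda>\<omega> t. Y (t + k) \<omega>)
        = distr M (PiM UNIV (\<lambda>_::int. borel)) (\<lambda>\<omega> t. Y t \<omega>))"

definition iid_process :: "'a measure \<Rightarrow> (int \<Rightarrow> 'a \<Rightarrow> real) \<Rightarrow> bool" where
  "iid_process M Z \<longleftrightarrow>
     prob_space.indep_vars M (\<lambda>_. borel) Z UNIV \<and>
     (\<forall>t. distr M borel (Z t) = distr M borel (Z 0))"

text \<open>Stationary \<open>D\<close>-valued solutions of the stochastic recurrence equation
  \<open>h (Y (t+1)) = F t (h (Y t))\<close> indexed by all integers. Equations between random variables hold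
  almost surely, and uniqueness is up to almost sure equality, among all stationary solutions
  defined on the same probability space.\<close>

definition stationary_solution ::
  "'a measure \<Rightarrow> real set \<Rightarrow> (real \<Rightarrow> real) \<Rightarrow> (int \<Rightarrow> 'a \<Rightarrow> real \<Rightarrow> real) \<Rightarrow>
     (int \<Rightarrow> 'a \<Rightarrow> real) \<Rightarrow> bool" where
  "stationary_solution M D h F Y \<longleftrightarrow>
     stationary_process M Y \<and>
     (\<forall>t. AE \<omega> in M. Y t \<omega> \<in> D \<and> h (Y (t + 1) \<omega>) = F t \<omega> (h (Y t \<omega>)))"

definition unique_stationary_solution ::
  "'a measure \<Rightarrow> real set \<Rightarrow> (real \<Rightarrow> real) \<Rightarrow> (int \<Rightarrow> 'a \<Rightarrow> real \<Rightarrow> real) \<Rightarrow>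
     (int \<Rightarrow> 'a \<Rightarrow> real) \<Rightarrow> bool" where
  "unique_stationary_solution M D h F Y \<longleftrightarrow>
     stationary_solution M D h F Y \<and>
     (\<forall>Y'. stationary_solution M D h F Y' \<longrightarrow> (\<forall>t. AE \<omega> in M. Y' t \<omega> = Y t \<omega>))"

text \<open>Independence of \<open>Y t\<close> and the sequence \<open>(Z s)\<close>, \<open>s \<ge> t\<close>. The library's \<open>indep_var\<close> needs both
  variables to have values in the same type, so the generated sigma-algebras are used.\<close>

definition non_anticipative ::
  "'a measure \<Rightarrow> (int \<Rightarrow> 'a \<Rightarrow> real) \<Rightarrow> (int \<Rightarrow> 'a \<Rightarrow> real) \<Rightarrow> bool" where
  "non_anticipative M Z Y \<longleftrightarrow>
     (\<forall>t. prob_space.indep_set M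
        (sets (vimage_algebra (space M) (Y t) borel))
        (sets (vimage_algebra (space M) (\<lambda>\<omega>. \<lambda>s\<in>{t..}. Z s \<omega>) (PiM {t..} (\<lambda>_. borel)))))"

text \<open>\<open>\<psi> x z \<theta>\<close> is the model map, with the innovation as its second argument.\<close>

definition inverted_map ::
  "(real \<Rightarrow> real \<Rightarrow> 'p \<Rightarrow> real) \<Rightarrow> (real \<Rightarrow> real) \<Rightarrow> (int \<Rightarrow> 'a \<Rightarrow> real) \<Rightarrow>
     int \<Rightarrow> 'a \<Rightarrow> real \<Rightarrow> 'p \<Rightarrow> real" where
  "inverted_map \<psi> l X t \<omega> x \<theta> = \<psi> x (X t \<omega> / sqrt (l x)) \<theta>"

text \<open>The composition of \<open>\<phi> t\<close>, \<open>\<phi> (t - 1)\<close>, ..., \<open>\<phi> (t - r + 1)\<close>, the last one being applied first.\<close>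

primrec iterate_map ::
  "(int \<Rightarrow> 'a \<Rightarrow> real \<Rightarrow> 'p \<Rightarrow> real) \<Rightarrow> nat \<Rightarrow> int \<Rightarrow> 'a \<Rightarrow> real \<Rightarrow> 'p \<Rightarrow> real" where
  "iterate_map \<phi> 0 t \<omega> x \<theta> = x"
| "iterate_map \<phi> (Suc n) t \<omega> x \<theta> = \<phi> t \<omega> (iterate_map \<phi> n (t - 1) \<omega> x \<theta>) \<theta>"

primrec approx ::
  "(int \<Rightarrow> 'a \<Rightarrow> real \<Rightarrow> 'p \<Rightarrow> real) \<Rightarrow> ('p \<Rightarrow> real) \<Rightarrow> nat \<Rightarrow> 'a \<Rightarrow> 'p \<Rightarrow> real" where
  "approx \<phi> f 0 \<omega> \<theta> = f \<theta>"
| "approx \<phi> f (Suc n) \<omega> \<theta> = \<phi> (int n) \<omega> (approx \<phi> f n \<omega> \<theta>) \<theta>"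

definition cont_fun_space :: "'p::topological_space set \<Rightarrow> real set \<Rightarrow> ('p \<Rightarrow> real) set" where
  "cont_fun_space \<Theta> K = {f. continuous_on \<Theta> f \<and> f ` \<Theta> \<subseteq> K}"

text \<open>Only meaningful for nonempty \<open>\<Theta>\<close> and \<open>f\<close> bounded on \<open>\<Theta>\<close>; it is only used for functions that
  are continuous on a nonempty compact \<open>\<Theta>\<close>.\<close>

definition unif_norm :: "'p set \<Rightarrow> ('p \<Rightarrow> real) \<Rightarrow> real" where
  "unif_norm \<Theta> f = (SUP \<theta>\<in>\<Theta>. \<bar>f \<theta>\<bar>)"

definition lipschitz_coeff ::
  "real set \<Rightarrow> 'p::topological_space set \<Rightarrow> (real \<Rightarrow> 'p \<Rightarrow> real) \<Rightarrow> ('p \<Rightarrow> real) \<Rightarrow> bool" where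
  "lipschitz_coeff K \<Theta> f L \<longleftrightarrow>
     continuous_on \<Theta> L \<and>
     (\<forall>x\<in>K. \<forall>y\<in>K. \<forall>\<theta>\<in>\<Theta>. \<bar>f x \<theta> - f y \<theta>\<bar> \<le> L \<theta> * \<bar>x - y\<bar>)"

definition log_plus :: "real \<Rightarrow> real" where
  "log_plus x = ln (max 1 x)"

text \<open>A Lipschitz coefficient may vanish, and \<^term>\<open>ln (0::real) = 0\<close>; hence the logarithm is taken
  in the extended reals, with \<open>log 0 = -\<infinity>\<close>.\<close>

definition ext_log :: "real \<Rightarrow> ereal" where
  "ext_log x = (if x \<le> 0 then - \<infinity> else ereal (ln x))"

text \<open>Expectation as positive part minus negative part (\<^const>\<open>e2ennreal\<close> sends negative numbers
  to 0). It is \<open>\<infinity>\<close> whenever the positive part has infinite integral.\<close>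

definition ext_expectation :: "'a measure \<Rightarrow> ('a \<Rightarrow> ereal) \<Rightarrow> ereal" where
  "ext_expectation M Y =
     enn2ereal (\<integral>\<^sup>+ \<omega>. e2ennreal (Y \<omega>) \<partial>M) - enn2ereal (\<integral>\<^sup>+ \<omega>. e2ennreal (- Y \<omega>) \<partial>M)"

text \<open>For each \<open>\<theta>\<close> separately, the stationary solution \<open>g t \<theta>\<close> is determined up to a null set only, and
  this null set may depend on \<open>\<theta>\<close>. The uniform norm over \<open>\<Theta>\<close> is therefore that of the modification
  \<open>g'\<close> with continuous paths on \<open>\<Theta>\<close>, whose existence is part of the property.\<close>

definition continuously_invertible ::
  "'a measure \<Rightarrow> real set \<Rightarrow> 'p::topological_space set \<Rightarrow> (int \<Rightarrow> 'a \<Rightarrow> real \<Rightarrow> 'p \<Rightarrow> real) \<Rightarrow>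
     (int \<Rightarrow> 'a \<Rightarrow> 'p \<Rightarrow> real) \<Rightarrow> bool" where
  "continuously_invertible M K \<Theta> \<phi> g \<longleftrightarrow>
     (\<exists>g'. (\<forall>t. \<forall>\<theta>\<in>\<Theta>. (\<lambda>\<omega>. g' t \<omega> \<theta>) \<in> borel_measurable M \<and> (AE \<omega> in M. g' t \<omega> \<theta> = g t \<omega> \<theta>)) \<and>
           (\<forall>t. \<forall>\<omega>\<in>space M. continuous_on \<Theta> (g' t \<omega>)) \<and>
           (\<forall>f\<in>cont_fun_space \<Theta> K. AE \<omega> in M.
              (\<lambda>n. unif_norm \<Theta> (\<lambda>\<theta>. approx \<phi> f n \<omega> \<theta> - g' (int n) \<omega> \<theta>)) \<longlonglongrightarrow> 0))"

end

theory Submission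
  imports Defs
begin

text \<open>The proof has two halves: the observations \<open>X\<close> form an ergodic process, and a recursion driven by an
ergodic process and contracting on average forgets its starting function uniformly over \<open>\<Theta>\<close>.

Ergodicity is not among the hypotheses. It follows from the uniqueness of the volatility on the given
probability space. Non-anticipation makes the volatility and the noise jointly stationary. Consider the conditional law of
the volatility path given the noise. If it had no atoms, reversing the conditional quantile of the path would give, on
the same space, a different path with the same joint law with the noise, hence a second stationary solution
(\<open>rigid_imp_atom\<close>). If two atoms shared the maximal weight, exchanging them would do the same
(\<open>rigid_maximal_atom_unique\<close>). So there is a unique heaviest atom. Its selection is a function of the noise that
commutes with the shift, so it is itself a stationary solution, and by uniqueness it is the volatility
(\<open>strong_solution\<close>). Hence \<open>X\<close> is a shift-equivariant function of independent identically distributed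
variables, and all powers of its shift are ergodic because the Bernoulli shift is mixing.

For the contraction, the given Lipschitz coefficients are replaced by the smallest ones, which are a fixed
function of the path of \<open>X\<close> and therefore stationary in time. The coefficient \<open>\<Lambda> r 0\<close> is continuous in
the parameter, so on a small ball around any \<open>\<theta>\<close> the expected logarithm of the smallest Lipschitz constant,
uniform over the ball, is still negative (\<open>local_contraction\<close>), and finitely many such balls cover \<open>\<Theta>\<close>.
By the ergodic theorem, in the one-sided form given by the maximal ergodic inequality, the products of these
constants along blocks of length \<open>r\<close> decrease exponentially, forwards and backwards in time. Backwards, the
iterates started at \<open>y\<close> converge uniformly to a continuous function of the parameter. It is the stationary
solution, since the stationary solution started in the distant past is tight and its starting value is
forgotten. Forwards, the recursion started at any continuous function approaches this limit uniformly.\<close>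

section \<open>Sums along the orbits of an ergodic map\<close>

text \<open>The largest of the first \<open>n + 1\<close> partial sums along the orbit (the empty sum included). Peeling off the first
point of the orbit, instead of the last, is what the maximal inequality needs.\<close>

primrec max_ergodic_sum :: "('a \<Rightarrow> 'a) \<Rightarrow> ('a \<Rightarrow> real) \<Rightarrow> nat \<Rightarrow> 'a \<Rightarrow> real" where
  "max_ergodic_sum \<tau> f 0 w = 0"
| "max_ergodic_sum \<tau> f (Suc n) w = max 0 (f w + max_ergodic_sum \<tau> f n (\<tau> w))"

lemma max_ergodic_sum_nonneg: "0 \<le> max_ergodic_sum \<tau> f n w"
  by (cases n) auto

lemma max_ergodic_sum_mono: "max_ergodic_sum \<tau> f n w \<le> max_ergodic_sum \<tau> f (Suc n) w"
  by (induction n arbitrary: w) (auto simp: max_ergodic_sum_nonneg max.coboundedI2)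

lemma ergodic_sum_Suc:
  fixes f :: "'a \<Rightarrow> real"
  shows "(\<Sum>i<Suc n. f ((\<tau> ^^ i) w)) = f w + (\<Sum>i<n. f ((\<tau> ^^ i) (\<tau> w)))"
  by (simp add: sum.lessThan_Suc_shift funpow_swap1 del: sum.lessThan_Suc)

lemma ergodic_sum_le_max:
  fixes f :: "'a \<Rightarrow> real"
  shows "(\<Sum>i<n. f ((\<tau> ^^ i) w)) \<le> max_ergodic_sum \<tau> f n w"
proof (induction n arbitrary: w)
  case (Suc n)
  show ?case
    unfolding ergodic_sum_Suc using Suc[of "\<tau> w"] by simp
qed simp

lemma measurable_funpow: "\<tau> \<in> Q \<rightarrow>\<^sub>M Q \<Longrightarrow> (\<tau> ^^ i) \<in> Q \<rightarrow>\<^sub>M Q"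
proof (induction i)
  case (Suc i)
  then have "\<tau> \<circ> (\<tau> ^^ i) \<in> Q \<rightarrow>\<^sub>M Q" by (intro measurable_comp[of _ Q Q]) auto
  then show ?case by (simp add: comp_def)
qed (simp add: id_def)

text \<open>Hopf's maximal inequality: where the maximal sum of index \<open>n + 1\<close> is positive, it equals \<open>f\<close> plus the maximal
sum of index \<open>n\<close> at the next point. Integration over that set gives that the integral of \<open>f\<close> over it is
nonnegative. Unboundedness of the sums is an invariant event; if it had probability one, these sets would exhaust
the space and the integral of \<open>f\<close> itself would be nonnegative.\<close>

lemma ergodic_sums_bounded_above:
  fixes f :: "'a \<Rightarrow> real"
  assumes "prob_space Q" and \<tau>: "\<tau> \<in> Q \<rightarrow>\<^sub>M Q" and inv: "distr Q Q \<tau> = Q"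
    and erg: "\<And>B. B \<in> sets Q \<Longrightarrow> \<tau> -` B \<inter> space Q = B \<Longrightarrow> measure Q B = 0 \<or> measure Q B = 1"
    and f: "integrable Q f" and neg: "(\<integral>w. f w \<partial>Q) < 0"
  shows "AE w in Q. \<exists>C. \<forall>n. (\<Sum>i<n. f ((\<tau> ^^ i) w)) \<le> C"
proof -
  interpret prob_space Q by fact
  let ?G = "max_ergodic_sum \<tau> f" and ?S = "\<lambda>n w. \<Sum>i<n. f ((\<tau> ^^ i) w)"
  have G_int: "integrable Q (?G n)" for n
  proof (induction n)
    case (Suc n)
    have "integrable (distr Q Q \<tau>) (?G n)" using Suc inv by simp
    then have "integrable Q (\<lambda>w. ?G n (\<tau> w))"
      using Suc \<tau> by (subst (asm) integrable_distr_eq) auto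
    then show ?case using f by simp
  qed simp
  have G_shift: "integrable Q (\<lambda>w. ?G n (\<tau> w)) \<and> (\<integral>w. ?G n (\<tau> w) \<partial>Q) = (\<integral>w. ?G n w \<partial>Q)" for n
  proof -
    have m: "?G n \<in> borel_measurable Q" using G_int by auto
    have "integrable (distr Q Q \<tau>) (?G n)" using G_int inv by simp
    then have "integrable Q (\<lambda>w. ?G n (\<tau> w))"
      using m \<tau> by (subst (asm) integrable_distr_eq) auto
    moreover have "(\<integral>w. ?G n w \<partial>(distr Q Q \<tau>)) = (\<integral>w. ?G n (\<tau> w) \<partial>Q)"
      using m \<tau> by (intro integral_distr) auto
    ultimately show ?thesis using inv by simp
  qed
  have fm[measurable]: "f \<in> borel_measurable Q" using f by auto
  have Gm[measurable]: "?G n \<in> borel_measurable Q" for n using G_int by auto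
  let ?I = "\<lambda>n w. f w * indicator {w \<in> space Q. 0 < ?G (Suc n) w} w"
  have I_int: "integrable Q (?I n)" for n
  proof (intro integrable_real_mult_indicator f)
    show "{w \<in> space Q. 0 < ?G (Suc n) w} \<in> sets Q"
      by (rule borel_measurable_less[OF borel_measurable_const Gm])
  qed
  have max_ineq: "0 \<le> (\<integral>w. ?I n w \<partial>Q)" for n
  proof -
    have "(\<integral>w. ?G (Suc n) w \<partial>Q) \<le> (\<integral>w. ?I n w + ?G n (\<tau> w) \<partial>Q)"
    proof (rule integral_mono)
      show "integrable Q (?G (Suc n))" by (rule G_int)
      show "integrable Q (\<lambda>w. ?I n w + ?G n (\<tau> w))"
        by (intro Bochner_Integration.integrable_add I_int G_shift[THEN conjunct1])
      fix w assume "w \<in> space Q"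
      then show "?G (Suc n) w \<le> ?I n w + ?G n (\<tau> w)"
        using max_ergodic_sum_nonneg[of \<tau> f n "\<tau> w"] by (auto simp: indicator_def max_def)
    qed
    also have "\<dots> = (\<integral>w. ?I n w \<partial>Q) + (\<integral>w. ?G n w \<partial>Q)"
      by (simp only: Bochner_Integration.integral_add[OF I_int G_shift[THEN conjunct1]] G_shift)
    also have "(\<integral>w. ?G n w \<partial>Q) \<le> (\<integral>w. ?G (Suc n) w \<partial>Q)"
      by (intro integral_mono G_int max_ergodic_sum_mono)
    finally show ?thesis by simp
  qed
  have pow[measurable]: "(\<tau> ^^ i) \<in> Q \<rightarrow>\<^sub>M Q" for i
    by (rule measurable_funpow[OF \<tau>])
  have Sm[measurable]: "?S n \<in> borel_measurable Q" for n
    by (intro borel_measurable_sum measurable_compose[OF pow]) auto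
  define B where "B = {w \<in> space Q. \<forall>m::nat. \<exists>n. real m < ?S n w}"
  have B: "B \<in> sets Q" unfolding B_def by measurable
  have "\<tau> -` B \<inter> space Q = B"
  proof -
    have "(\<forall>m::nat. \<exists>n. real m < ?S n (\<tau> w)) \<longleftrightarrow> (\<forall>m::nat. \<exists>n. real m < ?S n w)" for w
    proof
      assume L: "\<forall>m::nat. \<exists>n. real m < ?S n (\<tau> w)"
      show "\<forall>m::nat. \<exists>n. real m < ?S n w"
      proof
        fix m :: nat
        obtain k :: nat where k: "real m - f w < real k" using reals_Archimedean2 by blast
        obtain n where "real k < ?S n (\<tau> w)" using L by blast
        then have "real m < ?S (Suc n) w" unfolding ergodic_sum_Suc using k by simp
        then show "\<exists>n. real m < ?S n w" by blast
      qed
    next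
      assume R: "\<forall>m::nat. \<exists>n. real m < ?S n w"
      show "\<forall>m::nat. \<exists>n. real m < ?S n (\<tau> w)"
      proof
        fix m :: nat
        obtain k :: nat where k: "real m + f w < real k" using reals_Archimedean2 by blast
        obtain n where n: "real k < ?S n w" using R by blast
        then have "n \<noteq> 0" by (intro notI) auto
        then obtain n' where "n = Suc n'" using not0_implies_Suc by blast
        then have "real k < f w + ?S n' (\<tau> w)" using n ergodic_sum_Suc by metis
        then have "real m < ?S n' (\<tau> w)" using k by simp
        then show "\<exists>n. real m < ?S n (\<tau> w)" by blast
      qed
    qed
    then show ?thesis unfolding B_def using measurable_space[OF \<tau>] by auto
  qed
  then consider "measure Q B = 0" | "measure Q B = 1" using erg[OF B] by blast
  then show ?thesis
  proof cases
    case 1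
    then have "AE w in Q. w \<notin> B"
      using B by (intro AE_not_in) (auto simp: emeasure_eq_measure null_sets_def)
    then show ?thesis
    proof (rule AE_mp, intro AE_I2 impI)
      fix w assume "w \<in> space Q" "w \<notin> B"
      then show "\<exists>C. \<forall>n. ?S n w \<le> C" unfolding B_def by (auto simp: not_less)
    qed
  next
    case 2
    then have "AE w in Q. w \<in> B" using prob_eq_1[OF B] by simp
    then have lim: "AE w in Q. (\<lambda>n. ?I n w) \<longlonglongrightarrow> f w"
    proof (rule AE_mp, intro AE_I2 impI)
      fix w assume w: "w \<in> space Q" "w \<in> B"
      then have "\<exists>n. real 0 < ?S n w" unfolding B_def by blast
      then obtain n where "0 < ?S n w" by auto
      then have "0 < ?G n w" using ergodic_sum_le_max[of f \<tau> w n] by simp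
      moreover have "?G n w \<le> ?G (Suc m) w" if "n \<le> m" for m
        by (rule lift_Suc_mono_le[where f="\<lambda>n. ?G n w", OF max_ergodic_sum_mono]) (use that in auto)
      ultimately have "\<forall>m\<ge>n. 0 < ?G (Suc m) w"
        by (meson less_le_trans)
      then have "eventually (\<lambda>m. ?I m w = f w) sequentially"
        using w by (intro eventually_sequentiallyI[of n]) (simp del: max_ergodic_sum.simps)
      then show "(\<lambda>n. ?I n w) \<longlonglongrightarrow> f w" by (rule tendsto_eventually)
    qed
    have "(\<lambda>n. \<integral>w. ?I n w \<partial>Q) \<longlonglongrightarrow> (\<integral>w. f w \<partial>Q)"
    proof (rule integral_dominated_convergence[where w="\<lambda>w. \<bar>f w\<bar>"])
      show "?I n \<in> borel_measurable Q" for n using I_int by (rule borel_measurable_integrable)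
      show "AE w in Q. norm (?I n w) \<le> \<bar>f w\<bar>" for n by (auto simp: indicator_def)
    qed (use f lim in auto)
    then have "0 \<le> (\<integral>w. f w \<partial>Q)" using max_ineq by (intro LIMSEQ_le_const) auto
    then show ?thesis using neg by simp
  qed
qed

text \<open>Boundedness is applied to \<open>f + c\<close>, where \<open>c\<close> is half the distance of the mean from zero.\<close>

lemma ergodic_sums_linear_decrease:
  fixes f :: "'a \<Rightarrow> real"
  assumes "prob_space Q" and \<tau>: "\<tau> \<in> Q \<rightarrow>\<^sub>M Q" and inv: "distr Q Q \<tau> = Q"
    and erg: "\<And>B. B \<in> sets Q \<Longrightarrow> \<tau> -` B \<inter> space Q = B \<Longrightarrow> measure Q B = 0 \<or> measure Q B = 1"
    and f: "integrable Q f" and neg: "(\<integral>w. f w \<partial>Q) < 0"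
  shows "\<exists>c>0. AE w in Q. \<exists>C. \<forall>n. (\<Sum>i<n. f ((\<tau> ^^ i) w)) \<le> C - c * real n"
proof -
  interpret prob_space Q by fact
  define c where "c = - (\<integral>w. f w \<partial>Q) / 2"
  have c: "c > 0" using neg by (simp add: c_def)
  have "(\<integral>w. f w + c \<partial>Q) = (\<integral>w. f w \<partial>Q) + c"
    using f by (subst Bochner_Integration.integral_add) (auto simp: prob_space)
  also have "\<dots> < 0" using neg by (simp add: c_def)
  finally have "AE w in Q. \<exists>C. \<forall>n. (\<Sum>i<n. f ((\<tau> ^^ i) w) + c) \<le> C"
    using f by (intro ergodic_sums_bounded_above[OF assms(1) \<tau> inv erg]) auto
  then have "AE w in Q. \<exists>C. \<forall>n. (\<Sum>i<n. f ((\<tau> ^^ i) w)) \<le> C - c * real n"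
    by (rule AE_mp, intro AE_I2 impI) (auto simp: sum.distrib algebra_simps)
  then show ?thesis using c by blast
qed

section \<open>Mixing of the Bernoulli system\<close>

definition time_shift :: "int \<Rightarrow> (int \<Rightarrow> 'b) \<Rightarrow> int \<Rightarrow> 'b" where
  "time_shift k u = (\<lambda>t. u (t + k))"

lemma shift_apply: "time_shift k u t = u (t + k)"
  by (simp add: time_shift_def)

lemma shift_shift: "time_shift j (time_shift k u) = time_shift (j + k) u"
  by (simp add: time_shift_def fun_eq_iff add.assoc)

lemma shift_0: "time_shift 0 u = u"
  by (simp add: time_shift_def fun_eq_iff)

lemma funpow_shift: "(time_shift k ^^ n) u = time_shift (k * int n) u"
  by (induction n) (auto simp: shift_shift algebra_simps shift_0)

lemma measurable_shift [measurable]: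
  "time_shift k \<in> PiM UNIV (\<lambda>_. N) \<rightarrow>\<^sub>M PiM UNIV (\<lambda>_. N)"
  unfolding time_shift_def[abs_def] by (rule measurable_PiM_single') (auto simp: space_PiM PiE_iff)

lemma bernoulli_shift_stationary:
  fixes N :: "'b measure"
  assumes "prob_space N"
  shows "distr (PiM UNIV (\<lambda>_. N)) (PiM UNIV (\<lambda>_. N)) (time_shift k) = PiM UNIV (\<lambda>_. N)"
proof -
  have "distr (PiM UNIV (\<lambda>_::int. N)) (PiM UNIV (\<lambda>_. N)) (\<lambda>\<omega>. \<lambda>i\<in>UNIV. \<omega> (i + k)) = PiM UNIV (\<lambda>_. N)"
    by (rule distr_PiM_reindex) (auto intro: assms inj_onI)
  then show ?thesis by (simp add: time_shift_def[abs_def] restrict_UNIV)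
qed

text \<open>Two cylinders become independent as soon as the shift has separated their finite index sets. The limit passes
to arbitrary events, one argument at a time, by a Dynkin argument; for disjoint unions the limit and
the series are interchanged by Tannery's theorem.\<close>

lemma mixing_bernoulli_shift:
  fixes N :: "'b measure"
  defines "P \<equiv> PiM (UNIV :: int set) (\<lambda>_. N)"
  assumes N: "prob_space N" and A: "A \<in> sets P" and B: "B \<in> sets P"
  shows "(\<lambda>n. measure P (A \<inter> (time_shift (int n) -` B \<inter> space P))) \<longlonglongrightarrow> measure P A * measure P B"
proof -
  interpret N: prob_space N by fact
  interpret product_prob_space "\<lambda>_. N" "UNIV :: int set" by unfold_locales
  interpret Q: prob_space P unfolding P_def by (intro prob_space_PiM N)
  let ?G = "prod_algebra (UNIV :: int set) (\<lambda>_. N)"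
  let ?sh = "\<lambda>n B. time_shift (int n) -` B \<inter> space P"
  have sh_meas[measurable]: "time_shift k \<in> P \<rightarrow>\<^sub>M P" for k unfolding P_def by measurable
  have inv: "measure P (?sh n B) = measure P B" if "B \<in> sets P" for n B
  proof -
    have "distr P P (time_shift (int n)) = P" unfolding P_def by (rule bernoulli_shift_stationary[OF N])
    then show ?thesis using that by (metis measure_distr sh_meas)
  qed
  have setsP: "sets P = sigma_sets (\<Pi>\<^sub>E i\<in>UNIV. space N) ?G"
    unfolding P_def by (rule sets_PiM)
  have spaceP: "space P = (\<Pi>\<^sub>E i\<in>UNIV. space N)" unfolding P_def by (rule space_PiM)
  have clG: "?G \<subseteq> Pow (\<Pi>\<^sub>E i\<in>UNIV. space N)" by (rule prod_algebra_sets_into_space)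
  have rect: "(\<lambda>n. measure P (A \<inter> ?sh n B)) \<longlonglongrightarrow> measure P A * measure P B"
    if AG: "A \<in> ?G" and BG: "B \<in> ?G" for A B
  proof -
    obtain J E where J: "A = prod_emb UNIV (\<lambda>_. N) J (Pi\<^sub>E J E)" "finite J" "\<And>i. i \<in> J \<Longrightarrow> E i \<in> sets N"
      using prod_algebraE[OF AG] by metis
    obtain L F where L: "B = prod_emb UNIV (\<lambda>_. N) L (Pi\<^sub>E L F)" "finite L" "\<And>i. i \<in> L \<Longrightarrow> F i \<in> sets N"
      using prod_algebraE[OF BG] by metis
    obtain b where b: "\<And>i. i \<in> J \<Longrightarrow> \<bar>i\<bar> \<le> b" using that[of "\<Sum>i\<in>J. \<bar>i\<bar>"] J(2) by (simp add: member_le_sum)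
    obtain d where d: "\<And>i. i \<in> L \<Longrightarrow> \<bar>i\<bar> \<le> d" using that[of "\<Sum>i\<in>L. \<bar>i\<bar>"] L(2) by (simp add: member_le_sum)
    have "measure P (A \<inter> ?sh n B) = measure P A * measure P B" if n: "n > nat (b + d)" for n
    proof -
      let ?L = "(\<lambda>i. i + int n) ` L"
      let ?E = "\<lambda>i. if i \<in> J then E i else F (i - int n)"
      have disj: "J \<inter> ?L = {}"
      proof -
        have False if "i \<in> L" "i + int n \<in> J" for i
          using b[OF that(2)] d[OF that(1)] n by linarith
        then show ?thesis by blast
      qed
      have embI: "u \<in> prod_emb UNIV (\<lambda>_. N) I (Pi\<^sub>E I G) \<longleftrightarrow> u \<in> space P \<and> (\<forall>i\<in>I. u i \<in> G i)"
        for I :: "int set" and G u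
      proof -
        have "restrict u I \<in> Pi\<^sub>E I G \<longleftrightarrow> (\<forall>i\<in>I. u i \<in> G i)" by (simp add: PiE_iff)
        then show ?thesis unfolding prod_emb_def spaceP by auto
      qed
      have "A \<inter> ?sh n B = prod_emb UNIV (\<lambda>_. N) (J \<union> ?L) (Pi\<^sub>E (J \<union> ?L) ?E)"
      proof (rule set_eqI)
        fix u
        have E: "(\<forall>i\<in>?L. u i \<in> ?E i) \<longleftrightarrow> (\<forall>i\<in>L. u (i + int n) \<in> F i)"
        proof -
          have "?E (i + int n) = F i" if "i \<in> L" for i
            using disj that by (auto simp: disjoint_iff)
          then have "(\<forall>i\<in>L. u (i + int n) \<in> ?E (i + int n)) \<longleftrightarrow> (\<forall>i\<in>L. u (i + int n) \<in> F i)"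
            by (intro ball_cong refl) (simp only:)
          moreover have "(\<forall>i\<in>?L. u i \<in> ?E i) \<longleftrightarrow> (\<forall>i\<in>L. u (i + int n) \<in> ?E (i + int n))" by blast
          ultimately show ?thesis by (simp only:)
        qed
        show "u \<in> A \<inter> ?sh n B \<longleftrightarrow> u \<in> prod_emb UNIV (\<lambda>_. N) (J \<union> ?L) (Pi\<^sub>E (J \<union> ?L) ?E)"
          using measurable_space[OF sh_meas[of "int n"], of u]
          by (simp only: embI ball_Un E J(1) L(1) Int_iff vimage_eq shift_apply) (use E in \<open>simp, blast\<close>)
      qed
      also have "measure P \<dots> = (\<Prod>i\<in>J \<union> ?L. measure N (?E i))"
        unfolding P_def using J L disj by (subst measure_PiM_emb) auto
      also have "\<dots> = (\<Prod>i\<in>J. measure N (?E i)) * (\<Prod>i\<in>?L. measure N (?E i))"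
        using J L disj by (subst prod.union_disjoint) auto
      also have "(\<Prod>i\<in>J. measure N (?E i)) = measure P A"
        unfolding J(1) P_def using J by (subst measure_PiM_emb) auto
      also have "(\<Prod>i\<in>?L. measure N (?E i)) = (\<Prod>i\<in>L. measure N (F i))"
        using disj by (subst prod.reindex) (auto simp: disjoint_iff intro!: prod.cong inj_onI)
      also have "\<dots> = measure P B"
        unfolding L(1) P_def using L by (subst measure_PiM_emb) auto
      finally show ?thesis .
    qed
    then show ?thesis
      by (intro tendsto_eventually eventually_sequentiallyI[of "Suc (nat (b + d))"]) auto
  qed
  have step: "(\<lambda>n. measure P (A \<inter> ?sh n B)) \<longlonglongrightarrow> measure P A * measure P B"
    if BG: "B \<in> ?G" and A: "A \<in> sets P" for A B
  proof -
    have Bs: "B \<in> sets P" unfolding setsP using BG by (rule sigma_sets.Basic)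
    have "A \<in> sigma_sets (\<Pi>\<^sub>E i\<in>UNIV. space N) ?G" using A setsP by simp
    then show ?thesis
    proof (induction rule: sigma_sets_induct_disjoint[OF Int_stable_prod_algebra clG, consumes 1])
      case (1 A) then show ?case using rect BG by blast
    next
      case 2 then show ?case by simp
    next
      case (3 A)
      then have A[measurable]: "A \<in> sets P" using setsP by simp
      have shB[measurable]: "?sh n B \<in> sets P" for n using Bs by measurable
      have "measure P ((space P - A) \<inter> ?sh n B) = measure P B - measure P (A \<inter> ?sh n B)" for n
      proof -
        have "(space P - A) \<inter> ?sh n B = ?sh n B - (A \<inter> ?sh n B)" by auto
        moreover have "measure P (?sh n B - (A \<inter> ?sh n B)) = measure P (?sh n B) - measure P (A \<inter> ?sh n B)"
          by (intro Q.finite_measure_Diff) auto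
        ultimately show ?thesis using inv[OF Bs, of n] by (simp only:)
      qed
      moreover have "(\<lambda>n. measure P B - measure P (A \<inter> ?sh n B)) \<longlonglongrightarrow> measure P B - measure P A * measure P B"
        by (intro tendsto_intros 3)
      moreover have "measure P B - measure P A * measure P B = measure P (space P - A) * measure P B"
        by (simp add: Q.prob_compl algebra_simps)
      ultimately show ?case using spaceP by simp
    next
      case (4 A)
      then have A: "range A \<subseteq> sets P" "disjoint_family A" using setsP by auto
      have shB[measurable]: "?sh n B \<in> sets P" for n using Bs by measurable
      have Ai: "A i \<in> sets P" for i using A by auto
      have eq: "measure P (\<Union>(range A) \<inter> ?sh n B) = (\<Sum>i. measure P (A i \<inter> ?sh n B))" for n
      proof -
        have "(\<lambda>i. measure P (A i \<inter> ?sh n B)) sums measure P (\<Union>i. A i \<inter> ?sh n B)"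
          using A(2) Ai by (intro Q.finite_measure_UNION) (auto simp: disjoint_family_on_def)
        then show ?thesis by (simp add: sums_iff)
      qed
      have S: "(\<lambda>i. measure P (A i)) sums measure P (\<Union>i. A i)"
        using A by (intro Q.finite_measure_UNION) auto
      have "(\<lambda>n. \<Sum>i. measure P (A i \<inter> ?sh n B)) \<longlonglongrightarrow> (\<Sum>i. measure P (A i) * measure P B)"
      proof (rule tannerys_theorem[where M="\<lambda>i. measure P (A i)", THEN conjunct2, THEN conjunct2])
        show "\<forall>\<^sub>F (i, n) in sequentially \<times>\<^sub>F sequentially. norm (measure P (A i \<inter> ?sh n B)) \<le> measure P (A i)"
          using Ai by (intro always_eventually) (auto intro!: Q.finite_measure_mono)
      qed (use 4 S in \<open>auto simp: sums_iff\<close>)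
      moreover have "(\<Sum>i. measure P (A i) * measure P B) = measure P (\<Union>i. A i) * measure P B"
        using sums_mult2[OF S, of "measure P B"] by (simp add: sums_iff)
      ultimately show ?case by (simp add: eq)
    qed
  qed
  have "B \<in> sigma_sets (\<Pi>\<^sub>E i\<in>UNIV. space N) ?G" using B setsP by simp
  then show ?thesis
  proof (induction rule: sigma_sets_induct_disjoint[OF Int_stable_prod_algebra clG, consumes 1])
    case (1 B) then show ?case using step A by blast
  next
    case 2 then show ?case by simp
  next
    case (3 B)
    then have B[measurable]: "B \<in> sets P" using setsP by simp
    have "measure P (A \<inter> ?sh n (space P - B)) = measure P A - measure P (A \<inter> ?sh n B)" for n
    proof -
      have "A \<inter> ?sh n (space P - B) = A - (A \<inter> ?sh n B)"
        using sets.sets_into_space[OF A] measurable_space[OF sh_meas] by auto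
      moreover have "measure P (A - (A \<inter> ?sh n B)) = measure P A - measure P (A \<inter> ?sh n B)"
        using A by (intro Q.finite_measure_Diff) auto
      ultimately show ?thesis by (simp only:)
    qed
    moreover have "(\<lambda>n. measure P A - measure P (A \<inter> ?sh n B)) \<longlonglongrightarrow> measure P A - measure P A * measure P B"
      by (intro tendsto_intros 3)
    moreover have "measure P A - measure P A * measure P B = measure P A * measure P (space P - B)"
      by (simp add: Q.prob_compl algebra_simps)
    ultimately show ?case using spaceP by simp
  next
    case (4 B)
    then have B: "range B \<subseteq> sets P" "disjoint_family B" using setsP by auto
    have Bi[measurable]: "B i \<in> sets P" for i using B by auto
    have shB[measurable]: "?sh n (B i) \<in> sets P" for n i by measurable
    have eq: "measure P (A \<inter> ?sh n (\<Union>(range B))) = (\<Sum>i. measure P (A \<inter> ?sh n (B i)))" for n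
    proof -
      have "(\<lambda>i. measure P (A \<inter> ?sh n (B i))) sums measure P (\<Union>i. A \<inter> ?sh n (B i))"
        using B(2) A by (intro Q.finite_measure_UNION) (auto simp: disjoint_family_on_def)
      moreover have "(\<Union>i. A \<inter> ?sh n (B i)) = A \<inter> ?sh n (\<Union>(range B))" by auto
      ultimately show ?thesis by (simp add: sums_iff)
    qed
    have S: "(\<lambda>i. measure P (B i)) sums measure P (\<Union>i. B i)"
      using B by (intro Q.finite_measure_UNION) auto
    have "(\<lambda>n. \<Sum>i. measure P (A \<inter> ?sh n (B i))) \<longlonglongrightarrow> (\<Sum>i. measure P A * measure P (B i))"
    proof (rule tannerys_theorem[where M="\<lambda>i. measure P (B i)", THEN conjunct2, THEN conjunct2])
      have "measure P (A \<inter> ?sh n (B i)) \<le> measure P (B i)" for n i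
        using inv[OF Bi, of n i] A by (metis Q.finite_measure_mono inf_le2 shB)
      then show "\<forall>\<^sub>F (i, n) in sequentially \<times>\<^sub>F sequentially. norm (measure P (A \<inter> ?sh n (B i))) \<le> measure P (B i)"
        by (intro always_eventually) auto
    qed (use 4 S in \<open>auto simp: sums_iff\<close>)
    moreover have "(\<Sum>i. measure P A * measure P (B i)) = measure P A * measure P (\<Union>i. B i)"
      using sums_mult[OF S, of "measure P A"] by (simp add: sums_iff)
    ultimately show ?case by (simp add: eq)
  qed
qed

text \<open>Mixing of the event with itself along multiples of \<open>k\<close> gives \<open>p = p * p\<close> for its probability.\<close>

lemma bernoulli_shift_invariant_event:
  fixes N :: "'b measure"
  defines "P \<equiv> PiM (UNIV :: int set) (\<lambda>_. N)"
  assumes N: "prob_space N" and B: "B \<in> sets P" and k: "k \<ge> 1"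
    and inv: "AE u in P. time_shift (int k) u \<in> B \<longleftrightarrow> u \<in> B"
  shows "measure P B = 0 \<or> measure P B = 1"
proof -
  interpret Q: prob_space P unfolding P_def using N by (intro prob_space_PiM) auto
  have sh[measurable]: "time_shift j \<in> P \<rightarrow>\<^sub>M P" for j unfolding P_def by measurable
  have D: "distr P P (time_shift j) = P" for j unfolding P_def by (rule bernoulli_shift_stationary[OF N])
  have invn: "AE u in P. time_shift (int (k * n)) u \<in> B \<longleftrightarrow> u \<in> B" for n
  proof (induction n)
    case 0 show ?case by (simp add: shift_0)
  next
    case (Suc n)
    have "AE u in distr P P (time_shift (int (k * n))). time_shift (int k) u \<in> B \<longleftrightarrow> u \<in> B" unfolding D by (rule inv)
    then have "AE u in P. time_shift (int k) (time_shift (int (k * n)) u) \<in> B \<longleftrightarrow> time_shift (int (k * n)) u \<in> B"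
      by (rule AE_distrD[rotated]) simp
    moreover have "int (k * Suc n) = int k + int (k * n)" by simp
    ultimately show ?case using Suc.IH by (auto simp only: shift_shift elim!: eventually_elim2)
  qed
  have "measure P (B \<inter> (time_shift (int (k * n)) -` B \<inter> space P)) = measure P B" for n
  proof (rule Q.finite_measure_eq_AE)
    show "AE u in P. u \<in> B \<inter> (time_shift (int (k * n)) -` B \<inter> space P) \<longleftrightarrow> u \<in> B"
      using invn[of n] AE_space by eventually_elim auto
  qed (auto intro!: sets.Int measurable_sets[OF sh] B)
  moreover have "(\<lambda>n. measure P (B \<inter> (time_shift (int (k * n)) -` B \<inter> space P))) \<longlonglongrightarrow> measure P B * measure P B"
    using LIMSEQ_subseq_LIMSEQ[OF mixing_bernoulli_shift[OF N, folded P_def, OF B B], of "\<lambda>n. k * n"] k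
    by (simp add: comp_def strict_mono_def)
  ultimately have "measure P B = measure P B * measure P B"
    by (simp add: LIMSEQ_const_iff)
  then have "measure P B * (1 - measure P B) = 0" by (simp only: right_diff_distrib)
  then show ?thesis by simp
qed

section \<open>Paths as real numbers\<close>

definition rat_enum :: "nat \<Rightarrow> real" where
  "rat_enum n = real_of_rat (from_nat_into UNIV n)"

lemma rat_enum_between: "(a::real) < b \<Longrightarrow> \<exists>n. a < rat_enum n \<and> rat_enum n < b"
proof -
  assume "a < b"
  then obtain q where q: "a < real_of_rat q" "real_of_rat q < b" using of_rat_dense by blast
  have "\<exists>n. from_nat_into (UNIV :: rat set) n = q"
    by (metis UNIV_I UNIV_not_empty countableI_type from_nat_into_surj)
  then show ?thesis using q unfolding rat_enum_def by metis
qed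

text \<open>A path is determined by the countably many truth values of \<open>u t < q\<close> with rational \<open>q\<close>. They are stored as the
digits of a number in base 3; as the digit 2 does not occur, the tail after the leading digit is less than 1 and
the leading digit can be read off by comparison with 1.\<close>

definition path_bit :: "(int \<Rightarrow> real) \<Rightarrow> nat \<Rightarrow> bool" where
  "path_bit u n \<longleftrightarrow> (case prod_decode n of (i, j) \<Rightarrow> u (int_decode i) < rat_enum j)"

definition encode_path :: "(int \<Rightarrow> real) \<Rightarrow> real" where
  "encode_path u = (\<Sum>n. of_bool (path_bit u n) / 3 ^ n)"

text \<open>The digits from position \<open>n\<close> on, read as a number.\<close>

primrec remainder :: "nat \<Rightarrow> real \<Rightarrow> real" where
  "remainder 0 v = v"
| "remainder (Suc n) v = 3 * (remainder n v - of_bool (1 \<le> remainder n v))"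

definition decode_path :: "real \<Rightarrow> int \<Rightarrow> real" where
  "decode_path v t = real_of_ereal (INF j. if 1 \<le> remainder (prod_encode (int_encode t, j)) v then ereal (rat_enum j) else \<infinity>)"

lemma summable_bits: "summable (\<lambda>n. of_bool (b n) / 3 ^ n :: real)"
  by (rule summable_comparison_test'[of "\<lambda>n. (1/3)^n" 0])
     (use summable_geometric[of "1 / 3 :: real"] in \<open>auto simp: power_one_over inverse_eq_divide of_bool_def\<close>)

lemma bits_le: "(\<Sum>n. of_bool (b n) / 3 ^ n :: real) \<le> 3 / 2"
proof -
  have "(\<Sum>n. of_bool (b n) / 3 ^ n :: real) \<le> (\<Sum>n. (1/3) ^ n)"
    by (rule suminf_le[OF _ summable_bits]) (use summable_geometric[of "1 / 3 :: real"] in \<open>auto simp: power_one_over inverse_eq_divide of_bool_def\<close>)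
  also have "\<dots> = 3 / 2" by (subst suminf_geometric) auto
  finally show ?thesis .
qed

lemma bits_nonneg: "0 \<le> (\<Sum>n. of_bool (b n) / 3 ^ n :: real)"
  by (rule suminf_nonneg[OF summable_bits]) auto

lemma bits_split:
  "(\<Sum>n. of_bool (b n) / 3 ^ n :: real) = of_bool (b 0) + (\<Sum>n. of_bool (b (Suc n)) / 3 ^ n) / 3"
proof -
  have "(\<Sum>n. of_bool (b (Suc n)) / 3 ^ Suc n :: real) = (\<Sum>n. (of_bool (b (Suc n)) / 3 ^ n) / 3)"
    by (rule suminf_cong) simp
  also have "\<dots> = (\<Sum>n. of_bool (b (Suc n)) / 3 ^ n) / 3"
    by (rule suminf_divide[OF summable_bits])
  finally show ?thesis using suminf_split_head[OF summable_bits, of b] by simp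
qed

lemma bit_iff_one_le_bits:
  "b 0 \<longleftrightarrow> 1 \<le> (\<Sum>n. of_bool (b n) / 3 ^ n :: real)"
  using bits_le[of "\<lambda>n. b (Suc n)"] bits_nonneg[of "\<lambda>n. b (Suc n)"] bits_split[of b] by auto

lemma remainder_bits:
  "remainder n (\<Sum>k. of_bool (b k) / 3 ^ k) = (\<Sum>k. of_bool (b (n + k)) / 3 ^ k)"
proof (induction n)
  case (Suc n)
  show ?case
    using bits_split[of "\<lambda>k. b (n + k)"] bit_iff_one_le_bits[of "\<lambda>k. b (n + k)"]
    by (auto simp: Suc)
qed simp

lemma decode_encode_path: "decode_path (encode_path u) = u"
proof
  fix t
  have "1 \<le> remainder (prod_encode (int_encode t, j)) (encode_path u) \<longleftrightarrow> u t < rat_enum j" for j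
    using bit_iff_one_le_bits[of "\<lambda>k. path_bit u (prod_encode (int_encode t, j) + k)"]
    by (simp add: encode_path_def remainder_bits path_bit_def)
  then have "decode_path (encode_path u) t = real_of_ereal (INF j. if u t < rat_enum j then ereal (rat_enum j) else \<infinity>)"
    unfolding decode_path_def by simp
  also have "(INF j. if u t < rat_enum j then ereal (rat_enum j) else \<infinity>) = ereal (u t)"
  proof (rule antisym)
    show "ereal (u t) \<le> (INF j. if u t < rat_enum j then ereal (rat_enum j) else \<infinity>)"
      by (rule INF_greatest) auto
    show "(INF j. if u t < rat_enum j then ereal (rat_enum j) else \<infinity>) \<le> ereal (u t)"
    proof (rule ereal_le_epsilon2)
      fix e :: real assume "0 < e"
      then obtain j where j: "u t < rat_enum j" "rat_enum j < u t + e"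
        using rat_enum_between[of "u t" "u t + e"] by auto
      have "(INF j. if u t < rat_enum j then ereal (rat_enum j) else \<infinity>)
          \<le> (if u t < rat_enum j then ereal (rat_enum j) else \<infinity>)"
        by (rule INF_lower) simp
      also have "\<dots> \<le> ereal (u t) + ereal e" using j by simp
      finally show "(INF j. if u t < rat_enum j then ereal (rat_enum j) else \<infinity>) \<le> ereal (u t) + ereal e" .
    qed
  qed
  finally show "decode_path (encode_path u) t = u t" by simp
qed

lemma measurable_encode_path [measurable]:
  "encode_path \<in> borel_measurable (PiM UNIV (\<lambda>_::int. borel :: real measure))"
proof -
  have "(\<lambda>u. path_bit u n) \<in> measurable (PiM UNIV (\<lambda>_::int. borel :: real measure)) (count_space UNIV)" for n
    unfolding path_bit_def by (cases "prod_decode n") (simp, measurable)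
  note [measurable] = this
  show ?thesis unfolding encode_path_def[abs_def] by measurable
qed

lemma measurable_remainder [measurable]: "remainder n \<in> borel_measurable borel"
  by (induction n) auto

lemma measurable_decode_path [measurable]:
  "decode_path \<in> borel \<rightarrow>\<^sub>M (PiM UNIV (\<lambda>_::int. borel :: real measure))"
proof (rule measurable_PiM_single')
  fix t :: int
  show "(\<lambda>v. decode_path v t) \<in> borel_measurable borel"
    unfolding decode_path_def by measurable
qed auto

lemma encode_path_range: "0 \<le> encode_path u" "encode_path u \<le> 3 / 2"
  unfolding encode_path_def by (rule bits_nonneg bits_le)+

section \<open>Random variables determined by their conditional law\<close>

text \<open>Half-lines determine a law on the real line, so the inner condition says that \<open>V'\<close> and \<open>V\<close> have the same
conditional law given \<open>G\<close>.\<close>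

definition conditionally_rigid :: "'a measure \<Rightarrow> 'a measure \<Rightarrow> ('a \<Rightarrow> real) \<Rightarrow> bool" where
  "conditionally_rigid M G V \<longleftrightarrow>
     (\<forall>V'\<in>borel_measurable M.
        (\<forall>C\<in>sets G. \<forall>x. measure M (C \<inter> {\<omega> \<in> space M. x < V' \<omega>}) = measure M (C \<inter> {\<omega> \<in> space M. x < V \<omega>})) \<longrightarrow>
        (AE \<omega> in M. V' \<omega> = V \<omega>))"

text \<open>Conditional probabilities are monotone in the threshold only up to null sets. Taking the supremum over all smaller
thresholds makes them monotone everywhere without changing them almost surely.\<close>

lemma conditional_distribution_function:
  fixes V :: "'a \<Rightarrow> real" and q :: "nat \<Rightarrow> real"
  assumes "prob_space M" and sub: "subalgebra M G" and V[measurable]: "V \<in> borel_measurable M"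
  shows "\<exists>F :: nat \<Rightarrow> 'a \<Rightarrow> real. (\<forall>n. F n \<in> borel_measurable G) \<and> (\<forall>n \<omega>. 0 \<le> F n \<omega> \<and> F n \<omega> \<le> 1) \<and>
    (\<forall>n m \<omega>. q n \<le> q m \<longrightarrow> F n \<omega> \<le> F m \<omega>) \<and>
    (\<forall>n. \<forall>C\<in>sets G. measure M (C \<inter> {\<omega> \<in> space M. V \<omega> \<le> q n}) = (\<integral>\<omega>. F n \<omega> * indicator C \<omega> \<partial>M))"
proof -
  interpret prob_space M by fact
  interpret finite_measure_subalgebra M G by unfold_locales (rule sub)
  let ?I = "\<lambda>n \<omega>. indicator {\<omega> \<in> space M. V \<omega> \<le> q n} \<omega> :: real"
  have I_int: "integrable M (?I n)" for n
    by (intro integrable_real_indicator) (auto simp: less_top[symmetric])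
  define E where "E n = real_cond_exp M G (?I n)" for n
  have E_meas[measurable]: "E n \<in> borel_measurable G" for n unfolding E_def by (rule borel_measurable_cond_exp)
  have E01: "AE \<omega> in M. \<forall>n. 0 \<le> E n \<omega> \<and> E n \<omega> \<le> 1"
  proof (subst AE_all_countable, intro allI AE_conjI)
    fix n
    show "AE \<omega> in M. 0 \<le> E n \<omega>" unfolding E_def
      by (rule real_cond_exp_ge_c[OF I_int]) auto
    show "AE \<omega> in M. E n \<omega> \<le> 1" unfolding E_def
      by (rule real_cond_exp_le_c[OF I_int]) auto
  qed
  have Emono: "AE \<omega> in M. \<forall>n m. q m \<le> q n \<longrightarrow> E m \<omega> \<le> E n \<omega>"
  proof (subst AE_all_countable, intro allI, subst AE_all_countable, intro allI)
    fix n m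
    show "AE \<omega> in M. q m \<le> q n \<longrightarrow> E m \<omega> \<le> E n \<omega>"
    proof (cases "q m \<le> q n")
      case True
      have "AE \<omega> in M. E m \<omega> \<le> E n \<omega>" unfolding E_def
        by (rule real_cond_exp_mono[OF _ I_int I_int]) (use True in \<open>auto simp: indicator_def\<close>)
      then show ?thesis by eventually_elim simp
    qed simp
  qed
  define H where "H n \<omega> = max 0 (min 1 (E n \<omega>))" for n \<omega>
  define F where "F n \<omega> = (SUP m\<in>{m. q m \<le> q n}. H m \<omega>)" for n \<omega>
  have H: "0 \<le> H n \<omega>" "H n \<omega> \<le> 1" for n \<omega> by (auto simp: H_def)
  have bdd: "bdd_above ((\<lambda>m. H m \<omega>) ` {m. q m \<le> q n})" for n \<omega>
    by (rule bdd_aboveI2[where M=1]) (rule H)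
  have H_meas[measurable]: "H n \<in> borel_measurable G" for n unfolding H_def[abs_def] by measurable
  have F_meas: "F n \<in> borel_measurable G" for n
    unfolding F_def[abs_def] by (rule borel_measurable_cSUP) (use bdd in auto)
  have F0: "0 \<le> F n \<omega>" for n \<omega>
    unfolding F_def by (rule order_trans[OF H(1)[of n] cSUP_upper[OF _ bdd]]) simp
  have F1: "F n \<omega> \<le> 1" for n \<omega>
    unfolding F_def by (rule cSUP_least) (auto simp: H)
  have FE: "AE \<omega> in M. F n \<omega> = E n \<omega>" for n
    using E01 Emono
  proof eventually_elim
    case (elim \<omega>)
    then have HE: "H m \<omega> = E m \<omega>" for m unfolding H_def by auto
    have "F n \<omega> \<le> E n \<omega>" unfolding F_def HE using elim by (intro cSUP_least) auto
    moreover have "H n \<omega> \<le> F n \<omega>" unfolding F_def by (rule cSUP_upper[OF _ bdd]) simp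
    ultimately show ?case using HE by simp
  qed
  show ?thesis
  proof (intro exI[of _ F] conjI allI ballI impI)
    show "F n \<in> borel_measurable G" "0 \<le> F n \<omega>" "F n \<omega> \<le> 1" for n \<omega> by (fact F_meas F0 F1)+
    show "F n \<omega> \<le> F m \<omega>" if "q n \<le> q m" for n m \<omega>
      unfolding F_def by (rule cSUP_subset_mono[OF _ bdd]) (use that in auto)
    fix n C assume C: "C \<in> sets G"
    have [measurable]: "C \<in> sets M" using C sub by (auto simp: subalgebra_def)
    have [measurable]: "F n \<in> borel_measurable M" using F_meas sub by (rule measurable_from_subalg[rotated])
    have [measurable]: "E n \<in> borel_measurable M" using E_meas sub by (rule measurable_from_subalg[rotated])
    have "measure M (C \<inter> {\<omega> \<in> space M. V \<omega> \<le> q n}) = (\<integral>\<omega>. indicator (C \<inter> {\<omega> \<in> space M. V \<omega> \<le> q n}) \<omega> \<partial>M)"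
      by simp
    also have "\<dots> = (LINT \<omega>:C|M. ?I n \<omega>)"
      unfolding set_lebesgue_integral_def by (rule Bochner_Integration.integral_cong) (auto simp: indicator_def)
    also have "\<dots> = (LINT \<omega>:C|M. E n \<omega>)" unfolding E_def by (rule real_cond_exp_intA[OF I_int C])
    also have "\<dots> = (\<integral>\<omega>. F n \<omega> * indicator C \<omega> \<partial>M)"
      unfolding set_lebesgue_integral_def
      by (rule integral_cong_AE) (use FE[of n] in \<open>auto simp: mult.commute\<close>)
    finally show "measure M (C \<inter> {\<omega> \<in> space M. V \<omega> \<le> q n}) = (\<integral>\<omega>. F n \<omega> * indicator C \<omega> \<partial>M)" .
  qed
qed

text \<open>The hypothesis says that \<open>U\<close> is uniform and independent of \<open>G\<close>. The random threshold is rounded up to a multiple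
of \<open>1 / N\<close>, which splits \<open>C\<close> into finitely many \<open>G\<close>-measurable pieces with constant threshold; rounding up makes the
events converge everywhere as \<open>N\<close> grows.\<close>

lemma uniform_independent_threshold:
  fixes U R :: "'a \<Rightarrow> real"
  assumes "prob_space M" and sub: "subalgebra M G"
    and U[measurable]: "U \<in> borel_measurable M" and R: "R \<in> borel_measurable G"
    and R01: "\<And>\<omega>. 0 \<le> R \<omega>" "\<And>\<omega>. R \<omega> \<le> 1"
    and unif: "\<And>C u. C \<in> sets G \<Longrightarrow> 0 \<le> u \<Longrightarrow> u \<le> 1 \<Longrightarrow> measure M (C \<inter> {\<omega> \<in> space M. U \<omega> \<le> u}) = u * measure M C"
    and C: "C \<in> sets G"
  shows "measure M (C \<inter> {\<omega> \<in> space M. U \<omega> \<le> R \<omega>}) = (\<integral>\<omega>. R \<omega> * indicator C \<omega> \<partial>M)"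
proof -
  interpret prob_space M by fact
  have GM: "A \<in> sets G \<Longrightarrow> A \<in> sets M" for A using sub by (auto simp: subalgebra_def)
  have spG: "space G = space M" using sub by (simp add: subalgebra_def)
  have RM[measurable]: "R \<in> borel_measurable M" by (rule measurable_from_subalg[OF sub R])
  note [measurable] = R
  have CM[measurable]: "C \<in> sets M" using GM[OF C] .
  define k where "k N \<omega> = \<lceil>real (Suc N) * R \<omega>\<rceil>" for N \<omega>
  define RN where "RN N \<omega> = real_of_int (k N \<omega>) / real (Suc N)" for N \<omega>
  have k_range: "0 \<le> k N \<omega>" "k N \<omega> \<le> int (Suc N)" for N \<omega>
  proof -
    show "0 \<le> k N \<omega>" unfolding k_def using mult_nonneg_nonneg[OF of_nat_0_le_iff R01(1)[of \<omega>], of "Suc N"]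
      by linarith
    have "real (Suc N) * R \<omega> \<le> real (Suc N) * 1" using R01(2)[of \<omega>] by (intro mult_left_mono) auto
    then show "k N \<omega> \<le> int (Suc N)" unfolding k_def by (simp add: ceiling_le_iff)
  qed
  have RN_ge: "R \<omega> \<le> RN N \<omega>" for N \<omega>
    using le_of_int_ceiling[of "real (Suc N) * R \<omega>"] unfolding RN_def k_def
    by (simp add: pos_le_divide_eq mult.commute)
  have RN_le: "RN N \<omega> \<le> R \<omega> + 1 / real (Suc N)" for N \<omega>
  proof -
    have "real_of_int (k N \<omega>) \<le> real (Suc N) * R \<omega> + 1" unfolding k_def by linarith
    then have "real_of_int (k N \<omega>) / real (Suc N) \<le> (real (Suc N) * R \<omega> + 1) / real (Suc N)"
      by (intro divide_right_mono) auto
    also have "\<dots> = R \<omega> + 1 / real (Suc N)" by (simp add: add_divide_distrib)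
    finally show ?thesis unfolding RN_def .
  qed
  have RN_lim: "(\<lambda>N. RN N \<omega>) \<longlonglongrightarrow> R \<omega>" for \<omega>
  proof (rule tendsto_sandwich[of "\<lambda>_. R \<omega>" _ _ "\<lambda>N. R \<omega> + 1 / real (Suc N)"])
    have "(\<lambda>N. R \<omega> + 1 / real (Suc N)) \<longlonglongrightarrow> R \<omega> + 0"
      by (intro tendsto_add tendsto_const LIMSEQ_inverse_real_of_nat[unfolded inverse_eq_divide])
    then show "(\<lambda>N. R \<omega> + 1 / real (Suc N)) \<longlonglongrightarrow> R \<omega>" by simp
  qed (intro always_eventually allI RN_ge RN_le tendsto_const)+
  have RN_meas[measurable]: "RN N \<in> borel_measurable M" for N
    unfolding RN_def[abs_def] k_def by measurable
  have RN_bound: "0 \<le> RN N \<omega>" "RN N \<omega> \<le> 2" for N \<omega>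
  proof -
    show "0 \<le> RN N \<omega>" using R01(1)[of \<omega>] RN_ge[of \<omega> N] by linarith
    have "1 / real (Suc N) \<le> 1" by simp
    then show "RN N \<omega> \<le> 2" using R01(2)[of \<omega>] RN_le[of N \<omega>] by linarith
  qed
  let ?U = "\<lambda>u. {\<omega> \<in> space M. U \<omega> \<le> u}"
  have discrete: "measure M (C \<inter> {\<omega> \<in> space M. U \<omega> \<le> RN N \<omega>}) = (\<integral>\<omega>. RN N \<omega> * indicator C \<omega> \<partial>M)" for N
  proof -
    let ?J = "{0..int (Suc N)}"
    define K where "K j = C \<inter> {\<omega> \<in> space M. k N \<omega> = j}" for j
    have KG: "K j \<in> sets G" for j
    proof -
      have "{\<omega> \<in> space G. k N \<omega> = j} \<in> sets G" unfolding k_def by measurable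
      then show ?thesis unfolding K_def spG[symmetric] using C by blast
    qed
    note KM[measurable] = GM[OF KG]
    have disj: "disjoint_family_on K ?J" by (auto simp: disjoint_family_on_def K_def)
    have "C \<inter> {\<omega> \<in> space M. U \<omega> \<le> RN N \<omega>} = (\<Union>j\<in>?J. K j \<inter> ?U (real_of_int j / real (Suc N)))"
      using k_range by (auto simp: K_def RN_def)
    also have "measure M \<dots> = (\<Sum>j\<in>?J. measure M (K j \<inter> ?U (real_of_int j / real (Suc N))))"
      using disj by (intro finite_measure_finite_Union) (auto simp: disjoint_family_on_def)
    also have "\<dots> = (\<Sum>j\<in>?J. (real_of_int j / real (Suc N)) * measure M (K j))"
      by (intro sum.cong refl unif KG) (auto simp: divide_simps)
    also have "\<dots> = (\<Sum>j\<in>?J. (\<integral>\<omega>. real_of_int j / real (Suc N) * indicator (K j) \<omega> \<partial>M))"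
      by (intro sum.cong refl) simp
    also have "\<dots> = (\<integral>\<omega>. (\<Sum>j\<in>?J. real_of_int j / real (Suc N) * indicator (K j) \<omega>) \<partial>M)"
      by (intro Bochner_Integration.integral_sum[symmetric] integrable_real_mult_indicator) auto
    also have "\<dots> = (\<integral>\<omega>. RN N \<omega> * indicator C \<omega> \<partial>M)"
    proof (rule Bochner_Integration.integral_cong[OF refl])
      fix \<omega> assume w: "\<omega> \<in> space M"
      have "(\<Sum>j\<in>?J. real_of_int j / real (Suc N) * indicator (K j) \<omega>)
          = (\<Sum>j\<in>{k N \<omega>}. real_of_int j / real (Suc N) * indicator (K j) \<omega>)"
        using k_range by (intro sum.mono_neutral_right) (auto simp: K_def)
      also have "\<dots> = RN N \<omega> * indicator C \<omega>" using w by (auto simp: K_def RN_def indicator_def)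
      finally show "(\<Sum>j\<in>?J. real_of_int j / real (Suc N) * indicator (K j) \<omega>) = RN N \<omega> * indicator C \<omega>" .
    qed
    finally show ?thesis .
  qed
  have "(\<lambda>N. (\<integral>\<omega>. RN N \<omega> * indicator C \<omega> \<partial>M)) \<longlonglongrightarrow> (\<integral>\<omega>. R \<omega> * indicator C \<omega> \<partial>M)"
  proof (rule integral_dominated_convergence[where w="\<lambda>_. 2"])
    show "AE \<omega> in M. (\<lambda>N. RN N \<omega> * indicator C \<omega>) \<longlonglongrightarrow> R \<omega> * indicator C \<omega>"
      by (intro AE_I2 tendsto_mult RN_lim tendsto_const)
    show "AE \<omega> in M. norm (RN N \<omega> * indicator C \<omega>) \<le> 2" for N
      using RN_bound by (intro AE_I2) (auto simp: indicator_def)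
  qed auto
  moreover have "(\<lambda>N. (\<integral>\<omega>. RN N \<omega> * indicator C \<omega> \<partial>M)) \<longlonglongrightarrow> measure M (C \<inter> {\<omega> \<in> space M. U \<omega> \<le> R \<omega>})"
  proof -
    have "(\<lambda>N. (\<integral>\<omega>. indicator (C \<inter> {\<omega> \<in> space M. U \<omega> \<le> RN N \<omega>}) \<omega> \<partial>M)) \<longlonglongrightarrow>
        (\<integral>\<omega>. indicator (C \<inter> {\<omega> \<in> space M. U \<omega> \<le> R \<omega>}) \<omega> \<partial>M :: real)"
    proof (rule integral_dominated_convergence[where w="\<lambda>_. 1"])
      show "AE \<omega> in M. (\<lambda>N. indicator (C \<inter> {\<omega> \<in> space M. U \<omega> \<le> RN N \<omega>}) \<omega>) \<longlonglongrightarrow>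
          (indicator (C \<inter> {\<omega> \<in> space M. U \<omega> \<le> R \<omega>}) \<omega> :: real)"
      proof (intro AE_I2 tendsto_eventually)
        fix \<omega> assume w: "\<omega> \<in> space M"
        show "\<forall>\<^sub>F N in sequentially. indicator (C \<inter> {\<omega> \<in> space M. U \<omega> \<le> RN N \<omega>}) \<omega> =
          (indicator (C \<inter> {\<omega> \<in> space M. U \<omega> \<le> R \<omega>}) \<omega> :: real)"
        proof (cases "U \<omega> \<le> R \<omega>")
          case True
          then show ?thesis using RN_ge[of \<omega>] order_trans[OF True RN_ge] by (auto simp: indicator_def)
        next
          case False
          then have "\<forall>\<^sub>F N in sequentially. RN N \<omega> < U \<omega>"
            by (intro order_tendstoD[OF RN_lim]) simp
          then show ?thesis by eventually_elim (use False in \<open>auto simp: indicator_def\<close>)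
        qed
      qed
    qed auto
    then show ?thesis unfolding discrete[symmetric] by simp
  qed
  ultimately show ?thesis by (rule LIMSEQ_unique[rotated])
qed


text \<open>If no \<open>G\<close>-measurable \<open>p\<close> is hit with positive probability, the conditional law of \<open>V\<close> is atomless. The conditional
rank \<open>U\<close> of \<open>V\<close> is then uniform and independent of \<open>G\<close>, and so is \<open>1 - U\<close>. The conditional quantile \<open>V'\<close> of
\<open>1 - U\<close> therefore has the conditional law of \<open>V\<close>, and rigidity forces \<open>V' = V\<close>. But then the rank is at most its own
reflection, which means \<open>U \<le> 1 / 2\<close>, an event of probability one half only.\<close>

lemma rigid_imp_atom:
  fixes V :: "'a \<Rightarrow> real"
  assumes "prob_space M" and sub: "subalgebra M G" and V[measurable]: "V \<in> borel_measurable M"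
    and range: "\<And>\<omega>. a \<le> V \<omega>" "\<And>\<omega>. V \<omega> \<le> b"
    and rigid: "conditionally_rigid M G V"
  shows "\<exists>p\<in>borel_measurable G. measure M {\<omega> \<in> space M. V \<omega> = p \<omega>} \<noteq> 0"
proof (rule ccontr)
  assume "\<not> ?thesis"
  then have null: "measure M {\<omega> \<in> space M. V \<omega> = p \<omega>} = 0" if "p \<in> borel_measurable G" for p
    using that by blast
  interpret prob_space M by fact
  have GM: "A \<in> sets G \<Longrightarrow> A \<in> sets M" for A using sub by (auto simp: subalgebra_def)
  have spG: "space G = space M" using sub by (simp add: subalgebra_def)
  obtain F where F: "\<And>n. F n \<in> borel_measurable G" "\<And>n \<omega>. 0 \<le> F n \<omega> \<and> F n \<omega> \<le> 1"
    and Fmono: "\<And>n m \<omega>. rat_enum n \<le> rat_enum m \<Longrightarrow> F n \<omega> \<le> F m \<omega>"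
    and Fint: "\<And>n C. C \<in> sets G \<Longrightarrow> measure M (C \<inter> {\<omega> \<in> space M. V \<omega> \<le> rat_enum n}) = (\<integral>\<omega>. F n \<omega> * indicator C \<omega> \<partial>M)"
    using conditional_distribution_function[OF assms(1) sub V, of rat_enum] by blast
  have FG[measurable]: "F n \<in> borel_measurable G" and F01: "0 \<le> F n \<omega>" "F n \<omega> \<le> 1" for n \<omega>
    using F by blast+
  let ?q = rat_enum
  have FM[measurable]: "F n \<in> borel_measurable M" for n by (rule measurable_from_subalg[OF sub FG])
  have FC_int: "integrable M (\<lambda>\<omega>. F n \<omega> * indicator C \<omega>)" if "C \<in> sets G" for n C
    by (rule integrable_const_bound[of _ 1]) (use F01 GM[OF that] in \<open>auto simp: indicator_def\<close>)
  have FC_compl: "measure M (C \<inter> {\<omega> \<in> space M. ?q n < V \<omega>}) = (\<integral>\<omega>. (1 - F n \<omega>) * indicator C \<omega> \<partial>M)"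
    if C: "C \<in> sets G" for n C
  proof -
    have [measurable]: "C \<in> sets M" by (rule GM[OF C])
    have "C \<inter> {\<omega> \<in> space M. ?q n < V \<omega>} = C - C \<inter> {\<omega> \<in> space M. V \<omega> \<le> ?q n}"
      using sets.sets_into_space[OF GM[OF C]] by auto
    then have "measure M (C \<inter> {\<omega> \<in> space M. ?q n < V \<omega>}) = measure M C - (\<integral>\<omega>. F n \<omega> * indicator C \<omega> \<partial>M)"
      using Fint[OF C] by (simp add: finite_measure_Diff)
    also have "\<dots> = (\<integral>\<omega>. indicator C \<omega> \<partial>M) - (\<integral>\<omega>. F n \<omega> * indicator C \<omega> \<partial>M)" by simp
    also have "\<dots> = (\<integral>\<omega>. indicator C \<omega> - F n \<omega> * indicator C \<omega> \<partial>M)"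
      using FC_int[OF C] by (intro Bochner_Integration.integral_diff[symmetric]) (auto simp: less_top[symmetric])
    also have "\<dots> = (\<integral>\<omega>. (1 - F n \<omega>) * indicator C \<omega> \<partial>M)" by (simp add: algebra_simps)
    finally show ?thesis .
  qed
  have integral_le: "(\<integral>\<omega>. f \<omega> * indicator C \<omega> \<partial>M) \<le> u * measure M C"
    if "C \<in> sets G" "integrable M (\<lambda>\<omega>. f \<omega> * indicator C \<omega>)" "\<And>\<omega>. \<omega> \<in> C \<Longrightarrow> f \<omega> \<le> u" for f :: "'a \<Rightarrow> real" and C u
  proof -
    have "(\<integral>\<omega>. f \<omega> * indicator C \<omega> \<partial>M) \<le> (\<integral>\<omega>. u * indicator C \<omega> \<partial>M)"
    proof (rule integral_mono[OF that(2)])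
      show "integrable M (\<lambda>\<omega>. u * indicator C \<omega> :: real)"
        using GM[OF that(1)] by (intro integrable_real_mult_indicator) auto
    qed (use that(3) in \<open>auto simp: indicator_def\<close>)
    then show ?thesis using GM[OF that(1)] by simp
  qed
  have split: "measure M C = measure M (C \<inter> D) + measure M (C - D)" if "C \<in> sets G" "D \<in> sets G" for C D
  proof -
    have "measure M ((C \<inter> D) \<union> (C - D)) = measure M (C \<inter> D) + measure M (C - D)"
      using GM[OF that(1)] GM[OF that(2)] by (intro finite_measure_Union) auto
    then show ?thesis by (simp add: Int_Diff_Un)
  qed
  \<comment> \<open>The pieces are peeled off at the largest threshold: where it is admissible, it absorbs all others.\<close>
  have below_fin: "measure M (C \<inter> {\<omega> \<in> space M. \<exists>n\<in>J. V \<omega> \<le> ?q n \<and> F n \<omega> \<le> u}) \<le> u * measure M C"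
    if "finite J" "C \<in> sets G" "0 \<le> u" for J C u
    using that(1,2)
  proof (induction J arbitrary: C rule: finite_ranking_induct[where f="?q"])
    case empty
    then show ?case using \<open>0 \<le> u\<close> by simp
  next
    case (insert n J)
    let ?A = "\<lambda>J. {\<omega> \<in> space M. \<exists>n\<in>J. V \<omega> \<le> ?q n \<and> F n \<omega> \<le> u}"
    define D where "D = {\<omega> \<in> space G. F n \<omega> \<le> u}"
    have D: "D \<in> sets G" unfolding D_def by measurable
    have CD: "C \<inter> D \<in> sets G" "C - D \<in> sets G" using insert.prems D by auto
    have "C \<inter> ?A (insert n J) = ((C \<inter> D) \<inter> {\<omega> \<in> space M. V \<omega> \<le> ?q n}) \<union> ((C - D) \<inter> ?A J)"
      using insert.hyps(2) sets.sets_into_space[OF insert.prems] unfolding D_def spG by force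
    also have "measure M \<dots> = measure M ((C \<inter> D) \<inter> {\<omega> \<in> space M. V \<omega> \<le> ?q n}) + measure M ((C - D) \<inter> ?A J)"
      using GM[OF CD(1)] GM[OF CD(2)] insert.hyps(1)
      by (intro finite_measure_Union) auto
    also have "\<dots> \<le> u * measure M (C \<inter> D) + u * measure M (C - D)"
      using insert.IH[OF CD(2)] integral_le[OF CD(1) FC_int[OF CD(1)], of n u] Fint[OF CD(1), of n]
      by (auto simp: D_def)
    also have "\<dots> = u * measure M C"
      using split[OF insert.prems D] by (simp add: algebra_simps)
    finally show ?case .
  qed
  \<comment> \<open>The same at the smallest threshold.\<close>
  have above_fin: "measure M (C \<inter> {\<omega> \<in> space M. \<exists>n\<in>J. ?q n < V \<omega> \<and> u < F n \<omega>}) \<le> (1 - u) * measure M C"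
    if "finite J" "C \<in> sets G" "u \<le> 1" for J C u
    using that(1,2)
  proof (induction J arbitrary: C rule: finite_ranking_induct[where f="\<lambda>n. - ?q n"])
    case empty
    then show ?case using \<open>u \<le> 1\<close> by simp
  next
    case (insert n J)
    let ?A = "\<lambda>J. {\<omega> \<in> space M. \<exists>n\<in>J. ?q n < V \<omega> \<and> u < F n \<omega>}"
    define D where "D = {\<omega> \<in> space G. u < F n \<omega>}"
    have D: "D \<in> sets G" unfolding D_def by measurable
    have CD: "C \<inter> D \<in> sets G" "C - D \<in> sets G" using insert.prems D by auto
    have cint: "integrable M (\<lambda>\<omega>. (1 - F n \<omega>) * indicator (C \<inter> D) \<omega>)"
    proof (rule integrable_const_bound[of _ 1])
      have [measurable]: "C \<inter> D \<in> sets M" by (rule GM[OF CD(1)])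
      show "(\<lambda>\<omega>. (1 - F n \<omega>) * indicator (C \<inter> D) \<omega>) \<in> borel_measurable M" by measurable
    qed (use F01 in \<open>auto simp: indicator_def\<close>)
    have "C \<inter> ?A (insert n J) = ((C \<inter> D) \<inter> {\<omega> \<in> space M. ?q n < V \<omega>}) \<union> ((C - D) \<inter> ?A J)"
      using insert.hyps(2) sets.sets_into_space[OF insert.prems] unfolding D_def spG by force
    also have "measure M \<dots> = measure M ((C \<inter> D) \<inter> {\<omega> \<in> space M. ?q n < V \<omega>}) + measure M ((C - D) \<inter> ?A J)"
      using GM[OF CD(1)] GM[OF CD(2)] insert.hyps(1)
      by (intro finite_measure_Union) auto
    also have "\<dots> \<le> (1 - u) * measure M (C \<inter> D) + (1 - u) * measure M (C - D)"
      using insert.IH[OF CD(2)] integral_le[OF CD(1) cint, of "1 - u"] FC_compl[OF CD(1), of n]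
      by (auto simp: D_def)
    also have "\<dots> = (1 - u) * measure M C"
      using split[OF insert.prems D] by (simp add: algebra_simps)
    finally show ?case .
  qed
  have countable_union: "(\<lambda>m. measure M (C \<inter> {\<omega> \<in> space M. \<exists>n\<in>{..<m}. P n \<omega>})) \<longlonglongrightarrow> measure M (C \<inter> {\<omega> \<in> space M. \<exists>n. P n \<omega>})"
    if C: "C \<in> sets G" and P: "\<And>n. Measurable.pred M (P n)" for C and P :: "nat \<Rightarrow> 'a \<Rightarrow> bool"
  proof -
    have [measurable]: "C \<in> sets M" by (rule GM[OF C])
    note [measurable] = P
    have "(\<Union>m. C \<inter> {\<omega> \<in> space M. \<exists>n\<in>{..<m}. P n \<omega>}) = C \<inter> {\<omega> \<in> space M. \<exists>n. P n \<omega>}"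
      by blast
    moreover have "(\<lambda>m. measure M (C \<inter> {\<omega> \<in> space M. \<exists>n\<in>{..<m}. P n \<omega>})) \<longlonglongrightarrow> measure M (\<Union>m. C \<inter> {\<omega> \<in> space M. \<exists>n\<in>{..<m}. P n \<omega>})"
      by (rule finite_Lim_measure_incseq) (auto intro!: incseq_SucI)
    ultimately show ?thesis by simp
  qed
  define U where "U \<omega> = (SUP n. if ?q n < V \<omega> then F n \<omega> else 0)" for \<omega>
  have U_bdd: "bdd_above (range (\<lambda>n. if ?q n < V \<omega> then F n \<omega> else 0))" for \<omega>
    by (rule bdd_aboveI2[where M=1]) (auto simp: F01)
  have U_meas[measurable]: "U \<in> borel_measurable M"
    unfolding U_def[abs_def] by (rule borel_measurable_cSUP) (use U_bdd in auto)
  have U_gt: "u < U \<omega> \<longleftrightarrow> (\<exists>n. ?q n < V \<omega> \<and> u < F n \<omega>)" if "0 \<le> u" for u \<omega>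
    unfolding U_def using that by (subst less_cSUP_iff[OF _ U_bdd]) (auto split: if_splits)
  have U_uniform: "measure M (C \<inter> {\<omega> \<in> space M. U \<omega> \<le> u}) = u * measure M C"
    if C: "C \<in> sets G" and u: "0 \<le> u" "u \<le> 1" for C u
  proof (rule antisym)
    have [measurable]: "C \<in> sets M" by (rule GM[OF C])
    define p where "p \<omega> = real_of_ereal (SUP n. if F n \<omega> \<le> u then ereal (?q n) else - \<infinity>)" for \<omega>
    have p: "p \<in> borel_measurable G" unfolding p_def[abs_def] by measurable
    have pM[measurable]: "p \<in> borel_measurable M" by (rule measurable_from_subalg[OF sub p])
    have key: "V \<omega> = p \<omega>" if "U \<omega> \<le> u" and no: "\<And>n. V \<omega> \<le> ?q n \<Longrightarrow> u < F n \<omega>" for \<omega>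
    proof -
      have yes: "F n \<omega> \<le> u" if "?q n < V \<omega>" for n
        using U_gt[OF u(1), of \<omega>] \<open>U \<omega> \<le> u\<close> that by force
      have "(SUP n. if F n \<omega> \<le> u then ereal (?q n) else - \<infinity>) = ereal (V \<omega>)"
      proof (rule antisym)
        show "(SUP n. if F n \<omega> \<le> u then ereal (?q n) else - \<infinity>) \<le> ereal (V \<omega>)"
        proof (rule SUP_least)
          fix n show "(if F n \<omega> \<le> u then ereal (?q n) else - \<infinity>) \<le> ereal (V \<omega>)"
            using no[of n] by (cases "V \<omega> \<le> ?q n") auto
        qed
        show "ereal (V \<omega>) \<le> (SUP n. if F n \<omega> \<le> u then ereal (?q n) else - \<infinity>)"
        proof (rule ereal_le_epsilon2)
          fix e :: real assume "0 < e"
          then obtain n where n: "V \<omega> - e < ?q n" "?q n < V \<omega>" using rat_enum_between[of "V \<omega> - e" "V \<omega>"] by auto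
          have "ereal (?q n) \<le> (SUP n. if F n \<omega> \<le> u then ereal (?q n) else - \<infinity>)"
            by (rule SUP_upper2[of n]) (use yes[OF n(2)] in auto)
          then have "ereal (?q n) + ereal e \<le> (SUP n. if F n \<omega> \<le> u then ereal (?q n) else - \<infinity>) + ereal e"
            by (rule add_right_mono)
          moreover have "ereal (V \<omega>) \<le> ereal (?q n) + ereal e" using n by simp
          ultimately show "ereal (V \<omega>) \<le> (SUP n. if F n \<omega> \<le> u then ereal (?q n) else - \<infinity>) + ereal e"
            by (rule order_trans[rotated])
        qed
      qed
      then show ?thesis unfolding p_def by simp
    qed
    have "measure M (C \<inter> {\<omega> \<in> space M. U \<omega> \<le> u})
        \<le> measure M ((C \<inter> {\<omega> \<in> space M. \<exists>n. V \<omega> \<le> ?q n \<and> F n \<omega> \<le> u}) \<union> {\<omega> \<in> space M. V \<omega> = p \<omega>})"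
      using key by (intro finite_measure_mono) (auto simp: not_le[symmetric])
    also have "\<dots> \<le> measure M (C \<inter> {\<omega> \<in> space M. \<exists>n. V \<omega> \<le> ?q n \<and> F n \<omega> \<le> u}) + measure M {\<omega> \<in> space M. V \<omega> = p \<omega>}"
      by (rule measure_Un_le) auto
    also have "measure M {\<omega> \<in> space M. V \<omega> = p \<omega>} = 0" by (rule null[OF p])
    also have "measure M (C \<inter> {\<omega> \<in> space M. \<exists>n. V \<omega> \<le> ?q n \<and> F n \<omega> \<le> u}) \<le> u * measure M C"
    proof (rule LIMSEQ_le_const2[OF countable_union[OF C]])
      show "\<exists>N. \<forall>m\<ge>N. measure M (C \<inter> {\<omega> \<in> space M. \<exists>n\<in>{..<m}. V \<omega> \<le> ?q n \<and> F n \<omega> \<le> u}) \<le> u * measure M C"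
        using below_fin[OF finite_lessThan C u(1)] by blast
    qed measurable
    finally show "measure M (C \<inter> {\<omega> \<in> space M. U \<omega> \<le> u}) \<le> u * measure M C" by simp
    have "measure M (C \<inter> {\<omega> \<in> space M. \<exists>n. ?q n < V \<omega> \<and> u < F n \<omega>}) \<le> (1 - u) * measure M C"
    proof (rule LIMSEQ_le_const2[OF countable_union[OF C]])
      show "\<exists>N. \<forall>m\<ge>N. measure M (C \<inter> {\<omega> \<in> space M. \<exists>n\<in>{..<m}. ?q n < V \<omega> \<and> u < F n \<omega>}) \<le> (1 - u) * measure M C"
        using above_fin[OF finite_lessThan C u(2)] by blast
    qed measurable
    moreover have "C \<inter> {\<omega> \<in> space M. \<exists>n. ?q n < V \<omega> \<and> u < F n \<omega>} = C - (C \<inter> {\<omega> \<in> space M. U \<omega> \<le> u})"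
      unfolding U_gt[OF u(1), symmetric] using sets.sets_into_space[OF GM[OF C]] by (auto simp: not_le)
    moreover have "measure M (C - (C \<inter> {\<omega> \<in> space M. U \<omega> \<le> u})) = measure M C - measure M (C \<inter> {\<omega> \<in> space M. U \<omega> \<le> u})"
      by (intro finite_measure_Diff) auto
    ultimately show "u * measure M C \<le> measure M (C \<inter> {\<omega> \<in> space M. U \<omega> \<le> u})"
      by (simp add: algebra_simps)
  qed
  define V' where "V' \<omega> = (SUP n. if ?q n \<le> b \<and> F n \<omega> \<le> 1 - U \<omega> then max a (?q n) else a)" for \<omega>
  have ab: "a \<le> b" using range[of undefined] by simp
  have V'_bdd: "bdd_above (range (\<lambda>n. if ?q n \<le> b \<and> F n \<omega> \<le> 1 - U \<omega> then max a (?q n) else a))" for \<omega>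
    by (rule bdd_aboveI2[where M=b]) (use ab in auto)
  have V'_meas[measurable]: "V' \<in> borel_measurable M"
    unfolding V'_def[abs_def] by (rule borel_measurable_cSUP) (use V'_bdd in auto)
  have V'_gt: "x < V' \<omega> \<longleftrightarrow> (\<exists>n. x < ?q n \<and> ?q n \<le> b \<and> F n \<omega> \<le> 1 - U \<omega>)" if "a \<le> x" for x \<omega>
  proof -
    have "x < (if ?q n \<le> b \<and> F n \<omega> \<le> 1 - U \<omega> then max a (?q n) else a) \<longleftrightarrow> x < ?q n \<and> ?q n \<le> b \<and> F n \<omega> \<le> 1 - U \<omega>" for n
      using that by (auto simp: less_max_iff_disj)
    then show ?thesis unfolding V'_def by (subst less_cSUP_iff[OF _ V'_bdd]) simp_all
  qed
  have V'_ge: "a \<le> V' \<omega>" for \<omega>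
    unfolding V'_def by (rule cSUP_upper2[OF V'_bdd UNIV_I]) auto
  have law: "measure M (C \<inter> {\<omega> \<in> space M. x < V' \<omega>}) = measure M (C \<inter> {\<omega> \<in> space M. x < V \<omega>})"
    if C: "C \<in> sets G" for C x
  proof (cases "a \<le> x")
    case False
    then have "x < V' \<omega>" "x < V \<omega>" for \<omega> using V'_ge[of \<omega>] range(1)[of \<omega>] by auto
    then show ?thesis by simp
  next
    case True
    have [measurable]: "C \<in> sets M" by (rule GM[OF C])
    have fin: "measure M (C \<inter> {\<omega> \<in> space M. \<exists>n\<in>{..<m}. x < ?q n \<and> ?q n \<le> b \<and> F n \<omega> \<le> 1 - U \<omega>})
        = measure M (C \<inter> {\<omega> \<in> space M. \<exists>n\<in>{..<m}. x < ?q n \<and> ?q n \<le> b \<and> ?q n < V \<omega>})" for m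
    proof (cases "{n\<in>{..<m}. x < ?q n \<and> ?q n \<le> b} = {}")
      case True
      then have "(\<exists>n\<in>{..<m}. x < ?q n \<and> ?q n \<le> b \<and> P n) \<longleftrightarrow> False" for P by blast
      then show ?thesis by (simp only:)
    next
      case False
      define k where "k = arg_min_on ?q {n\<in>{..<m}. x < ?q n \<and> ?q n \<le> b}"
      have k: "k < m" "x < ?q k" "?q k \<le> b"
        using arg_min_if_finite(1)[of "{n\<in>{..<m}. x < ?q n \<and> ?q n \<le> b}" ?q] False unfolding k_def by auto
      have k_least: "?q k \<le> ?q n" if "n < m" "x < ?q n" "?q n \<le> b" for n
        unfolding k_def by (rule arg_min_least) (use that False in auto)
      have "(\<exists>n\<in>{..<m}. x < ?q n \<and> ?q n \<le> b \<and> F n \<omega> \<le> 1 - U \<omega>) \<longleftrightarrow> U \<omega> \<le> 1 - F k \<omega>" for \<omega>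
      proof
        assume "\<exists>n\<in>{..<m}. x < ?q n \<and> ?q n \<le> b \<and> F n \<omega> \<le> 1 - U \<omega>"
        then obtain n where n: "n < m" "x < ?q n" "?q n \<le> b" "F n \<omega> \<le> 1 - U \<omega>" by auto
        then show "U \<omega> \<le> 1 - F k \<omega>" using Fmono[OF k_least[OF n(1-3)], of \<omega>] by linarith
      next
        assume "U \<omega> \<le> 1 - F k \<omega>"
        then show "\<exists>n\<in>{..<m}. x < ?q n \<and> ?q n \<le> b \<and> F n \<omega> \<le> 1 - U \<omega>"
          using k by (intro bexI[of _ k]) auto
      qed
      moreover have "(\<exists>n\<in>{..<m}. x < ?q n \<and> ?q n \<le> b \<and> ?q n < V \<omega>) \<longleftrightarrow> ?q k < V \<omega>" for \<omega>
        using k k_least by force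
      moreover have "measure M (C \<inter> {\<omega> \<in> space M. U \<omega> \<le> 1 - F k \<omega>}) = measure M (C \<inter> {\<omega> \<in> space M. ?q k < V \<omega>})"
        unfolding FC_compl[OF C]
        by (rule uniform_independent_threshold[OF assms(1) sub U_meas _ _ _ U_uniform C]) (auto simp: F01)
      ultimately show ?thesis by (simp only:)
    qed
    have "{\<omega> \<in> space M. x < V' \<omega>} = {\<omega> \<in> space M. \<exists>n. x < ?q n \<and> ?q n \<le> b \<and> F n \<omega> \<le> 1 - U \<omega>}"
      using V'_gt[OF True] by auto
    moreover have "{\<omega> \<in> space M. x < V \<omega>} = {\<omega> \<in> space M. \<exists>n. x < ?q n \<and> ?q n \<le> b \<and> ?q n < V \<omega>}"
    proof -
      have "(\<exists>n. x < ?q n \<and> ?q n \<le> b \<and> ?q n < V \<omega>) \<longleftrightarrow> x < V \<omega>" for \<omega>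
        using rat_enum_between[of x "V \<omega>"] range(2)[of \<omega>] by force
      then show ?thesis by simp
    qed
    moreover have "measure M (C \<inter> {\<omega> \<in> space M. \<exists>n. x < ?q n \<and> ?q n \<le> b \<and> F n \<omega> \<le> 1 - U \<omega>})
      = measure M (C \<inter> {\<omega> \<in> space M. \<exists>n. x < ?q n \<and> ?q n \<le> b \<and> ?q n < V \<omega>})"
    proof (rule LIMSEQ_unique)
      show "(\<lambda>m. measure M (C \<inter> {\<omega> \<in> space M. \<exists>n\<in>{..<m}. x < ?q n \<and> ?q n \<le> b \<and> F n \<omega> \<le> 1 - U \<omega>}))
        \<longlonglongrightarrow> measure M (C \<inter> {\<omega> \<in> space M. \<exists>n. x < ?q n \<and> ?q n \<le> b \<and> F n \<omega> \<le> 1 - U \<omega>})"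
        by (rule countable_union[OF C]) measurable
      show "(\<lambda>m. measure M (C \<inter> {\<omega> \<in> space M. \<exists>n\<in>{..<m}. x < ?q n \<and> ?q n \<le> b \<and> F n \<omega> \<le> 1 - U \<omega>}))
        \<longlonglongrightarrow> measure M (C \<inter> {\<omega> \<in> space M. \<exists>n. x < ?q n \<and> ?q n \<le> b \<and> ?q n < V \<omega>})"
        unfolding fin by (rule countable_union[OF C]) measurable
    qed
    ultimately show ?thesis by (simp only:)
  qed
  have "AE \<omega> in M. V' \<omega> = V \<omega>"
    using rigid V'_meas law unfolding conditionally_rigid_def by blast
  moreover have "AE \<omega> in M. V \<omega> \<noteq> a"
  proof (rule AE_I)
    show "{\<omega> \<in> space M. \<not> V \<omega> \<noteq> a} \<subseteq> {\<omega> \<in> space M. V \<omega> = a}" by auto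
    show "emeasure M {\<omega> \<in> space M. V \<omega> = a} = 0"
      using null[of "\<lambda>_. a"] by (simp add: emeasure_eq_measure)
  qed measurable
  ultimately have "AE \<omega> in M. U \<omega> \<le> 1 / 2"
  proof eventually_elim
    case (elim \<omega>)
    have "F n \<omega> \<le> 1 - U \<omega>" if n: "?q n < V \<omega>" for n
    proof -
      have "max a (?q n) < V' \<omega>" using elim n range(1)[of \<omega>] by auto
      then obtain m where m: "max a (?q n) < ?q m" "F m \<omega> \<le> 1 - U \<omega>" using V'_gt[of "max a (?q n)" \<omega>] by auto
      then show ?thesis using Fmono[of n m \<omega>] by simp
    qed
    moreover have "U \<omega> \<le> 1"
      unfolding U_def by (rule cSUP_least) (auto simp: F01)
    ultimately have "U \<omega> \<le> 1 - U \<omega>"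
      unfolding U_def by (intro cSUP_least) (auto simp: U_def[symmetric])
    then show ?case by simp
  qed
  then have "measure M {\<omega> \<in> space M. U \<omega> \<le> 1 / 2} = 1" by (subst prob_Collect_eq_1) auto
  moreover have "space M \<in> sets G" using spG sets.top[of G] by simp
  then have "measure M (space M \<inter> {\<omega> \<in> space M. U \<omega> \<le> 1 / 2}) = 1 / 2"
    using U_uniform[of "space M" "1 / 2"] by (simp add: prob_space)
  ultimately show False by (simp add: Int_absorb1)
qed

definition atom_weight :: "'a measure \<Rightarrow> 'a measure \<Rightarrow> ('a \<Rightarrow> real) \<Rightarrow> ('a \<Rightarrow> real) \<Rightarrow> 'a \<Rightarrow> real" where
  "atom_weight M G V p = real_cond_exp M G (indicator {\<omega> \<in> space M. V \<omega> = p \<omega>})"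

context
  fixes M G :: "'a measure" and V :: "'a \<Rightarrow> real"
  assumes prob: "prob_space M" and sub: "subalgebra M G" and V[measurable]: "V \<in> borel_measurable M"
begin

interpretation prob_space M by (rule prob)
interpretation finite_measure_subalgebra M G by unfold_locales (rule sub)

lemma subalgebra_sets: "A \<in> sets G \<Longrightarrow> A \<in> sets M"
  using sub by (auto simp: subalgebra_def)

lemma subalgebra_space: "space G = space M"
  using sub by (simp add: subalgebra_def)

lemma graph_indicator_integrable:
  assumes "p \<in> borel_measurable G"
  shows "integrable M (indicator {\<omega> \<in> space M. V \<omega> = p \<omega>} :: 'a \<Rightarrow> real)"
proof -
  have [measurable]: "p \<in> borel_measurable M" by (rule measurable_from_subalg[OF sub assms])
  show ?thesis by (intro integrable_real_indicator) (auto simp: less_top[symmetric])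
qed

lemma atom_weight_measurable [measurable]: "atom_weight M G V p \<in> borel_measurable G"
  unfolding atom_weight_def by (rule borel_measurable_cond_exp)

lemma atom_weight_measurable' [measurable]: "atom_weight M G V p \<in> borel_measurable M"
  by (rule measurable_from_subalg[OF sub atom_weight_measurable])

lemma atom_weight_integrable: "p \<in> borel_measurable G \<Longrightarrow> integrable M (atom_weight M G V p)"
  unfolding atom_weight_def by (rule real_cond_exp_int(1)[OF graph_indicator_integrable])

lemma atom_weight_nonneg: "p \<in> borel_measurable G \<Longrightarrow> AE \<omega> in M. 0 \<le> atom_weight M G V p \<omega>"
  unfolding atom_weight_def by (rule real_cond_exp_ge_c[OF graph_indicator_integrable]) auto

lemma atom_weight_integral_on:
  assumes p: "p \<in> borel_measurable G" and C: "C \<in> sets G"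
  shows "measure M (C \<inter> {\<omega> \<in> space M. V \<omega> = p \<omega>}) = (\<integral>\<omega>. atom_weight M G V p \<omega> * indicator C \<omega> \<partial>M)"
proof -
  have [measurable]: "C \<in> sets M" by (rule subalgebra_sets[OF C])
  have [measurable]: "p \<in> borel_measurable M" by (rule measurable_from_subalg[OF sub p])
  have "measure M (C \<inter> {\<omega> \<in> space M. V \<omega> = p \<omega>}) = (\<integral>\<omega>. indicator (C \<inter> {\<omega> \<in> space M. V \<omega> = p \<omega>}) \<omega> \<partial>M)"
    by simp
  also have "\<dots> = (LINT \<omega>:C|M. indicator {\<omega> \<in> space M. V \<omega> = p \<omega>} \<omega>)"
    unfolding set_lebesgue_integral_def by (rule Bochner_Integration.integral_cong) (auto simp: indicator_def)
  also have "\<dots> = (LINT \<omega>:C|M. atom_weight M G V p \<omega>)"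
    unfolding atom_weight_def by (rule real_cond_exp_intA[OF graph_indicator_integrable[OF p] C])
  also have "\<dots> = (\<integral>\<omega>. atom_weight M G V p \<omega> * indicator C \<omega> \<partial>M)"
    unfolding set_lebesgue_integral_def by (simp add: mult.commute)
  finally show ?thesis .
qed

lemma atom_weight_integral:
  assumes p: "p \<in> borel_measurable G"
  shows "measure M {\<omega> \<in> space M. V \<omega> = p \<omega>} = (\<integral>\<omega>. atom_weight M G V p \<omega> \<partial>M)"
proof -
  have "space M \<in> sets G" using sets.top[of G] subalgebra_space by simp
  from atom_weight_integral_on[OF p this]
  have "measure M (space M \<inter> {\<omega> \<in> space M. V \<omega> = p \<omega>}) = (\<integral>\<omega>. atom_weight M G V p \<omega> * indicator (space M) \<omega> \<partial>M)" .
  also have "space M \<inter> {\<omega> \<in> space M. V \<omega> = p \<omega>} = {\<omega> \<in> space M. V \<omega> = p \<omega>}" by auto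
  also have "(\<integral>\<omega>. atom_weight M G V p \<omega> * indicator (space M) \<omega> \<partial>M) = (\<integral>\<omega>. atom_weight M G V p \<omega> \<partial>M)"
    by (rule Bochner_Integration.integral_cong) auto
  finally show ?thesis .
qed

text \<open>The weight at \<open>\<omega>\<close> depends on \<open>p\<close> only through its value at \<open>\<omega>\<close>, which allows maps to be patched together pointwise.\<close>

lemma atom_weight_local:
  assumes p: "p \<in> borel_measurable G" and p': "p' \<in> borel_measurable G"
  shows "AE \<omega> in M. p \<omega> = p' \<omega> \<longrightarrow> atom_weight M G V p \<omega> = atom_weight M G V p' \<omega>"
proof -
  note [measurable] = p p'
  define D where "D = {\<omega> \<in> space G. p \<omega> = p' \<omega>}"
  have D[measurable]: "D \<in> sets G" unfolding D_def by measurable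
  have [measurable]: "D \<in> sets M" by (rule subalgebra_sets[OF D])
  let ?I = "\<lambda>p. indicator {\<omega> \<in> space M. V \<omega> = p \<omega>} :: 'a \<Rightarrow> real"
  have I: "integrable M (\<lambda>\<omega>. indicator D \<omega> * ?I p \<omega>)" "?I p \<in> borel_measurable M" if "p \<in> borel_measurable G" for p
    using graph_indicator_integrable[OF that] by (auto intro: integrable_mult_indicator[where 'b=real, simplified])
  have eq: "(\<lambda>\<omega>. indicator D \<omega> * ?I p \<omega>) = (\<lambda>\<omega>. indicator D \<omega> * ?I p' \<omega>)"
    unfolding D_def by (auto simp: fun_eq_iff indicator_def)
  have "AE \<omega> in M. real_cond_exp M G (\<lambda>\<omega>. indicator D \<omega> * ?I p \<omega>) \<omega> = indicator D \<omega> * atom_weight M G V p \<omega>"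
    if "p \<in> borel_measurable G" for p
    unfolding atom_weight_def by (rule real_cond_exp_mult[OF _ I(2)[OF that] I(1)[OF that]]) measurable
  from this[OF p] this[OF p'] AE_space show ?thesis unfolding eq
    by eventually_elim (auto simp: D_def subalgebra_space)
qed

text \<open>A maximising sequence is improved successively, always keeping the value of larger weight. Each change at \<open>\<omega>\<close>
introduces a value different from all earlier ones, of weight at least the current weight. Distinct values occupy
disjoint events, so the weights of the new values have a finite sum. Hence almost surely the sequence changes only finitely
often wherever its weight becomes positive, and its limit is a maximiser.\<close>

lemma maximal_atom_exists:
  "\<exists>p\<in>borel_measurable G. \<forall>p'\<in>borel_measurable G.
     measure M {\<omega> \<in> space M. V \<omega> = p' \<omega>} \<le> measure M {\<omega> \<in> space M. V \<omega> = p \<omega>}"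
proof -
  let ?c = "atom_weight M G V" and ?m = "\<lambda>p. measure M {\<omega> \<in> space M. V \<omega> = p \<omega>}"
  let ?B = "borel_measurable G"
  define \<alpha> where "\<alpha> = (SUP p\<in>?B. ?m p)"
  have ne: "?B \<noteq> {}" using borel_measurable_const by blast
  have bdd: "bdd_above (?m ` ?B)" by (rule bdd_aboveI2[where M=1]) simp
  have "\<exists>p\<in>?B. \<alpha> - 1 / real (Suc n) < ?m p" for n
  proof -
    have "\<alpha> - 1 / real (Suc n) < \<alpha>" by simp
    then show ?thesis unfolding \<alpha>_def by (subst (asm) less_cSUP_iff[OF ne bdd])
  qed
  then obtain r where r: "\<And>n. r n \<in> ?B" "\<And>n. \<alpha> - 1 / real (Suc n) < ?m (r n)" by metis
  define p where "p = rec_nat (r 0) (\<lambda>n P \<omega>. if ?c P \<omega> < ?c (r (Suc n)) \<omega> then r (Suc n) \<omega> else P \<omega>)"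
  have p0: "p 0 = r 0" unfolding p_def by simp
  have pS: "p (Suc n) \<omega> = (if ?c (p n) \<omega> < ?c (r (Suc n)) \<omega> then r (Suc n) \<omega> else p n \<omega>)" for n \<omega>
    unfolding p_def by simp
  note [measurable] = r(1)
  have pm[measurable]: "p n \<in> ?B" for n
  proof (induction n)
    case (Suc n)
    note [measurable] = Suc
    have "(\<lambda>\<omega>. if ?c (p n) \<omega> < ?c (r (Suc n)) \<omega> then r (Suc n) \<omega> else p n \<omega>) \<in> ?B" by measurable
    moreover have "p (Suc n) = (\<lambda>\<omega>. if ?c (p n) \<omega> < ?c (r (Suc n)) \<omega> then r (Suc n) \<omega> else p n \<omega>)"
      by (rule ext) (rule pS)
    ultimately show ?case by (simp only:)
  qed (simp add: p0 r)
  have pM[measurable]: "p n \<in> borel_measurable M" for n by (rule measurable_from_subalg[OF sub pm])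
  define D where "D n = {\<omega> \<in> space G. ?c (p n) \<omega> < ?c (r (Suc n)) \<omega>}" for n
  have DG[measurable]: "D n \<in> sets G" for n unfolding D_def by measurable
  have DM[measurable]: "D n \<in> sets M" for n by (rule subalgebra_sets[OF DG])
  have loc: "AE \<omega> in M. \<forall>n m. p n \<omega> = p m \<omega> \<longrightarrow> ?c (p n) \<omega> = ?c (p m) \<omega>"
    unfolding AE_all_countable by (intro allI atom_weight_local pm)
  have locr: "AE \<omega> in M. \<forall>n m. p n \<omega> = r m \<omega> \<longrightarrow> ?c (p n) \<omega> = ?c (r m) \<omega>"
    unfolding AE_all_countable by (intro allI atom_weight_local pm r)
  have step: "AE \<omega> in M. \<forall>n. ?c (p (Suc n)) \<omega> = max (?c (p n) \<omega>) (?c (r (Suc n)) \<omega>)"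
    using loc locr
  proof eventually_elim
    case (elim \<omega>)
    show ?case
    proof
      fix n
      show "?c (p (Suc n)) \<omega> = max (?c (p n) \<omega>) (?c (r (Suc n)) \<omega>)"
      proof (cases "?c (p n) \<omega> < ?c (r (Suc n)) \<omega>")
        case True
        then have "p (Suc n) \<omega> = r (Suc n) \<omega>" by (simp add: pS)
        then have "?c (p (Suc n)) \<omega> = ?c (r (Suc n)) \<omega>" using elim(2) by blast
        then show ?thesis using True by simp
      next
        case False
        then have "p (Suc n) \<omega> = p n \<omega>" by (simp add: pS)
        then have "?c (p (Suc n)) \<omega> = ?c (p n) \<omega>" using elim(1) by blast
        then show ?thesis using False by simp
      qed
    qed
  qed
  have nonneg: "AE \<omega> in M. \<forall>n. 0 \<le> ?c (p n) \<omega>"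
    unfolding AE_all_countable by (intro allI atom_weight_nonneg pm)
  have mono: "?c (p m) \<omega> \<le> ?c (p n) \<omega>"
    if "\<forall>n. ?c (p (Suc n)) \<omega> = max (?c (p n) \<omega>) (?c (r (Suc n)) \<omega>)" "m \<le> n" for \<omega> m n
    by (rule lift_Suc_mono_le[where f="\<lambda>n. ?c (p n) \<omega>"]) (use that in auto)
  have new: "AE \<omega> in M. \<forall>m n. m \<le> n \<longrightarrow> \<omega> \<in> D n \<longrightarrow> p (Suc n) \<omega> \<noteq> p m \<omega>"
    using loc step
  proof eventually_elim
    case (elim \<omega>)
    show ?case
    proof (intro allI impI notI)
      fix m n assume mn: "m \<le> n" "\<omega> \<in> D n" "p (Suc n) \<omega> = p m \<omega>"
      then have "?c (p (Suc n)) \<omega> = ?c (p m) \<omega>" using elim(1) by blast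
      also have "\<dots> \<le> ?c (p n) \<omega>" by (rule mono[OF elim(2) mn(1)])
      also have "\<dots> < ?c (r (Suc n)) \<omega>" using mn(2) by (simp add: D_def)
      also have "\<dots> \<le> ?c (p (Suc n)) \<omega>" using elim(2) by simp
      finally show False by simp
    qed
  qed
  define A where "A n = D n \<inter> {\<omega> \<in> space M. V \<omega> = p (Suc n) \<omega>}" for n
  have AM[measurable]: "A n \<in> sets M" for n unfolding A_def by measurable
  have sumA: "(\<Sum>n<N. measure M (A n)) \<le> 1" for N
  proof -
    have "(\<Sum>n<N. measure M (A n)) = (\<integral>\<omega>. (\<Sum>n<N. indicator (A n) \<omega>) \<partial>M)"
      by (subst Bochner_Integration.integral_sum) (auto simp: less_top[symmetric])
    also have "\<dots> \<le> (\<integral>\<omega>. 1 \<partial>M)"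
    proof (rule integral_mono_AE)
      show "AE \<omega> in M. (\<Sum>n<N. indicator (A n) \<omega>) \<le> (1::real)"
        using new
      proof eventually_elim
        case (elim \<omega>)
        have "\<not> (\<omega> \<in> A n \<and> \<omega> \<in> A m)" if "m < n" for m n
          using elim[rule_format, of "Suc m" n] that unfolding A_def by auto
        then have one: "n = m" if "\<omega> \<in> A n" "\<omega> \<in> A m" for n m
          using that by (meson linorder_neqE_nat)
        show ?case
        proof (cases "\<exists>n<N. \<omega> \<in> A n")
          case True
          then obtain n where n: "n < N" "\<omega> \<in> A n" by blast
          have "(\<Sum>k<N. indicator (A k) \<omega>) = (\<Sum>k\<in>{n}. indicator (A k) \<omega> :: real)"
            by (rule sum.mono_neutral_right) (use n one in \<open>auto simp: indicator_def\<close>)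
          also have "\<dots> = indicator (A n) \<omega>" by (simp only: sum.insert[OF finite.emptyI] empty_iff not_False_eq_True sum.empty add_0_right)
          also have "\<dots> \<le> 1" by (rule indicator_le_1)
          finally show ?thesis .
        next
          case False
          then have "(\<Sum>n<N. indicator (A n) \<omega>) = (0::real)" by (intro sum.neutral) (auto simp: indicator_def)
          then show ?thesis by simp
        qed
      qed
    qed (auto simp: less_top[symmetric])
    finally show ?thesis by (simp add: prob_space)
  qed
  have fin_change: "AE \<omega> in M. 0 < ?c (p j) \<omega> \<longrightarrow> (\<forall>\<^sub>F n in sequentially. \<omega> \<notin> D n)" for j
  proof -
    let ?f = "\<lambda>n \<omega>. max 0 (?c (p j) \<omega>) * indicator (D (j + n)) \<omega>"
    have f_int: "integrable M (?f n)" for n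
      using atom_weight_integrable[OF pm] by (intro integrable_real_mult_indicator) auto
    have f_le: "(\<integral>\<omega>. ?f n \<omega> \<partial>M) \<le> measure M (A (j + n))" for n
    proof -
      have "(\<integral>\<omega>. ?f n \<omega> \<partial>M) \<le> (\<integral>\<omega>. ?c (p (Suc (j + n))) \<omega> * indicator (D (j + n)) \<omega> \<partial>M)"
      proof (rule integral_mono_AE[OF f_int])
        show "integrable M (\<lambda>\<omega>. ?c (p (Suc (j + n))) \<omega> * indicator (D (j + n)) \<omega>)"
          using atom_weight_integrable[OF pm] by (intro integrable_real_mult_indicator) auto
        show "AE \<omega> in M. ?f n \<omega> \<le> ?c (p (Suc (j + n))) \<omega> * indicator (D (j + n)) \<omega>"
          using step nonneg
        proof eventually_elim
          case (elim \<omega>)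
          then show ?case using mono[OF elim(1), of j "Suc (j + n)"] by (auto simp: indicator_def)
        qed
      qed
      also have "\<dots> = measure M (A (j + n))"
        unfolding A_def by (rule atom_weight_integral_on[OF pm DG, symmetric])
      finally show ?thesis .
    qed
    have "(\<integral>\<^sup>+ \<omega>. (\<Sum>n. ennreal (?f n \<omega>)) \<partial>M) = (\<Sum>n. \<integral>\<^sup>+ \<omega>. ennreal (?f n \<omega>) \<partial>M)"
      by (rule nn_integral_suminf) measurable
    also have "\<dots> = (\<Sum>n. ennreal (\<integral>\<omega>. ?f n \<omega> \<partial>M))"
      by (intro suminf_cong nn_integral_eq_integral f_int) (auto simp: indicator_def)
    also have "\<dots> \<le> 1"
    proof (rule suminf_le_const)
      fix N
      have sum_eq: "(\<Sum>n<N. ennreal (\<integral>\<omega>. ?f n \<omega> \<partial>M)) = ennreal (\<Sum>n<N. \<integral>\<omega>. ?f n \<omega> \<partial>M)"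
        by (intro sum_ennreal Bochner_Integration.integral_nonneg) (auto simp: indicator_def)
      have "(\<Sum>n<N. \<integral>\<omega>. ?f n \<omega> \<partial>M) \<le> (\<Sum>n<N. measure M (A (j + n)))"
        by (intro sum_mono f_le)
      also have "\<dots> = (\<Sum>n\<in>(+) j ` {..<N}. measure M (A n))" by (subst sum.reindex) auto
      also have "\<dots> \<le> (\<Sum>n<j+N. measure M (A n))" by (intro sum_mono2) auto
      also have "\<dots> \<le> 1" by (rule sumA)
      finally show "(\<Sum>n<N. ennreal (\<integral>\<omega>. ?f n \<omega> \<partial>M)) \<le> 1" unfolding sum_eq by (simp only: ennreal_le_1)
    qed simp
    finally have "(\<integral>\<^sup>+ \<omega>. (\<Sum>n. ennreal (?f n \<omega>)) \<partial>M) \<noteq> \<infinity>" by (auto simp: top_unique)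
    then have "AE \<omega> in M. (\<Sum>n. ennreal (?f n \<omega>)) \<noteq> \<infinity>"
      by (intro nn_integral_PInf_AE) measurable
    then show ?thesis
    proof eventually_elim
      case (elim \<omega>)
      show ?case
      proof
        assume c: "0 < ?c (p j) \<omega>"
        have "summable (\<lambda>n. ?f n \<omega>)"
          by (rule summable_suminf_not_top) (use elim in \<open>auto simp: indicator_def\<close>)
        then have "(\<lambda>n. ?f n \<omega>) \<longlonglongrightarrow> 0" by (rule summable_LIMSEQ_zero)
        then have "\<forall>\<^sub>F n in sequentially. ?f n \<omega> < ?c (p j) \<omega>" using c by (rule order_tendstoD(2))
        then have "\<forall>\<^sub>F n in sequentially. \<omega> \<notin> D (n + j)"
          by eventually_elim (use c in \<open>auto simp: indicator_def add.commute split: if_splits\<close>)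
        then show "\<forall>\<^sub>F n in sequentially. \<omega> \<notin> D n" by (rule eventually_sequentially_seg[THEN iffD1])
      qed
    qed
  qed
  define P where "P \<omega> = lim (\<lambda>n. p n \<omega>)" for \<omega>
  have Pm[measurable]: "P \<in> ?B" unfolding P_def[abs_def] by measurable
  have "AE \<omega> in M. \<forall>j. ?c (p j) \<omega> \<le> ?c P \<omega>"
  proof -
    have "AE \<omega> in M. \<forall>j. 0 < ?c (p j) \<omega> \<longrightarrow> (\<forall>\<^sub>F n in sequentially. \<omega> \<notin> D n)"
      unfolding AE_all_countable using fin_change by blast
    moreover have "AE \<omega> in M. \<forall>n. P \<omega> = p n \<omega> \<longrightarrow> ?c P \<omega> = ?c (p n) \<omega>"
      unfolding AE_all_countable by (intro allI atom_weight_local pm Pm)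
    ultimately show ?thesis using step atom_weight_nonneg[OF Pm] AE_space
    proof eventually_elim
      case (elim \<omega>)
      show ?case
      proof
        fix j
        show "?c (p j) \<omega> \<le> ?c P \<omega>"
        proof (cases "0 < ?c (p j) \<omega>")
          case True
          then obtain N where N: "\<And>n. n \<ge> N \<Longrightarrow> \<omega> \<notin> D n"
            using elim(1) unfolding eventually_sequentially by blast
          have const: "p n \<omega> = p N \<omega>" if "n \<ge> N" for n
            using that
          proof (induction n rule: dec_induct)
            case (step n)
            then show ?case using N[of n] \<open>\<omega> \<in> space M\<close> by (simp add: pS D_def subalgebra_space)
          qed simp
          then have "(\<lambda>n. p n \<omega>) \<longlonglongrightarrow> p N \<omega>"
            by (intro tendsto_eventually eventually_sequentiallyI[of N])
          then have P: "P \<omega> = p N \<omega>" unfolding P_def by (rule limI)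
          have "P \<omega> = p (max j N) \<omega>" using const[of "max j N"] P by simp
          then have "?c P \<omega> = ?c (p (max j N)) \<omega>" using elim(2) by blast
          then show ?thesis using mono[OF elim(3), of j "max j N"] by simp
        qed (use elim(4) in simp)
      qed
    qed
  qed
  then have cP: "AE \<omega> in M. ?c (r n) \<omega> \<le> ?c P \<omega>" for n
    using step
  proof eventually_elim
    case (elim \<omega>)
    have "?c (r n) \<omega> \<le> ?c (p n) \<omega>" using elim(2) by (cases n) (auto simp: p0)
    then show ?case using elim(1) by (meson order_trans)
  qed
  have "?m (r n) \<le> ?m P" for n
    unfolding atom_weight_integral[OF r(1)] atom_weight_integral[OF Pm]
    by (rule integral_mono_AE[OF atom_weight_integrable[OF r(1)] atom_weight_integrable[OF Pm] cP])
  then have "\<alpha> - 1 / real (Suc n) \<le> ?m P" for n using r(2)[of n] by (meson less_imp_le less_le_trans)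
  moreover have "(\<lambda>n. \<alpha> - 1 / real (Suc n)) \<longlonglongrightarrow> \<alpha> - 0"
    by (intro tendsto_diff tendsto_const LIMSEQ_inverse_real_of_nat[unfolded inverse_eq_divide])
  ultimately have "\<alpha> \<le> ?m P" by (intro LIMSEQ_le_const2[of "\<lambda>n. \<alpha> - 1 / real (Suc n)"]) auto
  moreover have "?m p' \<le> \<alpha>" if "p' \<in> ?B" for p'
    unfolding \<alpha>_def by (rule cSUP_upper[OF that bdd])
  ultimately show ?thesis using Pm by (meson order_trans)
qed

text \<open>Both maps have the maximal weight almost everywhere, since otherwise patching them would be an improvement. Where they
differ, exchanging the two values preserves the conditional law of \<open>V\<close>, as the weights agree. By rigidity the exchange
does nothing, hence \<open>V\<close> takes neither value there and the weight is zero.\<close>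

lemma rigid_maximal_atom_unique:
  assumes rigid: "conditionally_rigid M G V" and p: "p \<in> borel_measurable G" and p': "p' \<in> borel_measurable G"
    and max: "\<And>s. s \<in> borel_measurable G \<Longrightarrow>
      measure M {\<omega> \<in> space M. V \<omega> = s \<omega>} \<le> measure M {\<omega> \<in> space M. V \<omega> = p \<omega>}"
    and le: "measure M {\<omega> \<in> space M. V \<omega> = p \<omega>} \<le> measure M {\<omega> \<in> space M. V \<omega> = p' \<omega>}"
  shows "AE \<omega> in M. atom_weight M G V p' \<omega> = atom_weight M G V p \<omega> \<and>
    (0 < atom_weight M G V p \<omega> \<longrightarrow> p' \<omega> = p \<omega>)"
proof -
  let ?c = "atom_weight M G V" and ?m = "\<lambda>p. measure M {\<omega> \<in> space M. V \<omega> = p \<omega>}"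
  note [measurable] = p p' measurable_from_subalg[OF sub p] measurable_from_subalg[OF sub p']
  define s where "s \<omega> = (if ?c p \<omega> < ?c p' \<omega> then p' \<omega> else p \<omega>)" for \<omega>
  have s[measurable]: "s \<in> borel_measurable G" unfolding s_def[abs_def] by measurable
  have cs: "AE \<omega> in M. ?c s \<omega> = max (?c p \<omega>) (?c p' \<omega>)"
    using atom_weight_local[OF s p] atom_weight_local[OF s p'] by eventually_elim (auto simp: s_def split: if_splits)
  have AE_eqI: "AE \<omega> in M. f \<omega> = g \<omega>"
    if "integrable M f" "integrable M g" "AE \<omega> in M. f \<omega> \<le> g \<omega>" "(\<integral>\<omega>. g \<omega> \<partial>M) \<le> (\<integral>\<omega>. f \<omega> \<partial>M)" for f g :: "'a \<Rightarrow> real"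
  proof -
    have "(\<integral>\<omega>. g \<omega> - f \<omega> \<partial>M) = 0"
      using that integral_mono_AE[OF that(1-3)] by (subst Bochner_Integration.integral_diff) auto
    then have "AE \<omega> in M. g \<omega> - f \<omega> = 0"
      using that by (subst (asm) integral_nonneg_eq_0_iff_AE) auto
    then show ?thesis by eventually_elim simp
  qed
  note ints = atom_weight_integrable[OF p] atom_weight_integrable[OF p'] atom_weight_integrable[OF s]
  have "AE \<omega> in M. ?c p \<omega> = ?c s \<omega>"
    using max[OF s] ints cs unfolding atom_weight_integral[OF s] atom_weight_integral[OF p]
    by (intro AE_eqI) auto
  then have "AE \<omega> in M. ?c p' \<omega> \<le> ?c p \<omega>" using cs by eventually_elim simp
  then have ceq: "AE \<omega> in M. ?c p' \<omega> = ?c p \<omega>"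
    using le ints unfolding atom_weight_integral[OF p'] atom_weight_integral[OF p] by (intro AE_eqI) auto
  have same: "measure M (K \<inter> {\<omega> \<in> space M. V \<omega> = p' \<omega>}) = measure M (K \<inter> {\<omega> \<in> space M. V \<omega> = p \<omega>})"
    if K: "K \<in> sets G" for K
    unfolding atom_weight_integral_on[OF p' K] atom_weight_integral_on[OF p K]
  proof (rule integral_cong_AE)
    have [measurable]: "K \<in> sets M" by (rule subalgebra_sets[OF K])
    show "(\<lambda>\<omega>. ?c p' \<omega> * indicator K \<omega>) \<in> borel_measurable M" "(\<lambda>\<omega>. ?c p \<omega> * indicator K \<omega>) \<in> borel_measurable M"
      by measurable
    show "AE \<omega> in M. ?c p' \<omega> * indicator K \<omega> = ?c p \<omega> * indicator K \<omega>" using ceq by eventually_elim simp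
  qed
  define C where "C = {\<omega> \<in> space G. p \<omega> \<noteq> p' \<omega>}"
  have C: "C \<in> sets G" unfolding C_def by measurable
  define V' where "V' \<omega> = (if p \<omega> \<noteq> p' \<omega> then if V \<omega> = p \<omega> then p' \<omega> else if V \<omega> = p' \<omega> then p \<omega> else V \<omega> else V \<omega>)" for \<omega>
  have V'[measurable]: "V' \<in> borel_measurable M" unfolding V'_def[abs_def] by measurable
  have "measure M (B \<inter> {\<omega> \<in> space M. x < V' \<omega>}) = measure M (B \<inter> {\<omega> \<in> space M. x < V \<omega>})" if B: "B \<in> sets G" for B x
  proof -
    have [measurable]: "B \<in> sets M" "C \<in> sets M" using subalgebra_sets B C by auto
    define Kp Kp' where "Kp = B \<inter> C \<inter> {\<omega> \<in> space G. x < p \<omega>}" and "Kp' = B \<inter> C \<inter> {\<omega> \<in> space G. x < p' \<omega>}"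
    have "{\<omega> \<in> space G. x < p \<omega>} \<in> sets G" "{\<omega> \<in> space G. x < p' \<omega>} \<in> sets G" by measurable
    then have K: "Kp \<in> sets G" "Kp' \<in> sets G" unfolding Kp_def Kp'_def using B C by auto
    note [measurable] = subalgebra_sets[OF K(1)] subalgebra_sets[OF K(2)]
    let ?e = "\<lambda>p. {\<omega> \<in> space M. V \<omega> = p \<omega>}"
    define R where "R = B \<inter> {\<omega> \<in> space M. x < V \<omega> \<and> \<not> (p \<omega> \<noteq> p' \<omega> \<and> (V \<omega> = p \<omega> \<or> V \<omega> = p' \<omega>))}"
    have [measurable]: "R \<in> sets M" unfolding R_def by measurable
    have Bsp: "\<omega> \<in> B \<Longrightarrow> \<omega> \<in> space M" for \<omega> using sets.sets_into_space[OF subalgebra_sets[OF B]] by blast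
    have 1: "B \<inter> {\<omega> \<in> space M. x < V' \<omega>} = (Kp' \<inter> ?e p) \<union> ((Kp \<inter> ?e p') \<union> R)"
      unfolding Kp_def Kp'_def R_def C_def V'_def subalgebra_space using Bsp by auto
    have 2: "B \<inter> {\<omega> \<in> space M. x < V \<omega>} = (Kp \<inter> ?e p) \<union> ((Kp' \<inter> ?e p') \<union> R)"
      unfolding Kp_def Kp'_def R_def C_def V'_def subalgebra_space using Bsp by auto
    have U: "measure M ((Ka \<inter> ?e p) \<union> ((Kb \<inter> ?e p') \<union> R)) = measure M (Ka \<inter> ?e p) + (measure M (Kb \<inter> ?e p') + measure M R)"
      if [measurable]: "Ka \<in> sets M" "Kb \<in> sets M" and "Ka \<subseteq> C" "Kb \<subseteq> C" for Ka Kb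
    proof -
      have "Ka \<inter> ?e p \<inter> ((Kb \<inter> ?e p') \<union> R) = {}" "(Kb \<inter> ?e p') \<inter> R = {}"
        using that(3,4) unfolding C_def R_def by auto
      then show ?thesis by (subst finite_measure_Union; (subst finite_measure_Union)?) auto
    qed
    have "measure M (B \<inter> {\<omega> \<in> space M. x < V' \<omega>}) = measure M (Kp' \<inter> ?e p) + (measure M (Kp \<inter> ?e p') + measure M R)"
      unfolding 1 by (rule U[OF subalgebra_sets[OF K(2)] subalgebra_sets[OF K(1)]]) (auto simp: Kp_def Kp'_def)
    also have "\<dots> = measure M (Kp \<inter> ?e p) + (measure M (Kp' \<inter> ?e p') + measure M R)"
      using same[OF K(1)] same[OF K(2)] by simp
    also have "\<dots> = measure M (B \<inter> {\<omega> \<in> space M. x < V \<omega>})"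
      unfolding 2 by (rule U[symmetric, OF subalgebra_sets[OF K(1)] subalgebra_sets[OF K(2)]]) (auto simp: Kp_def Kp'_def)
    finally show ?thesis .
  qed
  then have "AE \<omega> in M. V' \<omega> = V \<omega>"
    using rigid V' unfolding conditionally_rigid_def by blast
  then have "AE \<omega> in M. \<not> (p \<omega> \<noteq> p' \<omega> \<and> V \<omega> = p \<omega>)"
    by eventually_elim (auto simp: V'_def)
  then have "measure M (C \<inter> {\<omega> \<in> space M. V \<omega> = p \<omega>}) = 0"
  proof -
    assume ae: "AE \<omega> in M. \<not> (p \<omega> \<noteq> p' \<omega> \<and> V \<omega> = p \<omega>)"
    have "measure M (C \<inter> {\<omega> \<in> space M. V \<omega> = p \<omega>}) = measure M {}"
      by (rule finite_measure_eq_AE) (use ae subalgebra_sets[OF C] in \<open>auto simp: C_def\<close>)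
    then show ?thesis by simp
  qed
  then have "(\<integral>\<omega>. ?c p \<omega> * indicator C \<omega> \<partial>M) = 0"
    unfolding atom_weight_integral_on[OF p C] .
  moreover have "integrable M (\<lambda>\<omega>. ?c p \<omega> * indicator C \<omega>)"
    using ints(1) subalgebra_sets[OF C] by (intro integrable_real_mult_indicator)
  moreover have "AE \<omega> in M. 0 \<le> ?c p \<omega> * indicator C \<omega>"
    using atom_weight_nonneg[OF p] by eventually_elim simp
  ultimately have "AE \<omega> in M. ?c p \<omega> * indicator C \<omega> = 0"
    by (subst (asm) integral_nonneg_eq_0_iff_AE)
  then show ?thesis using ceq AE_space
    by eventually_elim (auto simp: C_def subalgebra_space indicator_def)
qed

end

section \<open>Joint stationarity of a causal solution and its noise\<close>

abbreviation path_space :: "(int \<Rightarrow> real) measure" where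
  "path_space \<equiv> PiM UNIV (\<lambda>_. borel)"

abbreviation future_space :: "(nat \<Rightarrow> real) measure" where
  "future_space \<equiv> PiM UNIV (\<lambda>_. borel)"

definition joint_path :: "(int \<Rightarrow> 'a \<Rightarrow> real) \<Rightarrow> (int \<Rightarrow> 'a \<Rightarrow> real) \<Rightarrow> 'a \<Rightarrow> (int \<Rightarrow> real) \<times> (int \<Rightarrow> real)" where
  "joint_path Y Z \<omega> = (\<lambda>t. Y t \<omega>, \<lambda>t. Z t \<omega>)"

lemma measurable_paths [measurable (raw)]:
  assumes "\<And>t. Y t \<in> borel_measurable M"
  shows "(\<lambda>\<omega> t. Y t \<omega>) \<in> M \<rightarrow>\<^sub>M PiM UNIV (\<lambda>_. borel :: real measure)"
  using assms by (intro measurable_PiM_single') (auto simp: space_PiM PiE_iff)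

lemma measurable_joint_path:
  assumes "\<And>t. Y t \<in> borel_measurable M" "\<And>t. Z t \<in> borel_measurable M"
  shows "joint_path Y Z \<in> M \<rightarrow>\<^sub>M path_space \<Otimes>\<^sub>M path_space"
  unfolding joint_path_def[abs_def] by (intro measurable_Pair measurable_paths assms)

primrec run_forward :: "(real \<Rightarrow> real \<Rightarrow> real) \<Rightarrow> real \<Rightarrow> (nat \<Rightarrow> real) \<Rightarrow> nat \<Rightarrow> real" where
  "run_forward f y z 0 = y"
| "run_forward f y z (Suc n) = f (run_forward f y z n) (z n)"

lemma measurable_run_forward:
  assumes f: "(\<lambda>(x, z). f x z) \<in> borel_measurable (borel \<Otimes>\<^sub>M borel)"
  shows "(\<lambda>(y, z). (run_forward f y z, z)) \<in> borel \<Otimes>\<^sub>M future_space \<rightarrow>\<^sub>M future_space \<Otimes>\<^sub>M future_space"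
proof -
  have [measurable]: "(\<lambda>p. run_forward f (fst p) (snd p) n) \<in> borel_measurable (borel \<Otimes>\<^sub>M future_space)" for n
  proof (induction n)
    case (Suc n)
    have "(\<lambda>p. (run_forward f (fst p) (snd p) n, snd p n)) \<in> borel \<Otimes>\<^sub>M future_space \<rightarrow>\<^sub>M borel \<Otimes>\<^sub>M borel"
      using Suc by (intro measurable_Pair measurable_compose[OF measurable_snd measurable_component_singleton[OF UNIV_I]])
    from measurable_compose[OF this f] show ?case by simp
  qed simp
  show ?thesis unfolding case_prod_beta'
    by (intro measurable_Pair measurable_paths) measurable
qed

lemma iid_path_law:
  assumes "prob_space M" and iid: "iid_process M Z"
  shows "\<And>t. Z t \<in> borel_measurable M"
    and "distr M path_space (\<lambda>\<omega> t. Z t \<omega>) = PiM UNIV (\<lambda>_. distr M borel (Z 0))"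
    and "prob_space (distr M borel (Z 0))"
proof -
  interpret prob_space M by fact
  show m: "Z t \<in> borel_measurable M" for t
    using iid unfolding iid_process_def indep_vars_def by auto
  have "distr M (PiM UNIV (\<lambda>_. borel)) (\<lambda>\<omega>. \<lambda>t\<in>UNIV. Z t \<omega>) = PiM UNIV (\<lambda>t. distr M borel (Z t))"
    using iid m unfolding iid_process_def by (subst (asm) indep_vars_iff_distr_eq_PiM) auto
  moreover have "distr M borel (Z t) = distr M borel (Z 0)" for t
    using iid unfolding iid_process_def by blast
  then have "PiM UNIV (\<lambda>t. distr M borel (Z t)) = PiM (UNIV :: int set) (\<lambda>_. distr M borel (Z 0))"
    by (intro PiM_cong refl)
  ultimately show "distr M path_space (\<lambda>\<omega> t. Z t \<omega>) = PiM UNIV (\<lambda>_. distr M borel (Z 0))"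
    by (simp add: restrict_UNIV)
  show "prob_space (distr M borel (Z 0))" by (rule prob_space_distr[OF m])
qed

lemma stationary_process_marginal:
  assumes "stationary_process M Y" shows "distr M borel (Y t) = distr M borel (Y 0)"
proof -
  have m: "\<And>t. Y t \<in> borel_measurable M" using assms unfolding stationary_process_def by blast
  have "distr M borel (Y s) = distr (distr M path_space (\<lambda>\<omega> u. Y (u + s) \<omega>)) borel (\<lambda>u. u 0)" for s
    by (subst distr_distr) (auto simp: comp_def intro!: measurable_paths m)
  from this[of t] this[of 0] show ?thesis using assms unfolding stationary_process_def by simp
qed

text \<open>By non-anticipation the law is a product, and neither factor changes with \<open>t\<close>.\<close>

lemma causal_start_future_law:
  assumes "prob_space M" and iid: "iid_process M Z" and Y: "stationary_process M Y"
    and causal: "non_anticipative M Z Y"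
  shows "distr M (borel \<Otimes>\<^sub>M future_space) (\<lambda>\<omega>. (Y t \<omega>, \<lambda>n. Z (t + int n) \<omega>)) =
    distr M (borel \<Otimes>\<^sub>M future_space) (\<lambda>\<omega>. (Y 0 \<omega>, \<lambda>n. Z (int n) \<omega>))"
proof -
  interpret prob_space M by fact
  have Zm[measurable]: "Z t \<in> borel_measurable M" for t by (rule iid_path_law[OF assms(1) iid])
  have Ym[measurable]: "Y t \<in> borel_measurable M" for t using Y unfolding stationary_process_def by blast
  let ?F = "\<lambda>t \<omega>. \<lambda>n. Z (t + int n) \<omega>"
  have Fm[measurable]: "?F t \<in> M \<rightarrow>\<^sub>M future_space" for t by (intro measurable_paths Zm)
  have prod: "distr M borel (Y t) \<Otimes>\<^sub>M distr M future_space (?F t) =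
    distr M (borel \<Otimes>\<^sub>M future_space) (\<lambda>\<omega>. (Y t \<omega>, ?F t \<omega>))" for t
  proof (rule pair_measure_eqI)
    show "sigma_finite_measure (distr M borel (Y t))"
      using prob_space_distr[OF Ym] by (rule prob_space_imp_sigma_finite)
    show "sigma_finite_measure (distr M future_space (?F t))"
      using prob_space_distr[OF Fm] by (rule prob_space_imp_sigma_finite)
    show "sets (distr M borel (Y t) \<Otimes>\<^sub>M distr M future_space (?F t)) =
      sets (distr M (borel \<Otimes>\<^sub>M future_space) (\<lambda>\<omega>. (Y t \<omega>, ?F t \<omega>)))"
      by (simp cong: sets_pair_measure_cong)
    fix A B assume "A \<in> sets (distr M borel (Y t))" "B \<in> sets (distr M future_space (?F t))"
    then have A: "A \<in> sets borel" and B: "B \<in> sets future_space" by auto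
    let ?R = "\<lambda>u::int \<Rightarrow> real. \<lambda>n. u (t + int n)"
    have R: "?R \<in> PiM {t..} (\<lambda>_. borel) \<rightarrow>\<^sub>M future_space"
      by (intro measurable_paths measurable_component_singleton) auto
    have B': "?R -` B \<inter> space (PiM {t..} (\<lambda>_. borel)) \<in> sets (PiM {t..} (\<lambda>_. borel))"
      by (rule measurable_sets[OF R B])
    have 1: "Y t -` A \<inter> space M \<in> sets (vimage_algebra (space M) (Y t) borel)"
      by (rule in_vimage_algebra[OF A])
    have 2: "(\<lambda>\<omega>. \<lambda>s\<in>{t..}. Z s \<omega>) -` (?R -` B \<inter> space (PiM {t..} (\<lambda>_. borel))) \<inter> space M
      \<in> sets (vimage_algebra (space M) (\<lambda>\<omega>. \<lambda>s\<in>{t..}. Z s \<omega>) (PiM {t..} (\<lambda>_. borel)))"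
      by (rule in_vimage_algebra[OF B'])
    have eq: "(\<lambda>\<omega>. \<lambda>s\<in>{t..}. Z s \<omega>) -` (?R -` B \<inter> space (PiM {t..} (\<lambda>_. borel))) \<inter> space M = ?F t -` B \<inter> space M"
      by (auto simp: space_PiM)
    have "measure M ((Y t -` A \<inter> space M) \<inter> (?F t -` B \<inter> space M)) =
      measure M (Y t -` A \<inter> space M) * measure M (?F t -` B \<inter> space M)"
      using indep_setD[OF causal[unfolded non_anticipative_def, rule_format, of t] 1 2] unfolding eq .
    moreover have "(\<lambda>\<omega>. (Y t \<omega>, ?F t \<omega>)) -` (A \<times> B) \<inter> space M = (Y t -` A \<inter> space M) \<inter> (?F t -` B \<inter> space M)"
      by auto
    ultimately show "emeasure (distr M borel (Y t)) A * emeasure (distr M future_space (?F t)) B =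
      emeasure (distr M (borel \<Otimes>\<^sub>M future_space) (\<lambda>\<omega>. (Y t \<omega>, ?F t \<omega>))) (A \<times> B)"
      using A B by (simp add: emeasure_distr emeasure_eq_measure ennreal_mult[symmetric])
  qed
  have "distr M borel (Y t) = distr M borel (Y 0)" by (rule stationary_process_marginal[OF Y])
  moreover have "distr M future_space (?F t) = distr M future_space (?F 0)"
  proof -
    let ?P = "PiM UNIV (\<lambda>_::int. distr M borel (Z 0))"
    note law = iid_path_law(2)[OF assms(1) iid]
    have R: "(\<lambda>u::int \<Rightarrow> real. \<lambda>n. u (int n)) \<in> path_space \<rightarrow>\<^sub>M future_space"
      by (intro measurable_paths measurable_component_singleton) auto
    have sh: "time_shift t \<in> path_space \<rightarrow>\<^sub>M path_space" by measurable
    have Zp: "(\<lambda>\<omega> t. Z t \<omega>) \<in> M \<rightarrow>\<^sub>M path_space" by (intro measurable_paths Zm)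
    have st: "distr (distr M path_space (\<lambda>\<omega> t. Z t \<omega>)) path_space (time_shift t) = distr M path_space (\<lambda>\<omega> t. Z t \<omega>)"
    proof -
      have "sets ?P = sets path_space" by (intro sets_PiM_cong) auto
      then have "distr ?P path_space (time_shift t) = distr ?P ?P (time_shift t)" by (intro distr_cong) auto
      then show ?thesis unfolding law using bernoulli_shift_stationary[OF iid_path_law(3)[OF assms(1) iid], of t] by simp
    qed
    have "distr M future_space (?F t) = distr (distr (distr M path_space (\<lambda>\<omega> t. Z t \<omega>)) path_space (time_shift t)) future_space (\<lambda>u n. u (int n))"
      using R sh Zp by (simp add: distr_distr comp_def time_shift_def add.commute)
    also have "\<dots> = distr M future_space (?F 0)"
      unfolding st using R Zp by (simp add: distr_distr comp_def)
    finally show ?thesis .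
  qed
  ultimately show ?thesis using prod[of t] prod[of 0] by simp
qed

text \<open>From time \<open>t\<close> on, the pair of processes is a fixed function of \<open>Y t\<close> and the future noise. A cylinder with finite
index set lies in the future of some time \<open>m\<close>, so its probability is unchanged by a shift.\<close>

lemma causal_solution_jointly_stationary:
  assumes "prob_space M" and iid: "iid_process M Z" and Y: "stationary_process M Y"
    and causal: "non_anticipative M Z Y"
    and f: "(\<lambda>(x, z). f x z) \<in> borel_measurable (borel \<Otimes>\<^sub>M borel)"
    and rec: "\<And>t. AE \<omega> in M. Y (t + 1) \<omega> = f (Y t \<omega>) (Z t \<omega>)"
  shows "distr M (path_space \<Otimes>\<^sub>M path_space) (joint_path (\<lambda>t. Y (t + k)) (\<lambda>t. Z (t + k))) =
    distr M (path_space \<Otimes>\<^sub>M path_space) (joint_path Y Z)"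
proof -
  interpret prob_space M by fact
  have Zm[measurable]: "Z t \<in> borel_measurable M" for t by (rule iid_path_law[OF assms(1) iid])
  have Ym[measurable]: "Y t \<in> borel_measurable M" for t using Y unfolding stationary_process_def by blast
  let ?FF = "\<lambda>t \<omega>. (\<lambda>n. Y (t + int n) \<omega>, \<lambda>n. Z (t + int n) \<omega>)"
  have FFm: "?FF t \<in> M \<rightarrow>\<^sub>M future_space \<Otimes>\<^sub>M future_space" for t
    by (intro measurable_Pair measurable_paths Ym Zm)
  have start: "(\<lambda>\<omega>. (Y t \<omega>, \<lambda>n. Z (t + int n) \<omega>)) \<in> M \<rightarrow>\<^sub>M borel \<Otimes>\<^sub>M future_space" for t
    by (intro measurable_Pair measurable_paths Ym Zm)
  note run = measurable_run_forward[OF f]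
  have future: "distr M (future_space \<Otimes>\<^sub>M future_space) (?FF t) =
    distr (distr M (borel \<Otimes>\<^sub>M future_space) (\<lambda>\<omega>. (Y t \<omega>, \<lambda>n. Z (t + int n) \<omega>)))
      (future_space \<Otimes>\<^sub>M future_space) (\<lambda>(y, z). (run_forward f y z, z))" for t
  proof -
    have "AE \<omega> in M. \<forall>n. Y (t + int n + 1) \<omega> = f (Y (t + int n) \<omega>) (Z (t + int n) \<omega>)"
      unfolding AE_all_countable using rec by blast
    then have "AE \<omega> in M. ?FF t \<omega> = (run_forward f (Y t \<omega>) (\<lambda>n. Z (t + int n) \<omega>), \<lambda>n. Z (t + int n) \<omega>)"
    proof eventually_elim
      case (elim \<omega>)
      have "Y (t + int n) \<omega> = run_forward f (Y t \<omega>) (\<lambda>n. Z (t + int n) \<omega>) n" for n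
      proof (induction n)
        case (Suc n)
        have "Y (t + int (Suc n)) \<omega> = Y (t + int n + 1) \<omega>" by (simp add: algebra_simps)
        also have "\<dots> = f (Y (t + int n) \<omega>) (Z (t + int n) \<omega>)" using elim by blast
        finally show ?case using Suc by simp
      qed simp
      then show ?case by (simp add: fun_eq_iff)
    qed
    then have "distr M (future_space \<Otimes>\<^sub>M future_space) (?FF t) =
      distr M (future_space \<Otimes>\<^sub>M future_space) ((\<lambda>(y, z). (run_forward f y z, z)) \<circ> (\<lambda>\<omega>. (Y t \<omega>, \<lambda>n. Z (t + int n) \<omega>)))"
      using FFm measurable_comp[OF start run] by (intro distr_cong_AE) (auto simp: comp_def)
    then show ?thesis by (simp add: distr_distr[OF run start])
  qed
  have same_future: "distr M (future_space \<Otimes>\<^sub>M future_space) (?FF t) = distr M (future_space \<Otimes>\<^sub>M future_space) (?FF s)" for t s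
    unfolding future causal_start_future_law[OF assms(1) iid Y causal, of t]
      causal_start_future_law[OF assms(1) iid Y causal, of s] ..
  let ?PP = "PiM UNIV (\<lambda>_::int. borel \<Otimes>\<^sub>M borel :: (real \<times> real) measure)"
  let ?V = "\<lambda>k \<omega> t. (Y (t + k) \<omega>, Z (t + k) \<omega>)"
  have Vm: "?V k \<in> M \<rightarrow>\<^sub>M ?PP" for k
    by (intro measurable_PiM_single' measurable_Pair Ym Zm) (auto simp: space_PiM space_pair_measure)
  have pairs: "distr M ?PP (?V k) = distr M ?PP (?V 0)"
  proof (rule measure_eqI_PiM_infinite)
    fix A :: "int \<Rightarrow> (real \<times> real) set" and J :: "int set"
    assume J: "finite J" and A: "\<And>i. i \<in> J \<Longrightarrow> A i \<in> sets (borel \<Otimes>\<^sub>M borel)"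
    \<comment> \<open>A time before all indices of the cylinder.\<close>
    define m where "m = - (\<Sum>i\<in>J. \<bar>i\<bar>)"
    have m: "m \<le> i" if "i \<in> J" for i
      using member_le_sum[OF that, of abs] J unfolding m_def by auto
    let ?E = "prod_emb UNIV (\<lambda>_. borel \<Otimes>\<^sub>M borel) J (Pi\<^sub>E J A)"
    define B where "B = {p \<in> space (future_space \<Otimes>\<^sub>M future_space). \<forall>i\<in>J. (fst p (nat (i - m)), snd p (nat (i - m))) \<in> A i}"
    have B: "B \<in> sets (future_space \<Otimes>\<^sub>M future_space)"
      unfolding B_def
    proof (intro sets.sets_Collect_finite_All J)
      fix i assume i: "i \<in> J"
      have "(\<lambda>p. (fst p (nat (i - m)), snd p (nat (i - m)))) \<in> future_space \<Otimes>\<^sub>M future_space \<rightarrow>\<^sub>M borel \<Otimes>\<^sub>M (borel :: real measure)"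
        by measurable
      from measurable_sets[OF this A[OF i]]
      show "{p \<in> space (future_space \<Otimes>\<^sub>M future_space). (fst p (nat (i - m)), snd p (nat (i - m))) \<in> A i} \<in> sets (future_space \<Otimes>\<^sub>M future_space)"
        by (simp add: vimage_def Collect_conj_eq Int_commute)
    qed
    have E: "?E \<in> sets ?PP" using J A by (intro sets_PiM_I) auto
    have pre: "?V k -` ?E \<inter> space M = ?FF (m + k) -` B \<inter> space M" for k
    proof -
      have t: "m + k + int (nat (i - m)) = i + k" if "i \<in> J" for i using m[OF that] by simp
      have "(\<forall>i\<in>J. (Y (m + k + int (nat (i - m))) \<omega>, Z (m + k + int (nat (i - m))) \<omega>) \<in> A i) \<longleftrightarrow>
          (\<forall>i\<in>J. (Y (i + k) \<omega>, Z (i + k) \<omega>) \<in> A i)" for \<omega>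
        by (intro ball_cong refl) (simp only: t)
      moreover have "?V k \<omega> \<in> ?E \<longleftrightarrow> (\<forall>i\<in>J. (Y (i + k) \<omega>, Z (i + k) \<omega>) \<in> A i)" for \<omega>
        by (auto simp: prod_emb_def space_pair_measure space_PiM PiE_iff)
      moreover have "?FF (m + k) \<omega> \<in> B \<longleftrightarrow>
          (\<forall>i\<in>J. (Y (m + k + int (nat (i - m))) \<omega>, Z (m + k + int (nat (i - m))) \<omega>) \<in> A i)" for \<omega>
        unfolding B_def by (simp only: mem_Collect_eq fst_conv snd_conv) (auto simp only: space_pair_measure space_PiM PiE_iff space_borel extensional_UNIV mem_Times_iff UNIV_I)
      ultimately show ?thesis by (simp only: vimage_def)
    qed
    have V_FF: "emeasure (distr M ?PP (?V k)) ?E = emeasure (distr M (future_space \<Otimes>\<^sub>M future_space) (?FF (m + k))) B" for k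
      using E B FFm Vm by (subst (1 2) emeasure_distr) (auto simp: pre)
    show "emeasure (distr M ?PP (?V k)) ?E = emeasure (distr M ?PP (?V 0)) ?E"
      by (simp only: V_FF same_future[of "m + k" "m + 0"])
  next
    show "finite_measure (distr M ?PP (?V k))"
      using prob_space_distr[OF Vm] by (rule prob_space.finite_measure)
  qed simp_all
  let ?S = "\<lambda>w::int \<Rightarrow> real \<times> real. (\<lambda>t. fst (w t), \<lambda>t. snd (w t))"
  have S: "?S \<in> ?PP \<rightarrow>\<^sub>M path_space \<Otimes>\<^sub>M path_space"
    by (intro measurable_Pair measurable_paths) measurable
  have "distr M (path_space \<Otimes>\<^sub>M path_space) (joint_path (\<lambda>t. Y (t + k)) (\<lambda>t. Z (t + k))) =
    distr (distr M ?PP (?V k)) (path_space \<Otimes>\<^sub>M path_space) ?S" for k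
    by (simp add: distr_distr[OF S Vm] comp_def joint_path_def[abs_def])
  from this[of k] this[of 0] show ?thesis using pairs by simp
qed

section \<open>A unique solution is a function of the noise\<close>

definition joint_shift :: "int \<Rightarrow> (int \<Rightarrow> real) \<times> (int \<Rightarrow> real) \<Rightarrow> (int \<Rightarrow> real) \<times> (int \<Rightarrow> real)" where
  "joint_shift k p = (time_shift k (fst p), time_shift k (snd p))"

lemma joint_shift_simps:
  "fst (joint_shift k p) = time_shift k (fst p)" "snd (joint_shift k p) = time_shift k (snd p)"
  "joint_shift k (joint_shift j p) = joint_shift (k + j) p" "joint_shift 0 p = p"
  by (auto simp: joint_shift_def shift_shift shift_0)

lemma measurable_joint_shift [measurable]:
  "joint_shift k \<in> path_space \<Otimes>\<^sub>M path_space \<rightarrow>\<^sub>M path_space \<Otimes>\<^sub>M path_space"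
  unfolding joint_shift_def[abs_def] by measurable

lemma pair_law_eqI:
  fixes V V' :: "'a \<Rightarrow> real"
  assumes P: "prob_space P" and g[measurable]: "g \<in> P \<rightarrow>\<^sub>M N"
    and V[measurable]: "V \<in> borel_measurable P" and V'[measurable]: "V' \<in> borel_measurable P"
    and eq: "\<And>C x. C \<in> sets N \<Longrightarrow> measure P ((g -` C \<inter> space P) \<inter> {p \<in> space P. x < V' p}) =
      measure P ((g -` C \<inter> space P) \<inter> {p \<in> space P. x < V p})"
  shows "distr P (N \<Otimes>\<^sub>M borel) (\<lambda>p. (g p, V' p)) = distr P (N \<Otimes>\<^sub>M borel) (\<lambda>p. (g p, V p))"
proof -
  interpret prob_space P by fact
  have rect: "emeasure P ((g -` C \<inter> space P) \<inter> (V' -` B \<inter> space P)) = emeasure P ((g -` C \<inter> space P) \<inter> (V -` B \<inter> space P))"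
    if C: "C \<in> sets N" and B: "B \<in> sets borel" for C B
  proof -
    define K where "K = g -` C \<inter> space P"
    have K[measurable]: "K \<in> sets P" unfolding K_def using C by measurable
    let ?\<mu> = "\<lambda>V. distr (density P (indicator K)) borel V"
    have \<mu>: "emeasure (?\<mu> U) A = emeasure P (K \<inter> (U -` A \<inter> space P))"
      if [measurable]: "U \<in> borel_measurable P" "A \<in> sets borel" for U :: "'a \<Rightarrow> real" and A
    proof -
      have "emeasure (?\<mu> U) A = (\<integral>\<^sup>+ p. indicator K p * indicator (U -` A \<inter> space P) p \<partial>P)"
        by (subst emeasure_distr) (auto simp: emeasure_density)
      also have "\<dots> = (\<integral>\<^sup>+ p. indicator (K \<inter> (U -` A \<inter> space P)) p \<partial>P)"
        by (rule nn_integral_cong) (auto simp: indicator_def)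
      finally show ?thesis by simp
    qed
    have "?\<mu> V' = ?\<mu> V"
    proof (rule measure_eqI_lessThan)
      fix x :: real
      show "emeasure (?\<mu> V') {x<..} < \<infinity>" by (subst \<mu>) (auto simp: emeasure_eq_measure)
      have "U -` {x<..} \<inter> space P = {p \<in> space P. x < U p}" for U :: "'a \<Rightarrow> real" by auto
      then show "emeasure (?\<mu> V') {x<..} = emeasure (?\<mu> V) {x<..}"
        using eq[OF C, of x] by (simp add: \<mu> emeasure_eq_measure K_def[symmetric])
    qed auto
    then show ?thesis using \<mu>[OF V B] \<mu>[OF V' B] by (simp add: K_def)
  qed
  let ?E = "{a \<times> b | a b. a \<in> sets N \<and> b \<in> sets (borel :: real measure)}"
  show ?thesis
  proof (rule measure_eqI_generator_eq[where E="?E" and \<Omega>="space N \<times> UNIV" and A="\<lambda>_. space N \<times> UNIV"])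
    show "Int_stable ?E" by (rule Int_stable_pair_measure_generator)
    show "?E \<subseteq> Pow (space N \<times> UNIV)" using sets.sets_into_space[of _ N] by auto
    fix X assume "X \<in> ?E"
    then obtain C B where X: "X = C \<times> B" "C \<in> sets N" "B \<in> sets borel" by blast
    have "(\<lambda>p. (g p, U p)) -` (C \<times> B) \<inter> space P = (g -` C \<inter> space P) \<inter> (U -` B \<inter> space P)" for U :: "'a \<Rightarrow> real"
      by auto
    then show "emeasure (distr P (N \<Otimes>\<^sub>M borel) (\<lambda>p. (g p, V' p))) X = emeasure (distr P (N \<Otimes>\<^sub>M borel) (\<lambda>p. (g p, V p))) X"
      using X rect[OF X(2,3)] by (simp add: emeasure_distr)
  next
    show "sets (distr P (N \<Otimes>\<^sub>M borel) (\<lambda>p. (g p, V' p))) = sigma_sets (space N \<times> UNIV) ?E"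
      by (simp add: sets_pair_measure)
    show "sets (distr P (N \<Otimes>\<^sub>M borel) (\<lambda>p. (g p, V p))) = sigma_sets (space N \<times> UNIV) ?E"
      by (simp add: sets_pair_measure)
    show "range (\<lambda>_::nat. space N \<times> (UNIV::real set)) \<subseteq> ?E"
    proof -
      have "space N \<times> (UNIV::real set) \<in> ?E" 
        by (intro CollectI exI conjI refl) auto
      then show ?thesis by auto
    qed
    show "emeasure (distr P (N \<Otimes>\<^sub>M borel) (\<lambda>p. (g p, V' p))) (space N \<times> UNIV) \<noteq> \<infinity>"
    proof -
      interpret D: prob_space "distr P (N \<Otimes>\<^sub>M borel) (\<lambda>p. (g p, V' p))"
        by (rule prob_space_distr) measurable
      show ?thesis by (simp add: D.emeasure_eq_measure)
    qed
  qed auto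
qed

text \<open>The law \<open>P\<close> of a solution path and its noise path, on the space of pairs of paths, where the time shift acts. \<open>Sol\<close> is
the set of pairs that solve the recursion at all times. The last assumption is the uniqueness of the
stationary solution among the functions of the pair.\<close>

locale unique_solution_law =
  fixes P :: "((int \<Rightarrow> real) \<times> (int \<Rightarrow> real)) measure" and N :: "real measure"
    and Sol :: "((int \<Rightarrow> real) \<times> (int \<Rightarrow> real)) set"
  assumes prob_P: "prob_space P"
    and sets_P: "sets P = sets (path_space \<Otimes>\<^sub>M path_space)"
    and stationary_P: "\<And>k. distr P P (joint_shift k) = P"
    and prob_N: "prob_space N"
    and noise: "distr P path_space snd = PiM UNIV (\<lambda>_. N)"
    and Sol_sets: "Sol \<in> sets (path_space \<Otimes>\<^sub>M path_space)"
    and Sol_shift: "\<And>k p. joint_shift k p \<in> Sol \<longleftrightarrow> p \<in> Sol"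
    and Sol_AE: "AE p in P. p \<in> Sol"
    and unique: "\<And>R. R \<in> P \<rightarrow>\<^sub>M path_space \<Longrightarrow>
      (\<And>k. distr P path_space (\<lambda>p. time_shift k (R p)) = distr P path_space R) \<Longrightarrow>
      AE p in P. (R p, snd p) \<in> Sol \<Longrightarrow> AE p in P. R p = fst p"
begin

sublocale prob_space P by (rule prob_P)

text \<open>The events that depend on the noise only.\<close>

definition G :: "((int \<Rightarrow> real) \<times> (int \<Rightarrow> real)) measure" where "G = vimage_algebra UNIV snd path_space"

lemma space_P: "space P = UNIV"
  using sets_eq_imp_space_eq[OF sets_P] by (simp add: space_pair_measure space_PiM)

lemma measurable_P: "measurable P L = measurable (path_space \<Otimes>\<^sub>M path_space) L"
  by (rule measurable_cong_sets[OF sets_P refl])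

lemma measurable_into_P: "measurable L P = measurable L (path_space \<Otimes>\<^sub>M path_space)"
  by (rule measurable_cong_sets[OF refl sets_P])

lemma fst_measurable [measurable]: "fst \<in> P \<rightarrow>\<^sub>M path_space"
  and snd_measurable [measurable]: "snd \<in> P \<rightarrow>\<^sub>M path_space"
  unfolding measurable_P by measurable

lemma joint_shift_measurable [measurable]: "joint_shift k \<in> P \<rightarrow>\<^sub>M P"
  unfolding measurable_into_P unfolding measurable_P by measurable

lemma snd_measurable_G [measurable]: "snd \<in> G \<rightarrow>\<^sub>M path_space"
  unfolding G_def by (rule measurable_vimage_algebra1) (simp add: space_PiM)

lemma sets_G: "sets G = {snd -` A | A. A \<in> sets path_space}"
  unfolding G_def by (subst sets_vimage_algebra2) (auto simp: space_PiM)

lemma subalgebra_G: "subalgebra P G"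
  unfolding subalgebra_def
proof
  show "space G = space P" by (simp add: G_def space_P)
  show "sets G \<subseteq> sets P"
    unfolding sets_G using measurable_sets[OF snd_measurable] by (auto simp: space_P)
qed

lemma joint_shift_measurable_G [measurable]: "joint_shift k \<in> G \<rightarrow>\<^sub>M G"
proof -
  have "(\<lambda>p. snd (joint_shift k p)) \<in> G \<rightarrow>\<^sub>M path_space"
    unfolding joint_shift_simps by measurable
  then show ?thesis by (subst (2) G_def) (rule measurable_vimage_algebra2, auto)
qed

lemma measure_joint_shift:
  assumes "A \<in> sets P" shows "measure P (joint_shift k -` A) = measure P A"
proof -
  have "measure P A = measure (distr P P (joint_shift k)) A" by (simp add: stationary_P)
  also have "\<dots> = measure P (joint_shift k -` A)" using assms by (simp add: measure_distr space_P)
  finally show ?thesis by simp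
qed

lemma AE_joint_shift:
  assumes "AE p in P. Q p" shows "AE p in P. Q (joint_shift k p)"
proof -
  have "AE p in distr P P (joint_shift k). Q p" unfolding stationary_P by (rule assms)
  then show ?thesis by (rule AE_distrD[OF joint_shift_measurable])
qed

lemma noise_event_trivial:
  assumes B: "B \<in> sets path_space" and k: "k \<ge> 1"
    and inv: "AE p in P. time_shift (int k) (snd p) \<in> B \<longleftrightarrow> snd p \<in> B"
  shows "measure P (snd -` B) = 0 \<or> measure P (snd -` B) = 1"
proof -
  have sN: "sets (PiM UNIV (\<lambda>_::int. N)) = sets path_space" using noise by (metis sets_distr)
  have B': "B \<in> sets (PiM UNIV (\<lambda>_::int. N))" using B sN by simp
  have "AE u in distr P path_space snd. time_shift (int k) u \<in> B \<longleftrightarrow> u \<in> B"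
  proof (subst AE_distr_iff[OF snd_measurable])
    have [measurable]: "time_shift (int k) \<in> path_space \<rightarrow>\<^sub>M path_space" by measurable
    show "{u \<in> space path_space. (time_shift (int k) u \<in> B) = (u \<in> B)} \<in> sets path_space"
      using B by measurable
  qed (rule inv)
  then have "measure (PiM UNIV (\<lambda>_::int. N)) B = 0 \<or> measure (PiM UNIV (\<lambda>_::int. N)) B = 1"
    unfolding noise by (intro bernoulli_shift_invariant_event[OF prob_N B' k])
  moreover have "measure (PiM UNIV (\<lambda>_::int. N)) B = measure P (snd -` B)"
    unfolding noise[symmetric] using B by (simp add: measure_distr space_P)
  ultimately show ?thesis by simp
qed

abbreviation V :: "(int \<Rightarrow> real) \<times> (int \<Rightarrow> real) \<Rightarrow> real" where "V p \<equiv> encode_path (fst p)"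

lemma V_measurable [measurable]: "V \<in> borel_measurable P"
  by measurable

text \<open>A variable with the same conditional law given the noise decodes to a path with the same joint law with the noise, that is, to
another stationary solution.\<close>

lemma encoded_solution_rigid: "conditionally_rigid P G V"
  unfolding conditionally_rigid_def
proof (intro ballI impI)
  fix V' assume V'[measurable]: "V' \<in> borel_measurable P"
    and law: "\<forall>C\<in>sets G. \<forall>x. measure P (C \<inter> {p \<in> space P. x < V' p}) = measure P (C \<inter> {p \<in> space P. x < V p})"
  have joint: "distr P (path_space \<Otimes>\<^sub>M borel) (\<lambda>p. (snd p, V' p)) = distr P (path_space \<Otimes>\<^sub>M borel) (\<lambda>p. (snd p, V p))"
  proof (rule pair_law_eqI[OF prob_P snd_measurable V_measurable V'])
    fix C x assume "C \<in> sets path_space"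
    then have "snd -` C \<inter> space P \<in> sets G" unfolding sets_G space_P by auto
    then show "measure P ((snd -` C \<inter> space P) \<inter> {p \<in> space P. x < V' p}) = measure P ((snd -` C \<inter> space P) \<inter> {p \<in> space P. x < V p})"
      using law by blast
  qed
  define R where "R p = decode_path (V' p)" for p
  have R[measurable]: "R \<in> P \<rightarrow>\<^sub>M path_space" unfolding R_def[abs_def] by measurable
  have push: "distr P L (\<lambda>p. f (snd p, V' p)) = distr P L (\<lambda>p. f (snd p, V p))"
    if "f \<in> path_space \<Otimes>\<^sub>M borel \<rightarrow>\<^sub>M L" for f and L :: "'z measure"
  proof -
    have "distr P L (\<lambda>p. f (snd p, U p)) = distr (distr P (path_space \<Otimes>\<^sub>M borel) (\<lambda>p. (snd p, U p))) L f"
      if "U \<in> borel_measurable P" for U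
      using \<open>f \<in> _\<close> that by (subst distr_distr) (auto simp: comp_def)
    then show ?thesis using joint by simp
  qed
  have law_R: "distr P (path_space \<Otimes>\<^sub>M path_space) (\<lambda>p. (R p, snd p)) = P"
  proof -
    have "distr P (path_space \<Otimes>\<^sub>M path_space) (\<lambda>p. (R p, snd p)) = distr P (path_space \<Otimes>\<^sub>M path_space) (\<lambda>p. (fst p, snd p))"
      using push[of "\<lambda>q. (decode_path (snd q), fst q)" "path_space \<Otimes>\<^sub>M path_space"]
      by (simp add: R_def decode_encode_path)
    then show ?thesis by (simp add: distr_id2[OF sets_P[symmetric]])
  qed
  have "AE p in P. R p = fst p"
  proof (rule unique[OF R])
    show "distr P path_space (\<lambda>p. time_shift k (R p)) = distr P path_space R" for k
    proof -
      have *: "distr P path_space (\<lambda>p. time_shift k (R p)) = distr P path_space (\<lambda>p. time_shift k (fst p))" for k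
        using push[of "\<lambda>q. time_shift k (decode_path (snd q))" path_space]
        by (simp add: R_def decode_encode_path)
      have "distr P path_space (\<lambda>p. time_shift k (fst p)) = distr (distr P P (joint_shift k)) path_space fst"
        by (subst distr_distr) (auto simp: comp_def joint_shift_simps)
      also have "\<dots> = distr P path_space (\<lambda>p. time_shift 0 (fst p))" by (simp add: stationary_P shift_0)
      finally show ?thesis using *[of k] *[of 0] by (simp add: shift_0)
    qed
    have "AE q in distr P (path_space \<Otimes>\<^sub>M path_space) (\<lambda>p. (R p, snd p)). q \<in> Sol"
      unfolding law_R by (rule Sol_AE)
    then show "AE p in P. (R p, snd p) \<in> Sol"
      by (rule AE_distrD[rotated]) measurable
  qed
  moreover have "AE p in P. encode_path (decode_path (V' p)) = V' p"
  proof -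
    have m: "{q \<in> space (path_space \<Otimes>\<^sub>M borel). encode_path (decode_path (snd q)) = snd q} \<in> sets (path_space \<Otimes>\<^sub>M (borel :: real measure))"
      by measurable
    have "AE q in distr P (path_space \<Otimes>\<^sub>M borel) (\<lambda>p. (snd p, V p)). encode_path (decode_path (snd q)) = snd q"
      by (subst AE_distr_iff[OF _ m]) (auto simp: decode_encode_path)
    then have "AE q in distr P (path_space \<Otimes>\<^sub>M borel) (\<lambda>p. (snd p, V' p)). encode_path (decode_path (snd q)) = snd q"
      unfolding joint .
    then show ?thesis by (subst (asm) AE_distr_iff[OF _ m]) auto
  qed
  ultimately show "AE p in P. V' p = V p"
    by eventually_elim (simp add: R_def)
qed

text \<open>The solution path has a heaviest conditional atom \<open>Q\<close> given the noise. Conjugating \<open>Q\<close> by the shift yields another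
maximiser, which must agree with \<open>Q\<close> where the weight is positive. The weight is an invariant function of the noise,
hence positive almost surely; so \<open>Q\<close> commutes with the shift and has a stationary law. That \<open>Q\<close> solves the recursion is
an invariant event of the noise, and it contains the event of positive probability that \<open>Q\<close> is the solution path.
Uniqueness identifies \<open>Q\<close> with the solution path.\<close>

lemma strong_solution:
  "\<exists>Q. Q \<in> G \<rightarrow>\<^sub>M path_space \<and> (AE p in P. Q p = fst p)"
proof -
  note rigid = encoded_solution_rigid
  let ?m = "\<lambda>p. measure P {w \<in> space P. V w = p w}" and ?c = "atom_weight P G V"
  note ctx = prob_P subalgebra_G V_measurable
  obtain p0 where p0: "p0 \<in> borel_measurable G" "?m p0 \<noteq> 0"
    using rigid_imp_atom[OF ctx encode_path_range rigid] by blast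
  obtain p1 where p1[measurable]: "p1 \<in> borel_measurable G" and p1_max: "\<And>s. s \<in> borel_measurable G \<Longrightarrow> ?m s \<le> ?m p1"
    using maximal_atom_exists[OF ctx] by blast
  define Q where "Q w = decode_path (p1 w)" for w
  have Q[measurable]: "Q \<in> G \<rightarrow>\<^sub>M path_space" unfolding Q_def[abs_def] by measurable
  have QP[measurable]: "Q \<in> P \<rightarrow>\<^sub>M path_space" by (rule measurable_from_subalg[OF subalgebra_G Q])
  \<comment> \<open>A code outside the range of the encoding is replaced by the code of its path; this does not decrease the probability of being hit.\<close>
  define p where "p w = encode_path (Q w)" for w
  have p[measurable]: "p \<in> borel_measurable G" unfolding p_def[abs_def] by measurable
  have pP[measurable]: "p \<in> borel_measurable P" by (rule measurable_from_subalg[OF subalgebra_G p])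
  have Vp: "V w = p w \<longleftrightarrow> fst w = Q w" for w
    unfolding p_def by (metis decode_encode_path)
  have "?m p1 \<le> ?m p"
  proof (rule finite_measure_mono)
    show "{w \<in> space P. V w = p1 w} \<subseteq> {w \<in> space P. V w = p w}"
      unfolding Vp Q_def by auto (metis decode_encode_path)
  qed measurable
  then have p_max: "?m s \<le> ?m p" if "s \<in> borel_measurable G" for s
    using p1_max[OF that] by linarith
  have p_pos: "0 < ?m p" using p_max[OF p0(1)] p0(2) by (smt (verit) measure_nonneg)
  \<comment> \<open>The selection conjugated by the shift.\<close>
  define p' where "p' w = encode_path (time_shift (- 1) (Q (joint_shift 1 w)))" for w
  have QS[measurable]: "(\<lambda>w. Q (joint_shift 1 w)) \<in> G \<rightarrow>\<^sub>M path_space"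
    by (rule measurable_compose[OF joint_shift_measurable_G Q])
  have p'[measurable]: "p' \<in> borel_measurable G"
    unfolding p'_def[abs_def] by measurable
  have Vp': "V w = p' w \<longleftrightarrow> V (joint_shift 1 w) = p (joint_shift 1 w)" for w
  proof -
    have "V w = p' w \<longleftrightarrow> fst w = time_shift (- 1) (Q (joint_shift 1 w))"
      unfolding p'_def by (metis decode_encode_path)
    also have "\<dots> \<longleftrightarrow> time_shift 1 (fst w) = Q (joint_shift 1 w)"
      by (metis add.left_inverse add.right_inverse shift_0 shift_shift)
    finally show ?thesis using Vp[of "joint_shift 1 w"] by (simp only: joint_shift_simps)
  qed
  let ?A = "{w \<in> space P. V w = p w}"
  have A[measurable]: "?A \<in> sets P" by measurable
  have A': "{w \<in> space P. V w = p' w} = joint_shift 1 -` ?A" unfolding Vp' by (auto simp: space_P)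
  have "?m p \<le> ?m p'" unfolding A' by (simp only: measure_joint_shift[OF A] order_refl)
  from rigid_maximal_atom_unique[OF ctx rigid p p' p_max this]
  have same: "AE w in P. ?c p' w = ?c p w \<and> (0 < ?c p w \<longrightarrow> p' w = p w)" .
  have c_shift: "AE w in P. ?c p' w = ?c p (joint_shift 1 w)"
  proof -
    interpret finite_measure_subalgebra P G by unfold_locales (rule subalgebra_G)
    have cG[measurable]: "?c p \<in> borel_measurable G" by (rule atom_weight_measurable[OF ctx])
    have c_int: "integrable P (?c p)" by (rule atom_weight_integrable[OF ctx p])
    have int: "integrable P (\<lambda>w. f (joint_shift 1 w)) \<and> (\<integral>w. f (joint_shift 1 w) \<partial>P) = (\<integral>w. f w \<partial>P)"
      if "integrable P f" for f :: "_ \<Rightarrow> real"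
    proof -
      have fm: "f \<in> borel_measurable P" using that by auto
      have "integrable (distr P P (joint_shift 1)) f" unfolding stationary_P by (rule that)
      then have "integrable P (\<lambda>w. f (joint_shift 1 w))"
        by (subst (asm) integrable_distr_eq[OF joint_shift_measurable fm])
      moreover have "(\<integral>w. f w \<partial>(distr P P (joint_shift 1))) = (\<integral>w. f (joint_shift 1 w) \<partial>P)"
        using fm by (intro integral_distr) auto
      ultimately show ?thesis by (simp add: stationary_P)
    qed
    have "AE w in P. real_cond_exp P G (indicator {w \<in> space P. V w = p' w}) w = ?c p (joint_shift 1 w)"
    proof (rule real_cond_exp_charact)
      show "integrable P (indicator {w \<in> space P. V w = p' w} :: _ \<Rightarrow> real)"
        by (rule graph_indicator_integrable[OF ctx p'])
      show "integrable P (\<lambda>w. ?c p (joint_shift 1 w))" using int[OF c_int] by blast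
      show "(\<lambda>w. ?c p (joint_shift 1 w)) \<in> borel_measurable G"
        by (rule measurable_compose[OF joint_shift_measurable_G cG])
      fix B assume B: "B \<in> sets G"
      define B' where "B' = joint_shift (- 1) -` B"
      have B': "B' \<in> sets G" unfolding B'_def
        using measurable_sets[OF joint_shift_measurable_G B] by (simp add: G_def)
      have BB': "w \<in> B \<longleftrightarrow> joint_shift 1 w \<in> B'" for w
        unfolding B'_def by (simp add: joint_shift_simps)
      have BP: "B \<in> sets P" "B' \<in> sets P" using B B' subalgebra_G by (auto simp: subalgebra_def)
      have "(LINT w:B|P. indicator {w \<in> space P. V w = p' w} w) = measure P (B \<inter> {w \<in> space P. V w = p' w})"
      proof -
        have "(LINT w:B|P. indicator {w \<in> space P. V w = p' w} w) = (\<integral>w. indicator (B \<inter> {w \<in> space P. V w = p' w}) w \<partial>P :: real)"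
          unfolding set_lebesgue_integral_def by (rule Bochner_Integration.integral_cong) (auto simp: indicator_def)
        then show ?thesis by (simp add: space_P)
      qed
      also have "B \<inter> {w \<in> space P. V w = p' w} = joint_shift 1 -` (B' \<inter> ?A)"
        unfolding A' using BB' by auto
      also have "measure P \<dots> = measure P (B' \<inter> ?A)" using BP by (intro measure_joint_shift) auto
      also have "\<dots> = (\<integral>w. ?c p w * indicator B' w \<partial>P)" by (rule atom_weight_integral_on[OF ctx p B'])
      also have "\<dots> = (\<integral>w. ?c p (joint_shift 1 w) * indicator B' (joint_shift 1 w) \<partial>P)"
        using int[of "\<lambda>w. ?c p w * indicator B' w"] integrable_real_mult_indicator[OF BP(2) c_int] by simp
      also have "\<dots> = (LINT w:B|P. ?c p (joint_shift 1 w))"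
        unfolding set_lebesgue_integral_def
        by (rule Bochner_Integration.integral_cong) (auto simp: indicator_def BB')
      finally show "(LINT w:B|P. indicator {w \<in> space P. V w = p' w} w) = (LINT w:B|P. ?c p (joint_shift 1 w))" .
    qed
    then show ?thesis unfolding atom_weight_def .
  qed
  have pos: "AE w in P. 0 < ?c p w"
  proof -
    have "{w \<in> space G. 0 < ?c p w} \<in> sets G" using atom_weight_measurable[OF ctx, of p] by measurable
    then obtain D where D: "D \<in> sets path_space" "{w. 0 < ?c p w} = snd -` D"
      unfolding sets_G by (auto simp: G_def)
    have "AE w in P. time_shift (int 1) (snd w) \<in> D \<longleftrightarrow> snd w \<in> D"
      using same c_shift
    proof eventually_elim
      case (elim w)
      have "time_shift (int 1) (snd w) \<in> D \<longleftrightarrow> joint_shift 1 w \<in> snd -` D" by (simp add: joint_shift_simps)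
      also have "\<dots> \<longleftrightarrow> 0 < ?c p (joint_shift 1 w)" unfolding D(2)[symmetric] by simp
      also have "\<dots> \<longleftrightarrow> 0 < ?c p w" using elim by simp
      also have "\<dots> \<longleftrightarrow> snd w \<in> D" using D(2) by auto
      finally show ?case .
    qed
    then consider "measure P (snd -` D) = 0" | "measure P (snd -` D) = 1"
      using noise_event_trivial[OF D(1), of 1] by auto
    then show ?thesis
    proof cases
      case 1
      have DP: "{w. 0 < ?c p w} \<in> sets P" unfolding D(2) using measurable_sets[OF snd_measurable D(1)] by (simp add: space_P)
      have "AE w in P. w \<notin> {w. 0 < ?c p w}"
        using 1 DP unfolding D(2)[symmetric] by (intro AE_not_in) (auto simp: null_sets_def emeasure_eq_measure)
      then have "AE w in P. ?c p w \<le> 0" by eventually_elim auto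
      then have "(\<integral>w. ?c p w \<partial>P) \<le> (\<integral>w. 0 \<partial>P)"
        using atom_weight_integrable[OF ctx p] by (intro integral_mono_AE) auto
      then show ?thesis using p_pos atom_weight_integral[OF ctx p] by simp
    next
      case 2
      have DP: "{w. 0 < ?c p w} \<in> sets P" unfolding D(2) using measurable_sets[OF snd_measurable D(1)] by (simp add: space_P)
      then have "AE w in P. w \<in> {w. 0 < ?c p w}" using 2 unfolding D(2)[symmetric] by (simp add: prob_eq_1)
      then show ?thesis by simp
    qed
  qed
  have equivariant: "AE w in P. Q (joint_shift 1 w) = time_shift 1 (Q w)"
    using pos same
  proof eventually_elim
    case (elim w)
    then have "encode_path (time_shift (- 1) (Q (joint_shift 1 w))) = encode_path (Q w)"
      unfolding p_def p'_def by simp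
    then have "time_shift (- 1) (Q (joint_shift 1 w)) = Q w" by (metis decode_encode_path)
    then have "time_shift 1 (time_shift (- 1) (Q (joint_shift 1 w))) = time_shift 1 (Q w)" by simp
    then show ?case by (simp add: shift_shift shift_0)
  qed
  have law1: "distr P path_space (\<lambda>w. time_shift 1 (Q w)) = distr P path_space Q"
  proof -
    have "distr P path_space (\<lambda>w. time_shift 1 (Q w)) = distr P path_space (\<lambda>w. Q (joint_shift 1 w))"
      using equivariant by (intro distr_cong_AE) (auto simp: eq_commute)
    also have "\<dots> = distr (distr P P (joint_shift 1)) path_space Q"
      by (subst distr_distr) (auto simp: comp_def)
    finally show ?thesis by (simp add: stationary_P)
  qed
  have step_law: "distr P path_space (\<lambda>w. time_shift (j + k) (Q w)) = distr (distr P path_space (\<lambda>w. time_shift k (Q w))) path_space (time_shift j)" for j k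
    by (subst distr_distr) (auto simp: comp_def shift_shift)
  have law: "distr P path_space (\<lambda>w. time_shift k (Q w)) = distr P path_space Q" for k
  proof (induction k rule: int_induct[where k=0])
    case base show ?case by (simp add: shift_0)
  next
    case (step1 i)
    have "distr P path_space (\<lambda>w. time_shift (i + 1) (Q w)) = distr (distr P path_space (\<lambda>w. time_shift i (Q w))) path_space (time_shift 1)"
      using step_law[of 1 i] by (simp add: add.commute)
    also have "\<dots> = distr P path_space (\<lambda>w. time_shift 1 (Q w))"
      unfolding step1.IH by (subst distr_distr) (auto simp: comp_def)
    finally show ?case unfolding law1 .
  next
    case (step2 i)
    have "distr P path_space (\<lambda>w. time_shift (i - 1) (Q w)) = distr (distr P path_space (\<lambda>w. time_shift i (Q w))) path_space (time_shift (- 1))"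
      using step_law[of "- 1" i] by simp
    also have "\<dots> = distr (distr P path_space (\<lambda>w. time_shift 1 (Q w))) path_space (time_shift (- 1))"
      unfolding step2.IH law1 ..
    also have "\<dots> = distr P path_space Q" using step_law[of "- 1" 1] by (simp add: shift_0)
    finally show ?case .
  qed
  have "AE w in P. (Q w, snd w) \<in> Sol"
  proof -
    have QsG: "(\<lambda>w. (Q w, snd w)) \<in> G \<rightarrow>\<^sub>M path_space \<Otimes>\<^sub>M path_space" by measurable
    have "(\<lambda>w. (Q w, snd w)) -` Sol \<inter> space G \<in> sets G" by (rule measurable_sets[OF QsG Sol_sets])
    then obtain D where D: "D \<in> sets path_space" "{w. (Q w, snd w) \<in> Sol} = snd -` D"
      unfolding sets_G by (auto simp: G_def vimage_def)
    have DP: "{w. (Q w, snd w) \<in> Sol} \<in> sets P" unfolding D(2) using measurable_sets[OF snd_measurable D(1)] by (simp add: space_P)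
    have "AE w in P. time_shift (int 1) (snd w) \<in> D \<longleftrightarrow> snd w \<in> D"
      using equivariant
    proof eventually_elim
      case (elim w)
      have "time_shift (int 1) (snd w) \<in> D \<longleftrightarrow> joint_shift 1 w \<in> snd -` D" by (simp add: joint_shift_simps)
      also have "\<dots> \<longleftrightarrow> joint_shift 1 (Q w, snd w) \<in> Sol"
        unfolding D(2)[symmetric] by (simp add: joint_shift_def elim[unfolded joint_shift_def])
      also have "\<dots> \<longleftrightarrow> snd w \<in> D" unfolding Sol_shift using D(2) by auto
      finally show ?case .
    qed
    then consider "measure P (snd -` D) = 0" | "measure P (snd -` D) = 1"
      using noise_event_trivial[OF D(1), of 1] by auto
    then show ?thesis
    proof cases
      case 1
      then have "AE w in P. w \<notin> {w. (Q w, snd w) \<in> Sol}"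
        using DP unfolding D(2)[symmetric] by (intro AE_not_in) (auto simp: null_sets_def emeasure_eq_measure)
      then have "AE w in P. \<not> V w = p w" using Sol_AE by eventually_elim (auto simp: Vp)
      then have "?m p = 0" by (subst prob_Collect_eq_0) auto
      then show ?thesis using p_pos by simp
    next
      case 2
      then have "AE w in P. w \<in> {w. (Q w, snd w) \<in> Sol}" using DP unfolding D(2)[symmetric] by (simp add: prob_eq_1)
      then show ?thesis by simp
    qed
  qed
  from unique[OF QP law this] show ?thesis using Q by blast
qed

text \<open>Modulo null sets an invariant event of the pair is an invariant event of the noise.\<close>

theorem invariant_event_trivial:
  assumes B: "B \<in> sets P" and k: "k \<ge> 1" and inv: "joint_shift (int k) -` B = B"
  shows "measure P B = 0 \<or> measure P B = 1"
proof -
  obtain Q where Q[measurable]: "Q \<in> G \<rightarrow>\<^sub>M path_space" and Qfst: "AE p in P. Q p = fst p"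
    using strong_solution by blast
  have "(\<lambda>w. (Q w, snd w)) \<in> G \<rightarrow>\<^sub>M path_space \<Otimes>\<^sub>M path_space" by measurable
  from measurable_sets[OF this B[unfolded sets_P]]
  obtain D where D: "D \<in> sets path_space" "{w. (Q w, snd w) \<in> B} = snd -` D"
    unfolding sets_G by (auto simp: G_def vimage_def)
  have BD: "AE w in P. w \<in> B \<longleftrightarrow> snd w \<in> D"
    using Qfst
  proof eventually_elim
    case (elim w)
    then have "w \<in> B \<longleftrightarrow> w \<in> {w. (Q w, snd w) \<in> B}" by simp
    then show ?case unfolding D(2) by simp
  qed
  have "AE w in P. time_shift (int k) (snd w) \<in> D \<longleftrightarrow> snd w \<in> D"
    using BD AE_joint_shift[OF BD, of "int k"]
  proof eventually_elim
    case (elim w)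
    have "joint_shift (int k) w \<in> B \<longleftrightarrow> w \<in> B" using inv by auto
    then show ?case using elim by (simp add: joint_shift_simps)
  qed
  from noise_event_trivial[OF D(1) k this]
  have "measure P (snd -` D) = 0 \<or> measure P (snd -` D) = 1" .
  moreover have "measure P B = measure P (snd -` D)"
    using B measurable_sets[OF snd_measurable D(1)] BD by (intro finite_measure_eq_AE) (auto simp: space_P)
  ultimately show ?thesis by simp
qed

end

text \<open>Ergodicity of all powers of the shift is what a recursion contracting after \<open>r\<close> steps requires.\<close>

definition totally_ergodic_process :: "'a measure \<Rightarrow> (int \<Rightarrow> 'a \<Rightarrow> real) \<Rightarrow> bool" where
  "totally_ergodic_process M X \<longleftrightarrow>
     stationary_process M X \<and>
     (\<forall>k\<ge>1. \<forall>B\<in>sets path_space. time_shift (int k) -` B = B \<longrightarrow>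
        measure (distr M path_space (\<lambda>\<omega> t. X t \<omega>)) B \<in> {0, 1})"

text \<open>A function of the pair of paths that solves the recursion is a process on the original space, so the
uniqueness there carries over to the law.\<close>

lemma unique_causal_solution_law:
  fixes \<psi> :: "real \<Rightarrow> real \<Rightarrow> real" and h l :: "real \<Rightarrow> real"
  assumes "prob_space M" and iid: "iid_process M Z"
    and D: "D \<in> sets borel" and lh: "\<forall>s\<in>D. l (h s) = s"
    and h[measurable]: "h \<in> borel_measurable borel" and l[measurable]: "l \<in> borel_measurable borel"
    and \<psi>: "(\<lambda>(x, z). \<psi> x z) \<in> borel_measurable (borel \<Otimes>\<^sub>M borel)"
    and uniq: "unique_stationary_solution M D h (\<lambda>t \<omega> x. \<psi> x (Z t \<omega>)) Y"
    and causal: "non_anticipative M Z Y"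
  shows "unique_solution_law (distr M (path_space \<Otimes>\<^sub>M path_space) (joint_path Y Z)) (distr M borel (Z 0))
    {p. \<forall>t. fst p t \<in> D \<and> h (fst p (t + 1)) = \<psi> (h (fst p t)) (snd p t)}"
    (is "unique_solution_law ?P ?N ?Sol")
proof -
  interpret prob_space M by fact
  let ?W = "path_space \<Otimes>\<^sub>M path_space"
  have Y: "stationary_process M Y" and sol: "\<And>t. AE \<omega> in M. Y t \<omega> \<in> D \<and> h (Y (t + 1) \<omega>) = \<psi> (h (Y t \<omega>)) (Z t \<omega>)"
    using uniq unfolding unique_stationary_solution_def stationary_solution_def by blast+
  have Zm: "Z t \<in> borel_measurable M" for t by (rule iid_path_law[OF assms(1) iid])
  have Ym: "Y t \<in> borel_measurable M" for t using Y unfolding stationary_process_def by blast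
  have J: "joint_path Y Z \<in> M \<rightarrow>\<^sub>M ?W" by (rule measurable_joint_path[OF Ym Zm])
  have Jk: "joint_path (\<lambda>t. Y (t + k)) (\<lambda>t. Z (t + k)) = (\<lambda>\<omega>. joint_shift k (joint_path Y Z \<omega>))" for k
    by (simp add: joint_path_def joint_shift_def time_shift_def fun_eq_iff)
  have f: "(\<lambda>(y, z). l (\<psi> (h y) z)) \<in> borel_measurable (borel \<Otimes>\<^sub>M borel)"
  proof -
    have "(\<lambda>p. (h (fst p), snd p)) \<in> borel \<Otimes>\<^sub>M borel \<rightarrow>\<^sub>M borel \<Otimes>\<^sub>M (borel :: real measure)" by measurable
    from measurable_compose[OF measurable_compose[OF this \<psi>] l] show ?thesis by (simp add: case_prod_beta')
  qed
  have rec: "AE \<omega> in M. Y (t + 1) \<omega> = l (\<psi> (h (Y t \<omega>)) (Z t \<omega>))" for t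
    using sol[of t] sol[of "t + 1"] by eventually_elim (metis lh)
  have comp: "(\<lambda>p. fst p t) \<in> borel_measurable ?W" "(\<lambda>p. snd p t) \<in> borel_measurable ?W" for t
    by (intro measurable_compose[OF measurable_fst measurable_component_singleton[OF UNIV_I]]
        measurable_compose[OF measurable_snd measurable_component_singleton[OF UNIV_I]])+
  have Sol: "?Sol \<in> sets ?W"
  proof -
    have 1: "{p \<in> space ?W. fst p t \<in> D} \<in> sets ?W" for t
      using measurable_sets[OF comp(1) D] by (simp add: vimage_def Collect_conj_eq Int_commute)
    have "(\<lambda>p. (h (fst p t), snd p t)) \<in> ?W \<rightarrow>\<^sub>M borel \<Otimes>\<^sub>M borel" for t
      by (intro measurable_Pair measurable_compose[OF comp(1) h] comp)
    from measurable_compose[OF this \<psi>]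
    have 2: "(\<lambda>p. \<psi> (h (fst p t)) (snd p t)) \<in> borel_measurable ?W" for t by simp
    have "{p \<in> space ?W. h (fst p (t + 1)) = \<psi> (h (fst p t)) (snd p t)} \<in> sets ?W" for t
      by (rule borel_measurable_eq[OF measurable_compose[OF comp(1) h] 2])
    then have "{p \<in> space ?W. \<forall>t. fst p t \<in> D \<and> h (fst p (t + 1)) = \<psi> (h (fst p t)) (snd p t)} \<in> sets ?W"
      using 1 by (intro sets.sets_Collect_countable_All sets.sets_Collect_conj) auto
    then show ?thesis by (simp add: space_pair_measure space_PiM)
  qed
  have solJ: "AE \<omega> in M. joint_path Y Z \<omega> \<in> ?Sol"
  proof -
    have "AE \<omega> in M. \<forall>t. Y t \<omega> \<in> D \<and> h (Y (t + 1) \<omega>) = \<psi> (h (Y t \<omega>)) (Z t \<omega>)"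
      unfolding AE_all_countable using sol by blast
    then show ?thesis by eventually_elim (simp add: joint_path_def)
  qed
  show ?thesis
  proof (rule unique_solution_law.intro)
    show "prob_space ?P" by (rule prob_space_distr[OF J])
    show "sets ?P = sets ?W" by simp
    show "prob_space ?N" by (rule iid_path_law[OF assms(1) iid])
    show "?Sol \<in> sets ?W" by (rule Sol)
    show "distr ?P ?P (joint_shift k) = ?P" for k
    proof -
      have "distr ?P ?P (joint_shift k) = distr ?P ?W (joint_shift k)" by (rule distr_cong) auto
      also have "\<dots> = distr M ?W (joint_path (\<lambda>t. Y (t + k)) (\<lambda>t. Z (t + k)))"
        unfolding Jk by (subst distr_distr[OF measurable_joint_shift J]) (simp add: comp_def)
      also have "\<dots> = ?P"
        by (rule causal_solution_jointly_stationary[OF assms(1) iid Y causal f rec])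
      finally show ?thesis .
    qed
    show "distr ?P path_space snd = PiM UNIV (\<lambda>_. ?N)"
    proof -
      have "distr ?P path_space snd = distr M path_space (\<lambda>\<omega> t. Z t \<omega>)"
        by (subst distr_distr[OF measurable_snd J]) (simp add: comp_def joint_path_def)
      then show ?thesis using iid_path_law(2)[OF assms(1) iid] by simp
    qed
    show "joint_shift k p \<in> ?Sol \<longleftrightarrow> p \<in> ?Sol" for k p
    proof -
      have "(\<forall>t. Q (t + k)) \<longleftrightarrow> (\<forall>t. Q t)" for Q :: "int \<Rightarrow> bool" by (metis diff_add_cancel)
      from this[of "\<lambda>t. fst p t \<in> D \<and> h (fst p (t + 1)) = \<psi> (h (fst p t)) (snd p t)"]
      show ?thesis by (simp add: joint_shift_def time_shift_def algebra_simps)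
    qed
    show "AE p in ?P. p \<in> ?Sol"
      by (subst AE_distr_iff[OF J]) (use Sol solJ in \<open>auto simp: space_pair_measure space_PiM\<close>)
    fix R assume R': "R \<in> ?P \<rightarrow>\<^sub>M path_space"
      and stat: "\<And>k. distr ?P path_space (\<lambda>p. time_shift k (R p)) = distr ?P path_space R"
      and solR: "AE p in ?P. (R p, snd p) \<in> ?Sol"
    have R: "R \<in> ?W \<rightarrow>\<^sub>M path_space" using R' by simp
    define Y' where "Y' t \<omega> = R (joint_path Y Z \<omega>) t" for t \<omega>
    have RJ: "(\<lambda>\<omega>. R (joint_path Y Z \<omega>)) \<in> M \<rightarrow>\<^sub>M path_space" by (rule measurable_compose[OF J R])
    have Y'm: "Y' t \<in> borel_measurable M" for t
      unfolding Y'_def[abs_def] by (rule measurable_compose[OF RJ measurable_component_singleton[OF UNIV_I]])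
    have shR: "(\<lambda>p. time_shift k (R p)) \<in> ?W \<rightarrow>\<^sub>M path_space" for k
      by (rule measurable_compose[OF R measurable_shift])
    have lawY': "distr M path_space (\<lambda>\<omega> t. Y' (t + k) \<omega>) = distr ?P path_space (\<lambda>p. time_shift k (R p))" for k
      by (subst distr_distr[OF shR J]) (simp add: comp_def Y'_def time_shift_def)
    have "stationary_process M Y'"
      unfolding stationary_process_def using Y'm lawY' lawY'[of 0] stat by (simp add: shift_0)
    moreover have "AE \<omega> in M. (R (joint_path Y Z \<omega>), snd (joint_path Y Z \<omega>)) \<in> ?Sol"
      by (rule AE_distrD[OF J solR])
    then have "AE \<omega> in M. \<forall>t. Y' t \<omega> \<in> D \<and> h (Y' (t + 1) \<omega>) = \<psi> (h (Y' t \<omega>)) (Z t \<omega>)"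
      by eventually_elim (simp add: Y'_def joint_path_def)
    then have "AE \<omega> in M. Y' t \<omega> \<in> D \<and> h (Y' (t + 1) \<omega>) = \<psi> (h (Y' t \<omega>)) (Z t \<omega>)" for t
      by eventually_elim blast
    ultimately have "stationary_solution M D h (\<lambda>t \<omega> x. \<psi> x (Z t \<omega>)) Y'"
      unfolding stationary_solution_def by blast
    then have "AE \<omega> in M. Y' t \<omega> = Y t \<omega>" for t
      using uniq unfolding unique_stationary_solution_def by blast
    then have "AE \<omega> in M. \<forall>t. Y' t \<omega> = Y t \<omega>" by (simp add: AE_all_countable)
    then have ae: "AE \<omega> in M. R (joint_path Y Z \<omega>) = fst (joint_path Y Z \<omega>)"
      by eventually_elim (simp add: Y'_def joint_path_def fun_eq_iff)
    have "{p \<in> space ?W. \<forall>t. R p t = fst p t} \<in> sets ?W"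
      by (intro sets.sets_Collect_countable_All borel_measurable_eq comp
          measurable_compose[OF R measurable_component_singleton[OF UNIV_I]])
    then have "{p \<in> space ?W. R p = fst p} \<in> sets ?W" by (simp only: fun_eq_iff)
    from AE_distr_iff[OF J this] show "AE p in ?P. R p = fst p" using ae by blast
  qed
qed

theorem unique_causal_solution_ergodic:
  fixes \<psi> g :: "real \<Rightarrow> real \<Rightarrow> real" and h l :: "real \<Rightarrow> real"
  assumes "prob_space M" and "iid_process M Z"
    and "D \<in> sets borel" and "\<forall>s\<in>D. l (h s) = s"
    and "h \<in> borel_measurable borel" and "l \<in> borel_measurable borel"
    and "(\<lambda>(x, z). \<psi> x z) \<in> borel_measurable (borel \<Otimes>\<^sub>M borel)"
    and "unique_stationary_solution M D h (\<lambda>t \<omega> x. \<psi> x (Z t \<omega>)) Y"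
    and "non_anticipative M Z Y"
    and g: "(\<lambda>(y, z). g y z) \<in> borel_measurable (borel \<Otimes>\<^sub>M borel)"
  shows "totally_ergodic_process M (\<lambda>t \<omega>. g (Y t \<omega>) (Z t \<omega>))"
proof -
  let ?W = "path_space \<Otimes>\<^sub>M path_space" and ?P = "distr M (path_space \<Otimes>\<^sub>M path_space) (joint_path Y Z)"
  interpret P: unique_solution_law ?P "distr M borel (Z 0)"
    "{p. \<forall>t. fst p t \<in> D \<and> h (fst p (t + 1)) = \<psi> (h (fst p t)) (snd p t)}"
    by (rule unique_causal_solution_law[OF assms(1-9)])
  have Zm: "Z t \<in> borel_measurable M" for t by (rule iid_path_law[OF assms(1,2)])
  have Ym: "Y t \<in> borel_measurable M" for t
    using assms(8) unfolding unique_stationary_solution_def stationary_solution_def stationary_process_def by blast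
  have J: "joint_path Y Z \<in> M \<rightarrow>\<^sub>M ?W" by (rule measurable_joint_path[OF Ym Zm])
  define X where "X t \<omega> = g (Y t \<omega>) (Z t \<omega>)" for t \<omega>
  define \<Phi> where "\<Phi> p = (\<lambda>t::int. g (fst p t) (snd p t))" for p :: "(int \<Rightarrow> real) \<times> (int \<Rightarrow> real)"
  have \<Phi>: "\<Phi> \<in> ?W \<rightarrow>\<^sub>M path_space"
    unfolding \<Phi>_def[abs_def]
  proof (rule measurable_paths)
    fix t
    have "(\<lambda>p. (fst p t, snd p t)) \<in> ?W \<rightarrow>\<^sub>M borel \<Otimes>\<^sub>M borel"
      by (intro measurable_Pair measurable_compose[OF measurable_fst measurable_component_singleton[OF UNIV_I]]
        measurable_compose[OF measurable_snd measurable_component_singleton[OF UNIV_I]])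
    from measurable_compose[OF this g] show "(\<lambda>p. g (fst p t) (snd p t)) \<in> borel_measurable ?W" by simp
  qed
  have \<Phi>_shift: "\<Phi> (joint_shift k p) = time_shift k (\<Phi> p)" for k p
    by (simp add: \<Phi>_def joint_shift_def time_shift_def)
  have Xm: "X t \<in> borel_measurable M" for t
  proof -
    have "(\<lambda>\<omega>. (Y t \<omega>, Z t \<omega>)) \<in> M \<rightarrow>\<^sub>M borel \<Otimes>\<^sub>M borel" by (intro measurable_Pair Ym Zm)
    from measurable_compose[OF this g] show ?thesis by (simp add: X_def[abs_def])
  qed
  have lawX: "distr M path_space (\<lambda>\<omega> t. X (t + k) \<omega>) = distr (distr ?P ?P (joint_shift k)) path_space \<Phi>" for k
  proof -
    have 1: "distr ?P ?P (joint_shift k) = distr ?P ?W (joint_shift k)" by (rule distr_cong) auto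
    have "distr (distr ?P ?P (joint_shift k)) path_space \<Phi> = distr M path_space (\<lambda>\<omega>. \<Phi> (joint_shift k (joint_path Y Z \<omega>)))"
      unfolding 1 by (simp add: distr_distr[OF measurable_joint_shift J] distr_distr[OF \<Phi> measurable_compose[OF J measurable_joint_shift]] comp_def)
    also have "(\<lambda>\<omega>. \<Phi> (joint_shift k (joint_path Y Z \<omega>))) = (\<lambda>\<omega> t. X (t + k) \<omega>)"
      by (simp add: \<Phi>_shift) (simp add: time_shift_def \<Phi>_def joint_path_def X_def)
    finally show ?thesis by simp
  qed
  have "stationary_process M X"
    unfolding stationary_process_def using Xm lawX lawX[of 0] by (simp add: P.stationary_P)
  moreover have "measure (distr M path_space (\<lambda>\<omega> t. X t \<omega>)) B \<in> {0, 1}"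
    if k: "k \<ge> 1" and B: "B \<in> sets path_space" and inv: "time_shift (int k) -` B = B" for k B
  proof -
    have "distr M path_space (\<lambda>\<omega> t. X t \<omega>) = distr ?P path_space \<Phi>"
      using lawX[of 0] by (simp add: P.stationary_P)
    moreover have "measure (distr ?P path_space \<Phi>) B = measure ?P (\<Phi> -` B)"
      using \<Phi> B by (subst measure_distr) (auto simp: space_pair_measure space_PiM)
    moreover have "\<Phi> -` B \<in> sets ?P"
      using measurable_sets[OF \<Phi> B] by (simp add: space_pair_measure space_PiM)
    moreover have "joint_shift (int k) -` (\<Phi> -` B) = \<Phi> -` B"
    proof (rule set_eqI)
      fix p
      have "time_shift (int k) (\<Phi> p) \<in> B \<longleftrightarrow> \<Phi> p \<in> B" using inv by (metis vimage_eq)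
      then show "p \<in> joint_shift (int k) -` (\<Phi> -` B) \<longleftrightarrow> p \<in> \<Phi> -` B" by (simp only: vimage_eq \<Phi>_shift)
    qed
    ultimately show ?thesis using P.invariant_event_trivial[of "\<Phi> -` B" k] k by simp
  qed
  ultimately show ?thesis unfolding totally_ergodic_process_def X_def[abs_def, symmetric] by blast
qed

section \<open>Lipschitz constants over countable dense sets\<close>

lemma log_plus_nonneg: "0 \<le> log_plus x"
  by (simp add: log_plus_def)

lemma log_plus_mono: "x \<le> y \<Longrightarrow> log_plus x \<le> log_plus y"
  unfolding log_plus_def by (subst ln_le_cancel_iff) auto

lemma le_exp_log_plus: "x \<le> exp (log_plus x)"
  unfolding log_plus_def by simp

lemma log_plus_mult_le:
  assumes "0 \<le> x" "0 \<le> y" shows "log_plus (x * y) \<le> log_plus x + log_plus y"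
proof -
  have "x * y \<le> max 1 x * max 1 y" using assms by (intro mult_mono) auto
  moreover have "1 \<le> max 1 x * max 1 y" using mult_mono[of 1 "max 1 x" 1 "max 1 y"] by simp
  ultimately have "max 1 (x * y) \<le> max 1 x * max 1 y" by simp
  then have "ln (max 1 (x * y)) \<le> ln (max 1 x * max 1 y)" by (subst ln_le_cancel_iff) auto
  also have "\<dots> = ln (max 1 x) + ln (max 1 y)" by (rule ln_mult_pos) auto
  finally show ?thesis by (simp add: log_plus_def)
qed

lemma log_plus_add_le: "log_plus (x + y) \<le> ln 2 + log_plus x + log_plus y"
proof -
  have "max 1 x \<le> max 1 x * max 1 y" "max 1 y \<le> max 1 x * max 1 y"
    using mult_mono[of "max 1 x" "max 1 x" 1 "max 1 y"] mult_mono[of 1 "max 1 x" "max 1 y" "max 1 y"] by auto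
  moreover have "1 \<le> max 1 x * max 1 y" using mult_mono[of 1 "max 1 x" 1 "max 1 y"] by simp
  ultimately have "max 1 (x + y) \<le> 2 * (max 1 x * max 1 y)" by linarith
  then have "ln (max 1 (x + y)) \<le> ln (2 * (max 1 x * max 1 y))" by (subst ln_le_cancel_iff) auto
  also have "\<dots> = ln 2 + (ln (max 1 x) + ln (max 1 y))" by (simp add: ln_mult_pos)
  finally show ?thesis by (simp add: log_plus_def)
qed

lemma log_plus_prod_le:
  fixes m :: nat
  assumes "\<And>i. 0 \<le> f i" shows "log_plus (\<Prod>i<m. f i) \<le> (\<Sum>i<m. log_plus (f i))"
proof (induction m)
  case (Suc m)
  have "log_plus ((\<Prod>i<m. f i) * f m) \<le> log_plus (\<Prod>i<m. f i) + log_plus (f m)"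
    by (intro log_plus_mult_le prod_nonneg assms)
  then show ?case using Suc by simp
qed (simp add: log_plus_def)

lemma measurable_log_plus [measurable]: "log_plus \<in> borel_measurable borel"
  unfolding log_plus_def[abs_def] by measurable

text \<open>Suprema are taken over a countable dense set, for measurability; continuity extends the bounds to the whole set.\<close>

definition dense_part :: "'b::{metric_space,second_countable_topology} set \<Rightarrow> 'b set" where
  "dense_part S = (SOME T. countable T \<and> T \<subseteq> S \<and> S \<subseteq> closure T)"

lemma dense_part: "countable (dense_part S)" "dense_part S \<subseteq> S" "S \<subseteq> closure (dense_part S)"
proof -
  have "\<exists>T. countable T \<and> T \<subseteq> S \<and> S \<subseteq> closure T" using separable[of S] by metis
  from someI_ex[OF this] show "countable (dense_part S)" "dense_part S \<subseteq> S" "S \<subseteq> closure (dense_part S)"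
    unfolding dense_part_def by blast+
qed

lemma dense_part_sequence:
  assumes "x \<in> S" shows "\<exists>s. (\<forall>n::nat. s n \<in> dense_part S) \<and> s \<longlonglongrightarrow> x"
  using assms dense_part(3)[of S] closure_sequential by blast

definition sup_abs :: "'p set \<Rightarrow> ('p \<Rightarrow> real) \<Rightarrow> real" where
  "sup_abs T f = enn2real (SUP \<theta>\<in>T. ennreal \<bar>f \<theta>\<bar>)"

text \<open>The smallest Lipschitz constant on \<open>A\<close>, uniform in the parameters in \<open>T\<close>. The terms with \<open>x = x'\<close> are zero because
division by zero is zero, and an infinite supremum is sent to zero.\<close>

definition lip_const :: "real set \<Rightarrow> 'p set \<Rightarrow> (real \<Rightarrow> 'p \<Rightarrow> real) \<Rightarrow> real" where
  "lip_const A T G = enn2real (SUP \<theta>\<in>T. SUP x\<in>A. SUP x'\<in>A. ennreal (\<bar>G x \<theta> - G x' \<theta>\<bar> / \<bar>x - x'\<bar>))"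

lemma sup_abs_nonneg: "0 \<le> sup_abs T f" and lip_const_nonneg: "0 \<le> lip_const A T G"
  by (simp_all add: sup_abs_def lip_const_def)

lemma sup_abs_le:
  assumes "0 \<le> c" "\<And>\<theta>. \<theta> \<in> T \<Longrightarrow> \<bar>f \<theta>\<bar> \<le> c" shows "sup_abs T f \<le> c"
proof -
  have "(SUP \<theta>\<in>T. ennreal \<bar>f \<theta>\<bar>) \<le> ennreal c" by (intro SUP_least ennreal_leI assms)
  then have "sup_abs T f \<le> enn2real (ennreal c)" unfolding sup_abs_def by (rule enn2real_mono) simp
  then show ?thesis using assms(1) by simp
qed

lemma sup_abs_upper:
  assumes c: "\<And>\<theta>. \<theta> \<in> T \<Longrightarrow> \<bar>f \<theta>\<bar> \<le> c" and "\<theta> \<in> T" shows "\<bar>f \<theta>\<bar> \<le> sup_abs T f"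
proof -
  have "(SUP \<theta>\<in>T. ennreal \<bar>f \<theta>\<bar>) \<le> ennreal c" by (intro SUP_least ennreal_leI c)
  then have "(SUP \<theta>\<in>T. ennreal \<bar>f \<theta>\<bar>) < top" using ennreal_less_top le_less_trans by blast
  moreover have "ennreal \<bar>f \<theta>\<bar> \<le> (SUP \<theta>\<in>T. ennreal \<bar>f \<theta>\<bar>)" by (rule SUP_upper[OF assms(2)])
  ultimately have "enn2real (ennreal \<bar>f \<theta>\<bar>) \<le> sup_abs T f" unfolding sup_abs_def by (intro enn2real_mono)
  then show ?thesis by simp
qed

lemma lip_quotient_le:
  assumes "0 \<le> c" "\<bar>a - b\<bar> \<le> c * \<bar>x - x'\<bar>" shows "\<bar>a - b\<bar> / \<bar>x - x'\<bar> \<le> (c :: real)"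
  using assms by (cases "x = x'") (auto simp: divide_simps)

lemma lip_const_le:
  assumes "0 \<le> c"
    and "\<And>\<theta> x x'. \<theta> \<in> T \<Longrightarrow> x \<in> A \<Longrightarrow> x' \<in> A \<Longrightarrow> \<bar>G x \<theta> - G x' \<theta>\<bar> \<le> c * \<bar>x - x'\<bar>"
  shows "lip_const A T G \<le> c"
proof -
  have "(SUP \<theta>\<in>T. SUP x\<in>A. SUP x'\<in>A. ennreal (\<bar>G x \<theta> - G x' \<theta>\<bar> / \<bar>x - x'\<bar>)) \<le> ennreal c"
    by (intro SUP_least ennreal_leI lip_quotient_le assms)
  then have "lip_const A T G \<le> enn2real (ennreal c)" unfolding lip_const_def by (rule enn2real_mono) simp
  then show ?thesis using assms(1) by simp
qed

lemma lip_const_bound: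
  assumes c: "0 \<le> c"
    and G: "\<And>\<theta> x x'. \<theta> \<in> T \<Longrightarrow> x \<in> A \<Longrightarrow> x' \<in> A \<Longrightarrow> \<bar>G x \<theta> - G x' \<theta>\<bar> \<le> c * \<bar>x - x'\<bar>"
    and mem: "\<theta> \<in> T" "x \<in> A" "x' \<in> A"
  shows "\<bar>G x \<theta> - G x' \<theta>\<bar> \<le> lip_const A T G * \<bar>x - x'\<bar>"
proof -
  have "(SUP \<theta>\<in>T. SUP x\<in>A. SUP x'\<in>A. ennreal (\<bar>G x \<theta> - G x' \<theta>\<bar> / \<bar>x - x'\<bar>)) \<le> ennreal c"
    by (intro SUP_least ennreal_leI lip_quotient_le c G)
  then have fin: "(SUP \<theta>\<in>T. SUP x\<in>A. SUP x'\<in>A. ennreal (\<bar>G x \<theta> - G x' \<theta>\<bar> / \<bar>x - x'\<bar>)) < top"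
    using ennreal_less_top le_less_trans by blast
  have "ennreal (\<bar>G x \<theta> - G x' \<theta>\<bar> / \<bar>x - x'\<bar>) \<le> (SUP \<theta>\<in>T. SUP x\<in>A. SUP x'\<in>A. ennreal (\<bar>G x \<theta> - G x' \<theta>\<bar> / \<bar>x - x'\<bar>))"
    using mem by (intro SUP_upper2[of \<theta>] SUP_upper2[of x] SUP_upper2[of x'] order_refl)
  from enn2real_mono[OF this fin] have "\<bar>G x \<theta> - G x' \<theta>\<bar> / \<bar>x - x'\<bar> \<le> lip_const A T G"
    unfolding lip_const_def by simp
  then show ?thesis using G[OF mem] by (cases "x = x'") (auto simp: divide_simps)
qed

lemma measurable_sup_abs:
  assumes "countable T" "\<And>\<theta>. \<theta> \<in> T \<Longrightarrow> (\<lambda>v. f v \<theta>) \<in> borel_measurable N"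
  shows "(\<lambda>v. sup_abs T (f v)) \<in> borel_measurable N"
proof -
  have "(\<lambda>v. SUP \<theta>\<in>T. ennreal \<bar>f v \<theta>\<bar>) \<in> borel_measurable N"
    by (intro borel_measurable_SUP assms measurable_compose[OF _ measurable_ennreal] borel_measurable_abs)
  then show ?thesis unfolding sup_abs_def by measurable
qed

lemma measurable_lip_const:
  assumes "countable T" "countable A"
    and m: "\<And>\<theta> x. \<theta> \<in> T \<Longrightarrow> x \<in> A \<Longrightarrow> (\<lambda>v. G v x \<theta>) \<in> borel_measurable N"
  shows "(\<lambda>v. lip_const A T (G v)) \<in> borel_measurable N"
proof -
  have "(\<lambda>v. SUP \<theta>\<in>T. SUP x\<in>A. SUP x'\<in>A. ennreal (\<bar>G v x \<theta> - G v x' \<theta>\<bar> / \<bar>x - x'\<bar>)) \<in> borel_measurable N"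
    by (intro borel_measurable_SUP assms measurable_compose[OF _ measurable_ennreal]
        borel_measurable_abs borel_measurable_divide borel_measurable_diff borel_measurable_const)
  then show ?thesis unfolding lip_const_def by measurable
qed

text \<open>The function is continuous in both variables, and \<open>B\<close> is open, so that points of \<open>dense_part \<Theta>\<close> near \<open>\<theta>\<close> lie in \<open>B\<close>.\<close>

lemma lip_const_dense:
  fixes K :: "real set" and \<Theta> B :: "'p::{metric_space,second_countable_topology} set" and G :: "real \<Rightarrow> 'p \<Rightarrow> real"
  assumes L: "\<And>x x' \<theta>. x \<in> K \<Longrightarrow> x' \<in> K \<Longrightarrow> \<theta> \<in> \<Theta> \<Longrightarrow> \<bar>G x \<theta> - G x' \<theta>\<bar> \<le> c * \<bar>x - x'\<bar>"
    and c: "0 \<le> c"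
    and cont: "\<And>x. x \<in> K \<Longrightarrow> continuous_on \<Theta> (\<lambda>\<theta>. G x \<theta>)"
    and B: "open B" and \<theta>: "\<theta> \<in> \<Theta> \<inter> B" and x: "x \<in> K" "x' \<in> K"
  shows "\<bar>G x \<theta> - G x' \<theta>\<bar> \<le> lip_const (dense_part K) (dense_part \<Theta> \<inter> B) G * \<bar>x - x'\<bar>"
proof -
  let ?s = "lip_const (dense_part K) (dense_part \<Theta> \<inter> B) G"
  have base: "\<bar>G a \<eta> - G a' \<eta>\<bar> \<le> ?s * \<bar>a - a'\<bar>"
    if "\<eta> \<in> dense_part \<Theta> \<inter> B" "a \<in> dense_part K" "a' \<in> dense_part K" for \<eta> a a'
    by (rule lip_const_bound[OF c L that]) (use dense_part(2)[of K] dense_part(2)[of \<Theta>] in auto)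
  have xlim: "(\<lambda>n. G (s n) \<eta>) \<longlonglongrightarrow> G a \<eta>"
    if s: "\<forall>n. s n \<in> dense_part K" "s \<longlonglongrightarrow> a" and "a \<in> K" "\<eta> \<in> \<Theta>" for s a \<eta>
  proof (rule LIM_zero_cancel)
    show "(\<lambda>n. G (s n) \<eta> - G a \<eta>) \<longlonglongrightarrow> 0"
    proof (rule Lim_null_comparison)
      have "(\<lambda>n. c * \<bar>s n - a\<bar>) \<longlonglongrightarrow> c * \<bar>a - a\<bar>" by (intro tendsto_intros s)
      then show "(\<lambda>n. c * \<bar>s n - a\<bar>) \<longlonglongrightarrow> 0" by simp
      show "\<forall>\<^sub>F n in sequentially. norm (G (s n) \<eta> - G a \<eta>) \<le> c * \<bar>s n - a\<bar>"
        unfolding real_norm_def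
        by (intro always_eventually allI L that(3,4)) (use s(1) dense_part(2)[of K] in auto)
    qed
  qed
  have x_all: "\<bar>G a \<eta> - G a' \<eta>\<bar> \<le> ?s * \<bar>a - a'\<bar>"
    if \<eta>: "\<eta> \<in> dense_part \<Theta> \<inter> B" and a: "a \<in> K" "a' \<in> K" for \<eta> a a'
  proof -
    obtain s where s: "\<forall>n. s n \<in> dense_part K" "s \<longlonglongrightarrow> a" using dense_part_sequence[OF a(1)] by blast
    obtain s' where s': "\<forall>n. s' n \<in> dense_part K" "s' \<longlonglongrightarrow> a'" using dense_part_sequence[OF a(2)] by blast
    have \<eta>': "\<eta> \<in> \<Theta>" using \<eta> dense_part(2)[of \<Theta>] by auto
    have "(\<lambda>n. \<bar>G (s n) \<eta> - G (s' n) \<eta>\<bar>) \<longlonglongrightarrow> \<bar>G a \<eta> - G a' \<eta>\<bar>"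
      by (intro tendsto_rabs tendsto_diff xlim s s' a \<eta>')
    moreover have "(\<lambda>n. ?s * \<bar>s n - s' n\<bar>) \<longlonglongrightarrow> ?s * \<bar>a - a'\<bar>"
      by (intro tendsto_intros s s')
    ultimately show ?thesis
      by (rule LIMSEQ_le) (use base[OF \<eta>] s(1) s'(1) in auto)
  qed
  obtain t where t: "\<forall>n. t n \<in> dense_part \<Theta>" "t \<longlonglongrightarrow> \<theta>" using dense_part_sequence[of \<theta> \<Theta>] \<theta> by blast
  have t\<Theta>: "t n \<in> \<Theta>" for n using t(1) dense_part(2)[of \<Theta>] by auto
  have "\<forall>\<^sub>F n in sequentially. t n \<in> B" using topological_tendstoD[OF t(2) B] \<theta> by blast
  then have ev: "\<forall>\<^sub>F n in sequentially. \<bar>G x (t n) - G x' (t n)\<bar> \<le> ?s * \<bar>x - x'\<bar>"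
    by eventually_elim (use x_all[OF _ x] t(1) in auto)
  have tl: "(\<lambda>n. G a (t n)) \<longlonglongrightarrow> G a \<theta>" if "a \<in> K" for a
    using continuous_on_tendsto_compose[OF cont[OF that] t(2)] \<theta> t\<Theta> by auto
  have "(\<lambda>n. \<bar>G x (t n) - G x' (t n)\<bar>) \<longlonglongrightarrow> \<bar>G x \<theta> - G x' \<theta>\<bar>"
    by (intro tendsto_rabs tendsto_diff tl x)
  then show ?thesis by (rule tendsto_upperbound[OF _ ev]) simp
qed

lemma sup_abs_dense:
  fixes \<Theta> :: "'p::{metric_space,second_countable_topology} set" and f :: "'p \<Rightarrow> real"
  assumes c: "\<And>\<theta>. \<theta> \<in> \<Theta> \<Longrightarrow> \<bar>f \<theta>\<bar> \<le> c" and cont: "continuous_on \<Theta> f" and \<theta>: "\<theta> \<in> \<Theta>"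
  shows "\<bar>f \<theta>\<bar> \<le> sup_abs (dense_part \<Theta>) f"
proof -
  obtain t where t: "\<forall>n. t n \<in> dense_part \<Theta>" "t \<longlonglongrightarrow> \<theta>" using dense_part_sequence[OF \<theta>] by blast
  have t\<Theta>: "t n \<in> \<Theta>" for n using t(1) dense_part(2)[of \<Theta>] by auto
  have "(\<lambda>n. \<bar>f (t n)\<bar>) \<longlonglongrightarrow> \<bar>f \<theta>\<bar>"
    using continuous_on_tendsto_compose[OF cont t(2) \<theta>] t\<Theta> by (intro tendsto_rabs) auto
  moreover have "\<bar>f (t n)\<bar> \<le> sup_abs (dense_part \<Theta>) f" for n
    by (rule sup_abs_upper[where c=c]) (use c t(1) dense_part(2)[of \<Theta>] in auto)
  ultimately show ?thesis by (intro LIMSEQ_le_const2) auto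
qed

lemma continuous_abs_bounded:
  fixes f :: "'p::topological_space \<Rightarrow> real"
  assumes "compact \<Theta>" "continuous_on \<Theta> f" shows "\<exists>c\<ge>0. \<forall>\<theta>\<in>\<Theta>. \<bar>f \<theta>\<bar> \<le> c"
proof -
  have "bounded (f ` \<Theta>)" using assms by (intro compact_imp_bounded compact_continuous_image)
  then obtain c where "\<forall>\<theta>\<in>\<Theta>. \<bar>f \<theta>\<bar> \<le> c" unfolding bounded_iff by auto
  then have "\<forall>\<theta>\<in>\<Theta>. \<bar>f \<theta>\<bar> \<le> max 0 c" by (auto simp: max.coboundedI2)
  then show ?thesis by (meson max.cobounded1)
qed

lemma unif_norm_upper:
  assumes "compact \<Theta>" "continuous_on \<Theta> f" "\<theta> \<in> \<Theta>" shows "\<bar>f \<theta>\<bar> \<le> unif_norm \<Theta> f"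
  unfolding unif_norm_def using continuous_abs_bounded[OF assms(1,2)] assms(3)
  by (intro cSUP_upper) (auto intro: bdd_aboveI2)

lemma iterate_map_add:
  "iterate_map \<phi> (m + n) t \<omega> x \<theta> = iterate_map \<phi> m t \<omega> (iterate_map \<phi> n (t - int m) \<omega> x \<theta>) \<theta>"
  by (induction m arbitrary: t) (auto simp: algebra_simps)

lemma approx_eq_iterate_map:
  "approx \<phi> f (n + j) \<omega> \<theta> = iterate_map \<phi> n (int (n + j) - 1) \<omega> (approx \<phi> f j \<omega> \<theta>) \<theta>"
  by (induction n) (auto simp: algebra_simps)

section \<open>Recursions that contract on average\<close>

text \<open>A random recursion whose map at time \<open>t\<close> is a fixed function \<open>F\<close> of the driving variable \<open>X t\<close>. The coefficients \<open>\<Lambda>\<close>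
at different times need not have the same law; integrability and contraction are known at time 0 only.\<close>

locale contractive_recursion = prob_space M for M :: "'a measure" +
  fixes X :: "int \<Rightarrow> 'a \<Rightarrow> real"
    and F :: "real \<Rightarrow> real \<Rightarrow> 'p::euclidean_space \<Rightarrow> real"
    and \<phi> :: "int \<Rightarrow> 'a \<Rightarrow> real \<Rightarrow> 'p \<Rightarrow> real"
    and K :: "real set" and \<Theta> :: "'p set"
    and \<Lambda> :: "nat \<Rightarrow> int \<Rightarrow> 'a \<Rightarrow> 'p \<Rightarrow> real"
    and y :: real and r :: nat
  assumes ergodic: "totally_ergodic_process M X"
    and \<phi>: "\<phi> = (\<lambda>t \<omega> x \<theta>. F (X t \<omega>) x \<theta>)"
    and F_measurable: "\<And>\<theta>. \<theta> \<in> \<Theta> \<Longrightarrow> (\<lambda>(x, v). F v x \<theta>) \<in> borel_measurable (borel \<Otimes>\<^sub>M borel)"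
    and compact_\<Theta>: "compact \<Theta>" and \<Theta>_ne: "\<Theta> \<noteq> {}"
    and \<phi>_K: "AE \<omega> in M. \<forall>t. \<forall>x\<in>K. \<forall>\<theta>\<in>\<Theta>. \<phi> t \<omega> x \<theta> \<in> K"
    and \<phi>_C: "AE \<omega> in M. \<forall>t. \<forall>f\<in>cont_fun_space \<Theta> K. (\<lambda>\<theta>. \<phi> t \<omega> (f \<theta>) \<theta>) \<in> cont_fun_space \<Theta> K"
    and \<Lambda>: "\<forall>m\<in>{1, r}. AE \<omega> in M. \<forall>t. lipschitz_coeff K \<Theta> (iterate_map \<phi> m t \<omega>) (\<Lambda> m t \<omega>)"
    and \<Lambda>_measurable: "\<And>\<theta>. \<theta> \<in> \<Theta> \<Longrightarrow> (\<lambda>\<omega>. \<Lambda> r 0 \<omega> \<theta>) \<in> borel_measurable M"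
    and y: "y \<in> K" and y_log: "integrable M (\<lambda>\<omega>. log_plus (unif_norm \<Theta> (\<phi> 0 \<omega> y)))"
    and \<Lambda>_log: "integrable M (\<lambda>\<omega>. log_plus (unif_norm \<Theta> (\<Lambda> 1 0 \<omega>)))"
    and r: "r \<ge> 1"
    and contraction: "\<And>\<theta>. \<theta> \<in> \<Theta> \<Longrightarrow> ext_expectation M (\<lambda>\<omega>. ext_log (\<Lambda> r 0 \<omega> \<theta>)) < 0"
begin

definition path :: "'a \<Rightarrow> int \<Rightarrow> real" where "path \<omega> = (\<lambda>t. X t \<omega>)"

definition path_map :: "int \<Rightarrow> (int \<Rightarrow> real) \<Rightarrow> real \<Rightarrow> 'p \<Rightarrow> real" where
  "path_map t v x \<theta> = F (v t) x \<theta>"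

abbreviation iter :: "nat \<Rightarrow> int \<Rightarrow> (int \<Rightarrow> real) \<Rightarrow> real \<Rightarrow> 'p \<Rightarrow> real" where
  "iter \<equiv> iterate_map path_map"

lemma iterate_map_\<phi>: "iterate_map \<phi> m t \<omega> x \<theta> = iter m t (path \<omega>) x \<theta>"
  by (induction m arbitrary: t) (auto simp: \<phi> path_map_def path_def)

lemma iter_shift: "iter m t (time_shift k v) x \<theta> = iter m (t + k) v x \<theta>"
  by (induction m arbitrary: t) (auto simp: path_map_def time_shift_def algebra_simps)

lemma X_measurable: "X t \<in> borel_measurable M"
  using ergodic unfolding totally_ergodic_process_def stationary_process_def by blast

lemma path_measurable: "path \<in> M \<rightarrow>\<^sub>M path_space"
  unfolding path_def[abs_def] by (intro measurable_paths X_measurable)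

lemma shift_path_measurable: "(\<lambda>\<omega>. time_shift k (path \<omega>)) \<in> M \<rightarrow>\<^sub>M path_space"
  by (rule measurable_compose[OF path_measurable measurable_shift])

lemma iter_measurable:
  assumes \<theta>: "\<theta> \<in> \<Theta>" shows "(\<lambda>v. iter m t v x \<theta>) \<in> borel_measurable path_space"
proof (induction m arbitrary: t)
  case (Suc m)
  have "(\<lambda>v. (iter m (t - 1) v x \<theta>, v t)) \<in> path_space \<rightarrow>\<^sub>M borel \<Otimes>\<^sub>M borel"
    by (intro measurable_Pair Suc measurable_component_singleton UNIV_I)
  from measurable_compose[OF this F_measurable[OF \<theta>]]
  have "(\<lambda>v. F (v t) (iter m (t - 1) v x \<theta>) \<theta>) \<in> borel_measurable path_space" by simp
  moreover have "(\<lambda>v. iter (Suc m) t v x \<theta>) = (\<lambda>v. F (v t) (iter m (t - 1) v x \<theta>) \<theta>)"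
    by (rule ext) (simp add: path_map_def)
  ultimately show ?case by (simp only:)
qed simp

lemma path_law_stationary: "distr M path_space (\<lambda>\<omega>. time_shift k (path \<omega>)) = distr M path_space path"
  using ergodic unfolding totally_ergodic_process_def stationary_process_def
  by (simp add: path_def[abs_def] time_shift_def[abs_def])

lemma stationary_integral:
  fixes f :: "(int \<Rightarrow> real) \<Rightarrow> real"
  assumes f: "f \<in> borel_measurable path_space" and int: "integrable M (\<lambda>\<omega>. f (path \<omega>))"
  shows "integrable M (\<lambda>\<omega>. f (time_shift k (path \<omega>)))"
    and "(\<integral>\<omega>. f (time_shift k (path \<omega>)) \<partial>M) = (\<integral>\<omega>. f (path \<omega>) \<partial>M)"
proof -
  have "integrable (distr M path_space path) f"
    using int by (subst integrable_distr_eq[OF path_measurable f])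
  then have "integrable (distr M path_space (\<lambda>\<omega>. time_shift k (path \<omega>))) f" by (simp only: path_law_stationary)
  then show "integrable M (\<lambda>\<omega>. f (time_shift k (path \<omega>)))"
    by (subst (asm) integrable_distr_eq[OF shift_path_measurable f])
  show "(\<integral>\<omega>. f (time_shift k (path \<omega>)) \<partial>M) = (\<integral>\<omega>. f (path \<omega>) \<partial>M)"
    unfolding integral_distr[OF path_measurable f, symmetric] integral_distr[OF shift_path_measurable f, symmetric]
    by (simp only: path_law_stationary)
qed

text \<open>The step \<open>s\<close> is a block of length \<open>r\<close>, forwards or backwards in time. One exceptional null set serves all starting times.\<close>

lemma orbit_sums_decrease:
  fixes f :: "(int \<Rightarrow> real) \<Rightarrow> real"
  assumes f: "f \<in> borel_measurable path_space" and int: "integrable M (\<lambda>\<omega>. f (path \<omega>))"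
    and neg: "(\<integral>\<omega>. f (path \<omega>) \<partial>M) < 0" and s: "s = int r \<or> s = - int r"
  shows "\<exists>c>0. AE \<omega> in M. \<forall>t. \<exists>C. \<forall>q. (\<Sum>i<q. f (time_shift (t + s * int i) (path \<omega>))) \<le> C - c * real q"
proof -
  let ?Q = "distr M path_space path"
  have sh: "time_shift k \<in> ?Q \<rightarrow>\<^sub>M ?Q" for k by simp
  have inv: "distr ?Q ?Q (time_shift k) = ?Q" for k
  proof -
    have "distr ?Q ?Q (time_shift k) = distr ?Q path_space (time_shift k)" by (rule distr_cong) auto
    also have "\<dots> = distr M path_space (\<lambda>\<omega>. time_shift k (path \<omega>))"
      by (subst distr_distr[OF measurable_shift path_measurable]) (simp add: comp_def)
    finally show ?thesis by (simp only: path_law_stationary)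
  qed
  have "\<exists>c>0. AE v in ?Q. \<exists>C. \<forall>n. (\<Sum>i<n. f ((time_shift s ^^ i) v)) \<le> C - c * real n"
  proof (rule ergodic_sums_linear_decrease[OF prob_space_distr[OF path_measurable] sh inv])
    fix B assume B: "B \<in> sets ?Q" "time_shift s -` B \<inter> space ?Q = B"
    have sB: "v \<in> B \<longleftrightarrow> time_shift s v \<in> B" for v using B(2) by (auto simp: space_PiM)
    have "time_shift (int r) -` B = B"
      using s
    proof
      assume "s = - int r"
      then have "time_shift s (time_shift (int r) v) = v" for v :: "int \<Rightarrow> real" by (simp add: shift_shift shift_0)
      then show ?thesis using sB by (metis subset_antisym subsetI vimage_eq)
    qed (use sB in auto)
    then show "measure ?Q B = 0 \<or> measure ?Q B = 1"
      using ergodic r B(1) unfolding totally_ergodic_process_def path_def[abs_def] by auto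
  next
    show "integrable ?Q f" using int by (subst integrable_distr_eq[OF path_measurable f])
    show "(\<integral>v. f v \<partial>?Q) < 0" using neg by (subst integral_distr[OF path_measurable f])
  qed
  then obtain c where c: "c > 0" and ae: "AE v in ?Q. \<exists>C. \<forall>n. (\<Sum>i<n. f (time_shift (s * int i) v)) \<le> C - c * real n"
    unfolding funpow_shift by blast
  have "AE v in ?Q. \<forall>t. \<exists>C. \<forall>n. (\<Sum>i<n. f (time_shift (s * int i) (time_shift t v))) \<le> C - c * real n"
    unfolding AE_all_countable
  proof
    fix t
    have "AE v in distr ?Q ?Q (time_shift t). \<exists>C. \<forall>n. (\<Sum>i<n. f (time_shift (s * int i) v)) \<le> C - c * real n"
      unfolding inv by (rule ae)
    from AE_distrD[OF sh this]
    show "AE v in ?Q. \<exists>C. \<forall>n. (\<Sum>i<n. f (time_shift (s * int i) (time_shift t v))) \<le> C - c * real n" .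
  qed
  from AE_distrD[OF path_measurable this] c show ?thesis
    unfolding shift_shift add.commute[of _ "s * int _"] by blast
qed

definition regular :: "'a \<Rightarrow> bool" where
  "regular \<omega> \<longleftrightarrow>
     (\<forall>t. \<forall>x\<in>K. \<forall>\<theta>\<in>\<Theta>. \<phi> t \<omega> x \<theta> \<in> K) \<and>
     (\<forall>t. \<forall>f\<in>cont_fun_space \<Theta> K. (\<lambda>\<theta>. \<phi> t \<omega> (f \<theta>) \<theta>) \<in> cont_fun_space \<Theta> K) \<and>
     (\<forall>m\<in>{1, r}. \<forall>t. lipschitz_coeff K \<Theta> (iterate_map \<phi> m t \<omega>) (\<Lambda> m t \<omega>))"

lemma AE_regular: "AE \<omega> in M. regular \<omega>"
proof -
  have "AE \<omega> in M. \<forall>m\<in>{1, r}. \<forall>t. lipschitz_coeff K \<Theta> (iterate_map \<phi> m t \<omega>) (\<Lambda> m t \<omega>)"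
    using \<Lambda> by (subst AE_ball_countable) auto
  with \<phi>_K \<phi>_C show ?thesis unfolding regular_def by eventually_elim blast
qed

lemma regular_iter_K: "regular \<omega> \<Longrightarrow> x \<in> K \<Longrightarrow> \<theta> \<in> \<Theta> \<Longrightarrow> iter m t (path \<omega>) x \<theta> \<in> K"
  unfolding iterate_map_\<phi>[symmetric] by (induction m arbitrary: t) (auto simp: regular_def)

lemma regular_iter_C:
  assumes "regular \<omega>" "f \<in> cont_fun_space \<Theta> K"
  shows "(\<lambda>\<theta>. iter m t (path \<omega>) (f \<theta>) \<theta>) \<in> cont_fun_space \<Theta> K"
  unfolding iterate_map_\<phi>[symmetric]
proof (induction m arbitrary: t)
  case (Suc m)
  then show ?case using assms(1) unfolding regular_def by simp
qed (use assms in simp)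

lemma const_in_cont_fun_space: "x \<in> K \<Longrightarrow> (\<lambda>_. x) \<in> cont_fun_space \<Theta> K"
  by (auto simp: cont_fun_space_def)

lemma regular_iter_continuous:
  "regular \<omega> \<Longrightarrow> x \<in> K \<Longrightarrow> continuous_on \<Theta> (\<lambda>\<theta>. iter m t (path \<omega>) x \<theta>)"
  using regular_iter_C[OF _ const_in_cont_fun_space, of \<omega> x m t] by (simp add: cont_fun_space_def)

text \<open>Unlike \<open>\<Lambda>\<close>, this smallest constant is a fixed measurable function of the driving path, so it is stationary along the
shift.\<close>

definition lip :: "nat \<Rightarrow> 'p set \<Rightarrow> (int \<Rightarrow> real) \<Rightarrow> real" where
  "lip m B v = lip_const (dense_part K) (dense_part \<Theta> \<inter> B) (iter m 0 v)"

lemma lip_nonneg: "0 \<le> lip m B v"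
  unfolding lip_def by (rule lip_const_nonneg)

lemma lip_measurable [measurable]: "lip m B \<in> borel_measurable path_space"
  unfolding lip_def[abs_def]
  by (intro measurable_lip_const countable_Int1 dense_part iter_measurable) (use dense_part(2) in auto)

lemma iter_at: "iter m 0 (time_shift t v) x \<theta> = iter m t v x \<theta>"
  using iter_shift[of m 0 t v x \<theta>] by simp

lemma regular_lipschitz:
  assumes "regular \<omega>" "m \<in> {1, r}"
  shows "\<exists>c\<ge>0. \<forall>x\<in>K. \<forall>x'\<in>K. \<forall>\<theta>\<in>\<Theta>. \<bar>iter m t (path \<omega>) x \<theta> - iter m t (path \<omega>) x' \<theta>\<bar> \<le> c * \<bar>x - x'\<bar>"
proof -
  have L: "continuous_on \<Theta> (\<Lambda> m t \<omega>)"
    "\<And>x x' \<theta>. x \<in> K \<Longrightarrow> x' \<in> K \<Longrightarrow> \<theta> \<in> \<Theta> \<Longrightarrow> \<bar>iter m t (path \<omega>) x \<theta> - iter m t (path \<omega>) x' \<theta>\<bar> \<le> \<Lambda> m t \<omega> \<theta> * \<bar>x - x'\<bar>"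
    using assms unfolding regular_def lipschitz_coeff_def iterate_map_\<phi> by blast+
  obtain c where c: "c \<ge> 0" "\<forall>\<theta>\<in>\<Theta>. \<bar>\<Lambda> m t \<omega> \<theta>\<bar> \<le> c"
    using continuous_abs_bounded[OF compact_\<Theta> L(1)] by blast
  have "\<bar>iter m t (path \<omega>) x \<theta> - iter m t (path \<omega>) x' \<theta>\<bar> \<le> c * \<bar>x - x'\<bar>"
    if "x \<in> K" "x' \<in> K" "\<theta> \<in> \<Theta>" for x x' \<theta>
  proof (rule order_trans[OF L(2)[OF that]])
    have "\<Lambda> m t \<omega> \<theta> \<le> c" using c(2) that(3) abs_le_D1 by blast
    then show "\<Lambda> m t \<omega> \<theta> * \<bar>x - x'\<bar> \<le> c * \<bar>x - x'\<bar>" by (intro mult_right_mono) auto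
  qed
  then show ?thesis using c(1) by blast
qed

lemma lip_bound:
  assumes \<omega>: "regular \<omega>" and m: "m \<in> {1, r}" and B: "open B" and \<theta>: "\<theta> \<in> \<Theta> \<inter> B" and x: "x \<in> K" "x' \<in> K"
  shows "\<bar>iter m t (path \<omega>) x \<theta> - iter m t (path \<omega>) x' \<theta>\<bar> \<le> lip m B (time_shift t (path \<omega>)) * \<bar>x - x'\<bar>"
proof -
  obtain c where c: "c \<ge> 0" "\<And>x x' \<theta>. x \<in> K \<Longrightarrow> x' \<in> K \<Longrightarrow> \<theta> \<in> \<Theta> \<Longrightarrow>
      \<bar>iter m t (path \<omega>) x \<theta> - iter m t (path \<omega>) x' \<theta>\<bar> \<le> c * \<bar>x - x'\<bar>"
    using regular_lipschitz[OF \<omega> m] by meson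
  have eq: "iter m 0 (time_shift t (path \<omega>)) = iter m t (path \<omega>)" by (intro ext iter_at)
  show ?thesis unfolding lip_def eq
    by (rule lip_const_dense[OF c(2) c(1) regular_iter_continuous[OF \<omega>] B \<theta> x])
qed

lemma lip_le:
  assumes "0 \<le> c"
    and "\<And>x x' \<theta>. x \<in> K \<Longrightarrow> x' \<in> K \<Longrightarrow> \<theta> \<in> \<Theta> \<inter> B \<Longrightarrow> \<bar>iter m t v x \<theta> - iter m t v x' \<theta>\<bar> \<le> c * \<bar>x - x'\<bar>"
  shows "lip m B (time_shift t v) \<le> c"
proof -
  have eq: "iter m 0 (time_shift t v) = iter m t v" by (intro ext iter_at)
  show ?thesis unfolding lip_def eq
    by (rule lip_const_le[OF assms(1)], rule assms(2)) (use dense_part(2)[of K] dense_part(2)[of \<Theta>] in auto)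
qed

lemma lip_antimono:
  assumes \<omega>: "regular \<omega>" and B: "open B'" and sub: "B \<subseteq> B'"
  shows "lip r B (time_shift t (path \<omega>)) \<le> lip r B' (time_shift t (path \<omega>))"
  by (rule lip_le[OF lip_nonneg], rule lip_bound[OF \<omega> _ B]) (use sub in auto)

lemma lip_iterate_le_prod:
  assumes \<omega>: "regular \<omega>"
  shows "x \<in> K \<Longrightarrow> x' \<in> K \<Longrightarrow> \<theta> \<in> \<Theta> \<Longrightarrow>
    \<bar>iter m t (path \<omega>) x \<theta> - iter m t (path \<omega>) x' \<theta>\<bar> \<le> (\<Prod>i<m. lip 1 UNIV (time_shift (t - int i) (path \<omega>))) * \<bar>x - x'\<bar>"
proof (induction m arbitrary: t)
  case (Suc m)
  let ?it = "\<lambda>x. iter m (t - 1) (path \<omega>) x \<theta>"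
  have "\<bar>iter (Suc m) t (path \<omega>) x \<theta> - iter (Suc m) t (path \<omega>) x' \<theta>\<bar>
      = \<bar>iter 1 t (path \<omega>) (?it x) \<theta> - iter 1 t (path \<omega>) (?it x') \<theta>\<bar>" by simp
  also have "\<dots> \<le> lip 1 UNIV (time_shift t (path \<omega>)) * \<bar>?it x - ?it x'\<bar>"
    by (rule lip_bound[OF \<omega>]) (use Suc.prems regular_iter_K[OF \<omega>] in auto)
  also have "\<dots> \<le> lip 1 UNIV (time_shift t (path \<omega>)) * ((\<Prod>i<m. lip 1 UNIV (time_shift (t - 1 - int i) (path \<omega>))) * \<bar>x - x'\<bar>)"
    by (intro mult_left_mono Suc lip_nonneg)
  also have "\<dots> = (\<Prod>i<Suc m. lip 1 UNIV (time_shift (t - int i) (path \<omega>))) * \<bar>x - x'\<bar>"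
    by (simp add: prod.lessThan_Suc_shift algebra_simps del: prod.lessThan_Suc)
  finally show ?case .
qed simp

lemma integrable_log_lip_1: "integrable M (\<lambda>\<omega>. log_plus (lip 1 UNIV (path \<omega>)))"
proof (rule Bochner_Integration.integrable_bound[OF \<Lambda>_log])
  show "(\<lambda>\<omega>. log_plus (lip 1 UNIV (path \<omega>))) \<in> borel_measurable M"
    by (intro measurable_compose[OF measurable_compose[OF path_measurable lip_measurable] measurable_log_plus])
  show "AE \<omega> in M. norm (log_plus (lip 1 UNIV (path \<omega>))) \<le> norm (log_plus (unif_norm \<Theta> (\<Lambda> 1 0 \<omega>)))"
    using AE_regular
  proof eventually_elim
    case (elim \<omega>)
    have L: "continuous_on \<Theta> (\<Lambda> 1 0 \<omega>)"
      "\<And>x x' \<theta>. x \<in> K \<Longrightarrow> x' \<in> K \<Longrightarrow> \<theta> \<in> \<Theta> \<Longrightarrow> \<bar>iter 1 0 (path \<omega>) x \<theta> - iter 1 0 (path \<omega>) x' \<theta>\<bar> \<le> \<Lambda> 1 0 \<omega> \<theta> * \<bar>x - x'\<bar>"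
      using elim unfolding regular_def lipschitz_coeff_def iterate_map_\<phi> by blast+
    have U: "\<bar>\<Lambda> 1 0 \<omega> \<theta>\<bar> \<le> unif_norm \<Theta> (\<Lambda> 1 0 \<omega>)" if "\<theta> \<in> \<Theta>" for \<theta>
      by (rule unif_norm_upper[OF compact_\<Theta> L(1) that])
    have "lip 1 UNIV (time_shift 0 (path \<omega>)) \<le> unif_norm \<Theta> (\<Lambda> 1 0 \<omega>)"
    proof (rule lip_le)
      obtain \<theta> where "\<theta> \<in> \<Theta>" using \<Theta>_ne by blast
      from U[OF this] show "0 \<le> unif_norm \<Theta> (\<Lambda> 1 0 \<omega>)" by linarith
      fix x x' \<theta> assume a: "x \<in> K" "x' \<in> K" "\<theta> \<in> \<Theta> \<inter> UNIV"
      have "\<Lambda> 1 0 \<omega> \<theta> \<le> unif_norm \<Theta> (\<Lambda> 1 0 \<omega>)" using U[of \<theta>] a by auto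
      then have "\<Lambda> 1 0 \<omega> \<theta> * \<bar>x - x'\<bar> \<le> unif_norm \<Theta> (\<Lambda> 1 0 \<omega>) * \<bar>x - x'\<bar>" by (intro mult_right_mono) auto
      then show "\<bar>iter 1 0 (path \<omega>) x \<theta> - iter 1 0 (path \<omega>) x' \<theta>\<bar> \<le> unif_norm \<Theta> (\<Lambda> 1 0 \<omega>) * \<bar>x - x'\<bar>"
        using L(2)[of x x' \<theta>] a by (meson IntD1 order_trans)
    qed
    then show ?case by (simp add: shift_0 log_plus_nonneg log_plus_mono)
  qed
qed

text \<open>The integrability is inherited from one step, because the constant of \<open>r\<close> steps is at most the product of the
constants of the single steps.\<close>

lemma integrable_log_lip_r: "integrable M (\<lambda>\<omega>. log_plus (lip r UNIV (path \<omega>)))"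
proof (rule Bochner_Integration.integrable_bound)
  show "integrable M (\<lambda>\<omega>. \<Sum>i<r. log_plus (lip 1 UNIV (time_shift (- int i) (path \<omega>))))"
    by (intro Bochner_Integration.integrable_sum stationary_integral(1)[OF _ integrable_log_lip_1]
        measurable_compose[OF lip_measurable measurable_log_plus])
  show "(\<lambda>\<omega>. log_plus (lip r UNIV (path \<omega>))) \<in> borel_measurable M"
    by (intro measurable_compose[OF measurable_compose[OF path_measurable lip_measurable] measurable_log_plus])
  show "AE \<omega> in M. norm (log_plus (lip r UNIV (path \<omega>))) \<le> norm (\<Sum>i<r. log_plus (lip 1 UNIV (time_shift (- int i) (path \<omega>))))"
    using AE_regular
  proof eventually_elim
    case (elim \<omega>)
    have "lip r UNIV (time_shift 0 (path \<omega>)) \<le> (\<Prod>i<r. lip 1 UNIV (time_shift (0 - int i) (path \<omega>)))"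
      by (rule lip_le, intro prod_nonneg lip_nonneg ballI, rule lip_iterate_le_prod[OF elim]) auto
    then have "log_plus (lip r UNIV (path \<omega>)) \<le> log_plus (\<Prod>i<r. lip 1 UNIV (time_shift (- int i) (path \<omega>)))"
      by (intro log_plus_mono) (simp add: shift_0)
    also have "\<dots> \<le> (\<Sum>i<r. log_plus (lip 1 UNIV (time_shift (- int i) (path \<omega>))))"
      by (intro log_plus_prod_le lip_nonneg)
    finally show ?case using log_plus_nonneg[of "lip r UNIV (path \<omega>)"] by simp
  qed
qed

text \<open>How far \<open>m\<close> steps of the recursion move the reference point \<open>y\<close>, uniformly in the parameter.\<close>

definition disp :: "nat \<Rightarrow> (int \<Rightarrow> real) \<Rightarrow> real" where
  "disp m v = sup_abs (dense_part \<Theta>) (\<lambda>\<theta>. iter m 0 v y \<theta> - y)"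

lemma disp_nonneg: "0 \<le> disp m v"
  unfolding disp_def by (rule sup_abs_nonneg)

lemma disp_measurable [measurable]: "disp m \<in> borel_measurable path_space"
  unfolding disp_def[abs_def]
  by (intro measurable_sup_abs dense_part borel_measurable_diff iter_measurable borel_measurable_const)
     (use dense_part(2) in auto)

lemma disp_bound:
  assumes \<omega>: "regular \<omega>" and \<theta>: "\<theta> \<in> \<Theta>"
  shows "\<bar>iter m t (path \<omega>) y \<theta> - y\<bar> \<le> disp m (time_shift t (path \<omega>))"
proof -
  have cont: "continuous_on \<Theta> (\<lambda>\<theta>. iter m t (path \<omega>) y \<theta> - y)"
    by (intro continuous_intros regular_iter_continuous[OF \<omega> y])
  obtain c where c: "\<And>\<theta>. \<theta> \<in> \<Theta> \<Longrightarrow> \<bar>iter m t (path \<omega>) y \<theta> - y\<bar> \<le> c"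
    using continuous_abs_bounded[OF compact_\<Theta> cont] by blast
  show ?thesis unfolding disp_def iter_at
    by (rule sup_abs_dense[OF c cont \<theta>])
qed

lemma disp_le:
  assumes "0 \<le> c" "\<And>\<theta>. \<theta> \<in> \<Theta> \<Longrightarrow> \<bar>iter m t v y \<theta> - y\<bar> \<le> c"
  shows "disp m (time_shift t v) \<le> c"
  unfolding disp_def iter_at by (rule sup_abs_le[OF assms(1)], rule assms(2)) (use dense_part(2)[of \<Theta>] in auto)

lemma log_disp_measurable: "(\<lambda>v. log_plus (disp m v)) \<in> borel_measurable path_space"
  by (rule measurable_compose[OF disp_measurable measurable_log_plus])

lemma integrable_log_disp: "integrable M (\<lambda>\<omega>. log_plus (disp m (path \<omega>)))"
proof (induction m)
  case 0
  have "disp 0 v = 0" for v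
  proof (rule antisym[OF _ disp_nonneg])
    show "disp 0 v \<le> 0" using disp_le[of 0 0 0 v] by (simp add: shift_0)
  qed
  then show ?case by (simp add: log_plus_def)
next
  case (Suc m)
  have one: "integrable M (\<lambda>\<omega>. log_plus (disp 1 (path \<omega>)))"
  proof (rule Bochner_Integration.integrable_bound)
    show "integrable M (\<lambda>\<omega>. ln 2 + log_plus (unif_norm \<Theta> (\<phi> 0 \<omega> y)) + log_plus \<bar>y\<bar>)"
      using y_log by simp
    show "(\<lambda>\<omega>. log_plus (disp 1 (path \<omega>))) \<in> borel_measurable M"
      by (rule measurable_compose[OF path_measurable log_disp_measurable])
    show "AE \<omega> in M. norm (log_plus (disp 1 (path \<omega>))) \<le> norm (ln 2 + log_plus (unif_norm \<Theta> (\<phi> 0 \<omega> y)) + log_plus \<bar>y\<bar>)"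
      using AE_regular
    proof eventually_elim
      case (elim \<omega>)
      have \<phi>_iter: "\<phi> 0 \<omega> y \<theta> = iter 1 0 (path \<omega>) y \<theta>" for \<theta> using iterate_map_\<phi>[of 1 0 \<omega> y \<theta>] by simp
      have "continuous_on \<Theta> (\<phi> 0 \<omega> y)"
        using regular_iter_continuous[OF elim y, of 1 0] unfolding \<phi>_iter[symmetric] .
      then have U: "\<bar>\<phi> 0 \<omega> y \<theta>\<bar> \<le> unif_norm \<Theta> (\<phi> 0 \<omega> y)" if "\<theta> \<in> \<Theta>" for \<theta>
        by (rule unif_norm_upper[OF compact_\<Theta> _ that])
      have "disp 1 (time_shift 0 (path \<omega>)) \<le> unif_norm \<Theta> (\<phi> 0 \<omega> y) + \<bar>y\<bar>"
      proof (rule disp_le)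
        obtain \<theta> where "\<theta> \<in> \<Theta>" using \<Theta>_ne by blast
        from U[OF this] show "0 \<le> unif_norm \<Theta> (\<phi> 0 \<omega> y) + \<bar>y\<bar>" by linarith
        fix \<theta> assume "\<theta> \<in> \<Theta>"
        from U[OF this] show "\<bar>iter 1 0 (path \<omega>) y \<theta> - y\<bar> \<le> unif_norm \<Theta> (\<phi> 0 \<omega> y) + \<bar>y\<bar>"
          unfolding \<phi>_iter[symmetric] by linarith
      qed
      then have "log_plus (disp 1 (path \<omega>)) \<le> log_plus (unif_norm \<Theta> (\<phi> 0 \<omega> y) + \<bar>y\<bar>)"
        by (intro log_plus_mono) (simp add: shift_0)
      also have "\<dots> \<le> ln 2 + log_plus (unif_norm \<Theta> (\<phi> 0 \<omega> y)) + log_plus \<bar>y\<bar>" by (rule log_plus_add_le)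
      finally show ?case using log_plus_nonneg[of "disp 1 (path \<omega>)"] by simp
    qed
  qed
  show ?case
  proof (rule Bochner_Integration.integrable_bound)
    show "integrable M (\<lambda>\<omega>. ln 2 + (log_plus (lip 1 UNIV (path \<omega>)) + log_plus (disp m (time_shift (- 1) (path \<omega>)))) + log_plus (disp 1 (path \<omega>)))"
      using integrable_log_lip_1 one stationary_integral(1)[OF log_disp_measurable Suc, of "- 1"]
      by (intro Bochner_Integration.integrable_add integrable_const) auto
    show "(\<lambda>\<omega>. log_plus (disp (Suc m) (path \<omega>))) \<in> borel_measurable M"
      by (rule measurable_compose[OF path_measurable log_disp_measurable])
    show "AE \<omega> in M. norm (log_plus (disp (Suc m) (path \<omega>))) \<le>
        norm (ln 2 + (log_plus (lip 1 UNIV (path \<omega>)) + log_plus (disp m (time_shift (- 1) (path \<omega>)))) + log_plus (disp 1 (path \<omega>)))"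
      using AE_regular
    proof eventually_elim
      case (elim \<omega>)
      let ?l = "lip 1 UNIV (path \<omega>)" and ?d = "disp m (time_shift (- 1) (path \<omega>))" and ?e = "disp 1 (path \<omega>)"
      have "disp (Suc m) (time_shift 0 (path \<omega>)) \<le> ?l * ?d + ?e"
      proof (rule disp_le)
        show "0 \<le> ?l * ?d + ?e" by (intro add_nonneg_nonneg mult_nonneg_nonneg lip_nonneg disp_nonneg)
        fix \<theta> assume \<theta>: "\<theta> \<in> \<Theta>"
        let ?z = "iter m (- 1) (path \<omega>) y \<theta>"
        have "\<bar>iter 1 0 (path \<omega>) ?z \<theta> - iter 1 0 (path \<omega>) y \<theta>\<bar> \<le> ?l * \<bar>?z - y\<bar>"
          using lip_bound[OF elim, of 1 UNIV \<theta> ?z y 0] regular_iter_K[OF elim y \<theta>] y \<theta> by (simp add: shift_0)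
        also have "\<dots> \<le> ?l * ?d" by (intro mult_left_mono disp_bound[OF elim \<theta>] lip_nonneg)
        finally have "\<bar>iter 1 0 (path \<omega>) ?z \<theta> - iter 1 0 (path \<omega>) y \<theta>\<bar> \<le> ?l * ?d" .
        moreover have "\<bar>iter 1 0 (path \<omega>) y \<theta> - y\<bar> \<le> ?e" using disp_bound[OF elim \<theta>, of 1 0] by (simp add: shift_0)
        moreover have "iter (Suc m) 0 (path \<omega>) y \<theta> = iter 1 0 (path \<omega>) ?z \<theta>" by simp
        ultimately show "\<bar>iter (Suc m) 0 (path \<omega>) y \<theta> - y\<bar> \<le> ?l * ?d + ?e" by linarith
      qed
      then have "log_plus (disp (Suc m) (path \<omega>)) \<le> log_plus (?l * ?d + ?e)"
        by (intro log_plus_mono) (simp add: shift_0)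
      also have "\<dots> \<le> ln 2 + log_plus (?l * ?d) + log_plus ?e" by (rule log_plus_add_le)
      also have "\<dots> \<le> ln 2 + (log_plus ?l + log_plus ?d) + log_plus ?e"
        using log_plus_mult_le[OF lip_nonneg disp_nonneg, of 1 UNIV "path \<omega>" m "time_shift (- 1) (path \<omega>)"] by simp
      finally show ?case using log_plus_nonneg[of "disp (Suc m) (path \<omega>)"] by simp
    qed
  qed
qed

text \<open>Truncation from below makes the logarithm integrable. The level is tied to \<open>k\<close>, which also indexes the radius of the
ball below, so that one sequence serves both limits.\<close>

definition log_rate :: "'p set \<Rightarrow> nat \<Rightarrow> (int \<Rightarrow> real) \<Rightarrow> real" where
  "log_rate B k v = ln (max (lip r B v) (exp (- real k)))"

lemma log_rate_measurable [measurable]: "log_rate B k \<in> borel_measurable path_space"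
  unfolding log_rate_def[abs_def] by measurable

lemma lip_le_exp_log_rate: "lip r B v \<le> exp (log_rate B k v)"
  unfolding log_rate_def by (subst exp_ln) (auto simp: less_max_iff_disj)

lemma log_rate_lower: "- real k \<le> log_rate B k v"
proof -
  have "ln (exp (- real k)) \<le> ln (max (lip r B v) (exp (- real k)))"
    by (subst ln_le_cancel_iff) (auto simp: less_max_iff_disj)
  then show ?thesis by (simp add: log_rate_def)
qed

lemma log_rate_upper:
  assumes "0 < c" "lip r B v \<le> c" "exp (- real k) \<le> c" shows "log_rate B k v \<le> ln c"
  unfolding log_rate_def using assms by (subst ln_le_cancel_iff) (auto simp: less_max_iff_disj)

lemma log_rate_le_log_plus:
  assumes "regular \<omega>" shows "log_rate B k (path \<omega>) \<le> log_plus (lip r UNIV (path \<omega>))"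
proof -
  have "lip r B (path \<omega>) \<le> lip r UNIV (path \<omega>)"
    using lip_antimono[OF assms, of UNIV B 0] by (simp add: shift_0)
  moreover have "exp (- real k) \<le> 1" by simp
  ultimately show ?thesis unfolding log_plus_def by (intro log_rate_upper) (auto simp only: le_max_iff_disj less_max_iff_disj zero_less_one)
qed

lemma integrable_log_rate: "integrable M (\<lambda>\<omega>. log_rate B k (path \<omega>))"
proof (rule Bochner_Integration.integrable_bound)
  show "integrable M (\<lambda>\<omega>. log_plus (lip r UNIV (path \<omega>)) + real k)"
    using integrable_log_lip_r by simp
  show "(\<lambda>\<omega>. log_rate B k (path \<omega>)) \<in> borel_measurable M"
    by (rule measurable_compose[OF path_measurable log_rate_measurable])
  show "AE \<omega> in M. norm (log_rate B k (path \<omega>)) \<le> norm (log_plus (lip r UNIV (path \<omega>)) + real k)"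
    using AE_regular
  proof eventually_elim
    case (elim \<omega>)
    then show ?case
      using log_rate_le_log_plus[OF elim, of B k] log_rate_lower[of k B "path \<omega>"] log_plus_nonneg[of "lip r UNIV (path \<omega>)"]
      by (auto simp: abs_le_iff)
  qed
qed

text \<open>Continuity of \<open>\<Lambda> r 0\<close> in the parameter controls all parameters near \<open>\<theta>\<close> by the coefficient at \<open>\<theta>\<close>.\<close>

lemma small_ball_lip_le:
  assumes \<omega>: "regular \<omega>" and \<theta>: "\<theta> \<in> \<Theta>" and c: "0 < c" "\<Lambda> r 0 \<omega> \<theta> < c"
  shows "\<forall>\<^sub>F k in sequentially. lip r (ball \<theta> (1 / real (Suc k))) (path \<omega>) \<le> c"
proof -
  have L: "continuous_on \<Theta> (\<Lambda> r 0 \<omega>)"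
    "\<And>x x' \<theta>. x \<in> K \<Longrightarrow> x' \<in> K \<Longrightarrow> \<theta> \<in> \<Theta> \<Longrightarrow> \<bar>iter r 0 (path \<omega>) x \<theta> - iter r 0 (path \<omega>) x' \<theta>\<bar> \<le> \<Lambda> r 0 \<omega> \<theta> * \<bar>x - x'\<bar>"
    using \<omega> unfolding regular_def lipschitz_coeff_def iterate_map_\<phi> by blast+
  obtain e where e: "e > 0" "\<And>\<eta>. \<eta> \<in> \<Theta> \<Longrightarrow> dist \<eta> \<theta> < e \<Longrightarrow> dist (\<Lambda> r 0 \<omega> \<eta>) (\<Lambda> r 0 \<omega> \<theta>) < c - \<Lambda> r 0 \<omega> \<theta>"
    using L(1)[unfolded continuous_on_iff, rule_format, OF \<theta>, of "c - \<Lambda> r 0 \<omega> \<theta>"] c(2) by auto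
  have "(\<lambda>k. 1 / real (Suc k)) \<longlonglongrightarrow> 0" by (rule LIMSEQ_inverse_real_of_nat[unfolded inverse_eq_divide])
  then have "\<forall>\<^sub>F k in sequentially. 1 / real (Suc k) < e" using e(1) by (rule order_tendstoD(2))
  then show ?thesis
  proof eventually_elim
    case (elim k)
    have "lip r (ball \<theta> (1 / real (Suc k))) (time_shift 0 (path \<omega>)) \<le> c"
    proof (rule lip_le)
      fix x x' \<eta> assume a: "x \<in> K" "x' \<in> K" "\<eta> \<in> \<Theta> \<inter> ball \<theta> (1 / real (Suc k))"
      have "dist \<eta> \<theta> < 1 / real (Suc k)" using a(3) by (simp add: dist_commute)
      then have "dist \<eta> \<theta> < e" using elim by (rule less_trans)
      then have "\<Lambda> r 0 \<omega> \<eta> \<le> c" using e(2)[of \<eta>] a(3) by (auto simp: dist_real_def)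
      then have "\<Lambda> r 0 \<omega> \<eta> * \<bar>x - x'\<bar> \<le> c * \<bar>x - x'\<bar>" by (intro mult_right_mono) auto
      then show "\<bar>iter r 0 (path \<omega>) x \<eta> - iter r 0 (path \<omega>) x' \<eta>\<bar> \<le> c * \<bar>x - x'\<bar>"
        using L(2)[of x x' \<eta>] a by (meson IntD1 order_trans)
    qed (use c in simp)
    then show ?case by (simp add: shift_0)
  qed
qed

text \<open>As the balls shrink and the truncation level falls, the upper limit of \<open>log_rate\<close> is at most \<open>log (\<Lambda> r 0 \<theta>)\<close>, and
all terms lie below one integrable function \<open>b\<close>. If all integrals were nonnegative, Fatou's lemma for \<open>b\<close> minus
\<open>log_rate\<close> would give a nonnegative expectation of \<open>log (\<Lambda> r 0 \<theta>)\<close>. To avoid differences of infinite quantities the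
comparison is made between sums of positive and negative parts.\<close>

lemma local_contraction:
  assumes \<theta>: "\<theta> \<in> \<Theta>"
  shows "\<exists>k. (\<integral>\<omega>. log_rate (ball \<theta> (1 / real (Suc k))) k (path \<omega>) \<partial>M) < 0"
proof (rule ccontr)
  assume "\<not> ?thesis"
  then have nonneg: "0 \<le> (\<integral>\<omega>. log_rate (ball \<theta> (1 / real (Suc k))) k (path \<omega>) \<partial>M)" for k
    by (meson not_less)
  let ?a = "\<lambda>k \<omega>. log_rate (ball \<theta> (1 / real (Suc k))) k (path \<omega>)"
  let ?b = "\<lambda>\<omega>. log_plus (lip r UNIV (path \<omega>))"
  let ?P = "\<lambda>\<omega>. e2ennreal (ext_log (\<Lambda> r 0 \<omega> \<theta>))" and ?N = "\<lambda>\<omega>. e2ennreal (- ext_log (\<Lambda> r 0 \<omega> \<theta>))"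
  let ?g = "\<lambda>\<omega>. liminf (\<lambda>k. ennreal (?b \<omega> - ?a k \<omega>))"
  have am[measurable]: "?a k \<in> borel_measurable M" for k
    by (rule measurable_compose[OF path_measurable log_rate_measurable])
  have bm[measurable]: "?b \<in> borel_measurable M" using integrable_log_lip_r by (rule borel_measurable_integrable)
  have "(\<integral>\<^sup>+ \<omega>. ?g \<omega> \<partial>M) \<le> liminf (\<lambda>k. \<integral>\<^sup>+ \<omega>. ennreal (?b \<omega> - ?a k \<omega>) \<partial>M)"
    by (rule nn_integral_liminf) measurable
  also have "\<dots> \<le> liminf (\<lambda>k::nat. ennreal (\<integral>\<omega>. ?b \<omega> \<partial>M))"
  proof (intro Liminf_mono always_eventually allI)
    fix k
    have "AE \<omega> in M. 0 \<le> ?b \<omega> - ?a k \<omega>"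
      using AE_regular by eventually_elim (simp add: log_rate_le_log_plus)
    then have "(\<integral>\<^sup>+ \<omega>. ennreal (?b \<omega> - ?a k \<omega>) \<partial>M) = ennreal (\<integral>\<omega>. ?b \<omega> - ?a k \<omega> \<partial>M)"
      using integrable_log_lip_r integrable_log_rate by (intro nn_integral_eq_integral) auto
    also have "(\<integral>\<omega>. ?b \<omega> - ?a k \<omega> \<partial>M) = (\<integral>\<omega>. ?b \<omega> \<partial>M) - (\<integral>\<omega>. ?a k \<omega> \<partial>M)"
      by (rule Bochner_Integration.integral_diff[OF integrable_log_lip_r integrable_log_rate])
    finally show "(\<integral>\<^sup>+ \<omega>. ennreal (?b \<omega> - ?a k \<omega>) \<partial>M) \<le> ennreal (\<integral>\<omega>. ?b \<omega> \<partial>M)"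
      using nonneg[of k] by (simp add: ennreal_leI)
  qed
  also have "\<dots> = ennreal (\<integral>\<omega>. ?b \<omega> \<partial>M)" by (simp add: Liminf_const)
  also have "\<dots> = (\<integral>\<^sup>+ \<omega>. ennreal (?b \<omega>) \<partial>M)"
    by (rule nn_integral_eq_integral[symmetric, OF integrable_log_lip_r]) (simp add: log_plus_nonneg)
  finally have g_le: "(\<integral>\<^sup>+ \<omega>. ?g \<omega> \<partial>M) \<le> (\<integral>\<^sup>+ \<omega>. ennreal (?b \<omega>) \<partial>M)" .
  have b_fin: "(\<integral>\<^sup>+ \<omega>. ennreal (?b \<omega>) \<partial>M) \<noteq> top"
    by (subst nn_integral_eq_integral[OF integrable_log_lip_r]) (simp_all add: log_plus_nonneg)
  have key: "AE \<omega> in M. ?N \<omega> + ennreal (?b \<omega>) \<le> ?P \<omega> + ?g \<omega>"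
    using AE_regular
  proof eventually_elim
    case (elim \<omega>)
    let ?L = "\<Lambda> r 0 \<omega> \<theta>"
    have lower: "ennreal (?b \<omega> - ln c) \<le> ?g \<omega>" if c: "0 < c" "?L < c" for c
    proof (rule Liminf_bounded)
      have "(\<lambda>k. exp (- 1 :: real) ^ k) \<longlonglongrightarrow> 0" by (rule LIMSEQ_power_zero) simp
      then have "(\<lambda>k. exp (- real k)) \<longlonglongrightarrow> 0" by (simp add: exp_of_nat_mult[symmetric])
      then have "\<forall>\<^sub>F k in sequentially. exp (- real k) < c" using c(1) by (rule order_tendstoD(2))
      with small_ball_lip_le[OF elim \<theta> c]
      show "\<forall>\<^sub>F k in sequentially. ennreal (?b \<omega> - ln c) \<le> ennreal (?b \<omega> - ?a k \<omega>)"
      proof eventually_elim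
        case (elim k)
        then have "?a k \<omega> \<le> ln c" using c(1) by (intro log_rate_upper) auto
        then show ?case by (intro ennreal_leI) simp
      qed
    qed
    show ?case
    proof (cases "0 < ?L")
      case False
      have "?g \<omega> = top"
      proof (rule ccontr)
        assume "?g \<omega> \<noteq> top"
        then obtain m where m: "?g \<omega> = ennreal m" "0 \<le> m" by (cases "?g \<omega>") auto
        have "ennreal (?b \<omega> - ln (exp (?b \<omega> - m - 1))) \<le> ennreal m"
          unfolding m(1)[symmetric]
        proof (rule lower)
          show "?L < exp (?b \<omega> - m - 1)" using False exp_gt_zero by (meson le_less_trans not_less)
        qed simp
        then show False using m(2) by (simp add: ennreal_le_iff)
      qed
      then show ?thesis by simp
    next
      case True
      have "(\<lambda>n. ennreal (?b \<omega> - ln (?L + 1 / real (Suc n)))) \<longlonglongrightarrow> ennreal (?b \<omega> - ln (?L + 0))"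
        by (intro tendsto_intros LIMSEQ_inverse_real_of_nat[unfolded inverse_eq_divide]) (use True in auto)
      then have "ennreal (?b \<omega> - ln (?L + 0)) \<le> ?g \<omega>"
        by (rule LIMSEQ_le_const2) (use lower True in \<open>auto intro!: exI[of _ 0] simp: add_pos_pos\<close>)
      then have low: "ennreal (?b \<omega> - ln ?L) \<le> ?g \<omega>" by simp
      have PN: "?P \<omega> = ennreal (ln ?L)" "?N \<omega> = ennreal (- ln ?L)"
        using True by (simp_all add: ext_log_def)
      show ?thesis
      proof (cases "0 \<le> ln ?L")
        case True
        have "?N \<omega> + ennreal (?b \<omega>) = ennreal (?b \<omega>)" using True by (simp add: PN ennreal_neg)
        also have "\<dots> \<le> ennreal (ln ?L) + ennreal (?b \<omega> - ln ?L)"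
        proof (cases "ln ?L \<le> ?b \<omega>")
          case True
          then show ?thesis using \<open>0 \<le> ln ?L\<close> by (subst ennreal_plus[symmetric]) auto
        next
          case False
          then have "ennreal (?b \<omega>) \<le> ennreal (ln ?L)" by (intro ennreal_leI) simp
          then show ?thesis by (simp add: add_increasing2)
        qed
        also have "\<dots> \<le> ?P \<omega> + ?g \<omega>" unfolding PN by (intro add_left_mono low)
        finally show ?thesis .
      next
        case False
        have "?N \<omega> + ennreal (?b \<omega>) = ennreal (?b \<omega> - ln ?L)"
          unfolding PN using False log_plus_nonneg[of "lip r UNIV (path \<omega>)"] by (subst ennreal_plus[symmetric]) auto
        also have "\<dots> \<le> ?P \<omega> + ?g \<omega>" using low by (rule add_increasing[rotated]) simp
        finally show ?thesis .
      qed
    qed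
  qed
  have Lm[measurable]: "(\<lambda>\<omega>. \<Lambda> r 0 \<omega> \<theta>) \<in> borel_measurable M" by (rule \<Lambda>_measurable[OF \<theta>])
  have extm[measurable]: "(\<lambda>\<omega>. ext_log (\<Lambda> r 0 \<omega> \<theta>)) \<in> borel_measurable M"
    unfolding ext_log_def by measurable
  have "(\<integral>\<^sup>+ \<omega>. ?N \<omega> \<partial>M) + (\<integral>\<^sup>+ \<omega>. ennreal (?b \<omega>) \<partial>M) = (\<integral>\<^sup>+ \<omega>. ?N \<omega> + ennreal (?b \<omega>) \<partial>M)"
    by (rule nn_integral_add[symmetric]) measurable
  also have "\<dots> \<le> (\<integral>\<^sup>+ \<omega>. ?P \<omega> + ?g \<omega> \<partial>M)" by (rule nn_integral_mono_AE[OF key])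
  also have "\<dots> = (\<integral>\<^sup>+ \<omega>. ?P \<omega> \<partial>M) + (\<integral>\<^sup>+ \<omega>. ?g \<omega> \<partial>M)"
    by (rule nn_integral_add) measurable
  also have "\<dots> \<le> (\<integral>\<^sup>+ \<omega>. ?P \<omega> \<partial>M) + (\<integral>\<^sup>+ \<omega>. ennreal (?b \<omega>) \<partial>M)"
    by (intro add_left_mono g_le)
  finally have "(\<integral>\<^sup>+ \<omega>. ?N \<omega> \<partial>M) \<le> (\<integral>\<^sup>+ \<omega>. ?P \<omega> \<partial>M)"
    using b_fin by (simp add: add.commute[of _ "\<integral>\<^sup>+ \<omega>. ennreal (?b \<omega>) \<partial>M"] ennreal_add_left_cancel_le)
  then have "0 \<le> ext_expectation M (\<lambda>\<omega>. ext_log (\<Lambda> r 0 \<omega> \<theta>))"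
    unfolding ext_expectation_def by (intro ereal_diff_positive) (simp add: less_eq_ennreal.rep_eq)
  then show False using contraction[OF \<theta>] by simp
qed

text \<open>Exponential decrease of the products of Lipschitz constants over \<open>q\<close> blocks, backwards and forwards from every time \<open>t\<close>.
Backwards, it dominates in addition the displacement of \<open>y\<close> in the next block, as needed for the summability of the increments
of the backward iterates.\<close>

definition contracts_on :: "'p set \<Rightarrow> 'a \<Rightarrow> bool" where
  "contracts_on B \<omega> \<longleftrightarrow> (\<exists>c>0. \<exists>\<rho>. (\<forall>v. lip r B v \<le> exp (\<rho> v)) \<and>
     (\<forall>t. \<exists>C. \<forall>q. (\<Sum>i<q. \<rho> (time_shift (t - int r * int i) (path \<omega>))) +
         log_plus (disp r (time_shift (t - int r * int q) (path \<omega>))) \<le> C - c * real q) \<and>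
     (\<forall>t. \<exists>C. \<forall>q. (\<Sum>i<q. \<rho> (time_shift (t + int r * int i) (path \<omega>))) \<le> C - c * real q))"

text \<open>For the displacement the ergodic bound is applied to \<open>log_rate\<close> plus the coboundary of the logarithmic displacement. A coboundary has
mean zero, and its sum along the orbit telescopes, which leaves the displacement at the last point. Thus a single bound covers both terms.\<close>

lemma AE_contracts_on:
  assumes neg: "(\<integral>\<omega>. log_rate B k (path \<omega>) \<partial>M) < 0"
  shows "AE \<omega> in M. contracts_on B \<omega>"
proof -
  let ?a = "log_rate B k" and ?d = "\<lambda>v. log_plus (disp r v)"
  define f where "f v = ?a v + (?d (time_shift (- int r) v) - ?d v)" for v
  have d_shift: "integrable M (\<lambda>\<omega>. ?d (time_shift (- int r) (path \<omega>)))"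
    "(\<integral>\<omega>. ?d (time_shift (- int r) (path \<omega>)) \<partial>M) = (\<integral>\<omega>. ?d (path \<omega>) \<partial>M)"
    by (rule stationary_integral[OF log_disp_measurable integrable_log_disp])+
  have fm: "f \<in> borel_measurable path_space"
    unfolding f_def[abs_def]
    by (intro borel_measurable_add borel_measurable_diff log_rate_measurable log_disp_measurable
        measurable_compose[OF measurable_shift log_disp_measurable])
  have f_int: "integrable M (\<lambda>\<omega>. f (path \<omega>))"
    unfolding f_def by (intro Bochner_Integration.integrable_add Bochner_Integration.integrable_diff integrable_log_rate integrable_log_disp d_shift)
  have "(\<integral>\<omega>. f (path \<omega>) \<partial>M) = (\<integral>\<omega>. ?a (path \<omega>) \<partial>M)"
    unfolding f_def
    by (simp add: Bochner_Integration.integral_add Bochner_Integration.integral_diff integrable_log_rate integrable_log_disp d_shift)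
  then have f_neg: "(\<integral>\<omega>. f (path \<omega>) \<partial>M) < 0" using neg by simp
  obtain c1 where c1: "c1 > 0" "AE \<omega> in M. \<forall>t. \<exists>C. \<forall>q. (\<Sum>i<q. f (time_shift (t + (- int r) * int i) (path \<omega>))) \<le> C - c1 * real q"
    using orbit_sums_decrease[OF fm f_int f_neg, of "- int r"] by blast
  obtain c2 where c2: "c2 > 0" "AE \<omega> in M. \<forall>t. \<exists>C. \<forall>q. (\<Sum>i<q. ?a (time_shift (t + int r * int i) (path \<omega>))) \<le> C - c2 * real q"
    using orbit_sums_decrease[OF log_rate_measurable integrable_log_rate neg, of "int r"] by blast
  define c where "c = min c1 c2"
  have c: "c > 0" "c \<le> c1" "c \<le> c2" using c1 c2 by (auto simp: c_def)
  have weaken: "S \<le> C - c * real q" if "S \<le> C - c' * real q" "c \<le> c'" for S C c' and q :: nat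
  proof -
    have "c * real q \<le> c' * real q" using that(2) by (intro mult_right_mono) auto
    then show ?thesis using that(1) by linarith
  qed
  show ?thesis
    using c1(2) c2(2)
  proof eventually_elim
    case (elim \<omega>)
    have telescope: "(\<Sum>i<q. f (time_shift (t + (- int r) * int i) (path \<omega>))) =
        (\<Sum>i<q. ?a (time_shift (t - int r * int i) (path \<omega>))) + ?d (time_shift (t - int r * int q) (path \<omega>)) - ?d (time_shift t (path \<omega>))" for t q
      by (induction q) (simp_all add: f_def shift_shift algebra_simps)
    have "\<exists>C. \<forall>q. (\<Sum>i<q. ?a (time_shift (t - int r * int i) (path \<omega>))) + ?d (time_shift (t - int r * int q) (path \<omega>)) \<le> C - c * real q" for t
    proof -
      obtain C where C: "\<And>q. (\<Sum>i<q. f (time_shift (t + (- int r) * int i) (path \<omega>))) \<le> C - c1 * real q"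
        using elim(1) by blast
      have "(\<Sum>i<q. ?a (time_shift (t - int r * int i) (path \<omega>))) + ?d (time_shift (t - int r * int q) (path \<omega>))
          \<le> (C + ?d (time_shift t (path \<omega>))) - c * real q" for q
        by (rule weaken[OF _ c(2)]) (use C[of q] telescope[of t q] in linarith)
      then show ?thesis by blast
    qed
    moreover have "\<exists>C. \<forall>q. (\<Sum>i<q. ?a (time_shift (t + int r * int i) (path \<omega>))) \<le> C - c * real q" for t
      using elim(2) weaken[OF _ c(3)] by meson
    ultimately have "(\<forall>v. lip r B v \<le> exp (?a v)) \<and>
     (\<forall>t. \<exists>C. \<forall>q. (\<Sum>i<q. ?a (time_shift (t - int r * int i) (path \<omega>))) +
         ?d (time_shift (t - int r * int q) (path \<omega>)) \<le> C - c * real q) \<and>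
     (\<forall>t. \<exists>C. \<forall>q. (\<Sum>i<q. ?a (time_shift (t + int r * int i) (path \<omega>))) \<le> C - c * real q)"
      using lip_le_exp_log_rate by blast
    then show ?case unfolding contracts_on_def by (intro exI[of _ c] conjI[OF c(1)] exI[of _ ?a])
  qed
qed

lemma iterate_blocks:
  assumes \<omega>: "regular \<omega>" and B: "open B" and \<theta>: "\<theta> \<in> \<Theta> \<inter> B"
    and \<rho>: "\<And>v. lip r B v \<le> exp (\<rho> v)"
  shows "x \<in> K \<Longrightarrow> x' \<in> K \<Longrightarrow>
    \<bar>iter (r * q) t (path \<omega>) x \<theta> - iter (r * q) t (path \<omega>) x' \<theta>\<bar>
      \<le> exp (\<Sum>i<q. \<rho> (time_shift (t - int r * int i) (path \<omega>))) * \<bar>x - x'\<bar>"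
proof (induction q arbitrary: t)
  case (Suc q)
  let ?it = "\<lambda>x. iter (r * q) (t - int r) (path \<omega>) x \<theta>"
  have split: "iter (r * Suc q) t (path \<omega>) x \<theta> = iter r t (path \<omega>) (?it x) \<theta>" for x
    using iterate_map_add[of path_map r "r * q" t "path \<omega>" x \<theta>] by simp
  have \<theta>': "\<theta> \<in> \<Theta>" using \<theta> by simp
  have "\<bar>iter r t (path \<omega>) (?it x) \<theta> - iter r t (path \<omega>) (?it x') \<theta>\<bar> \<le> lip r B (time_shift t (path \<omega>)) * \<bar>?it x - ?it x'\<bar>"
    by (rule lip_bound[OF \<omega> _ B \<theta>]) (use Suc.prems regular_iter_K[OF \<omega> _ \<theta>'] in auto)
  also have "\<dots> \<le> exp (\<rho> (time_shift t (path \<omega>))) *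
      (exp (\<Sum>i<q. \<rho> (time_shift (t - int r - int r * int i) (path \<omega>))) * \<bar>x - x'\<bar>)"
    by (intro mult_mono \<rho> Suc) auto
  also have "\<dots> = exp (\<Sum>i<Suc q. \<rho> (time_shift (t - int r * int i) (path \<omega>))) * \<bar>x - x'\<bar>"
    by (simp add: sum.lessThan_Suc_shift exp_add algebra_simps del: sum.lessThan_Suc)
  finally show ?case unfolding split .
qed simp

text \<open>The limit of the recursion started at \<open>y\<close> in the distant past. Its values lie in the closure of \<open>K\<close>, not
necessarily in \<open>K\<close>.\<close>

definition backward_limit :: "int \<Rightarrow> 'a \<Rightarrow> 'p \<Rightarrow> real" where
  "backward_limit t \<omega> \<theta> = lim (\<lambda>q. iter (r * q) (t - 1) (path \<omega>) y \<theta>)"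

text \<open>Prolonging the past by one block replaces the starting point \<open>y\<close> by its image under that block, so the increments
are bounded by a product of Lipschitz constants times a displacement, and their series converges geometrically.\<close>

lemma backward_iterates_uniform_limit:
  assumes \<omega>: "regular \<omega>" and B: "open B" and contr: "contracts_on B \<omega>"
  shows "uniform_limit (\<Theta> \<inter> B) (\<lambda>q \<theta>. iter (r * q) (t - 1) (path \<omega>) y \<theta>) (backward_limit t \<omega>) sequentially"
proof -
  obtain c \<rho> where c: "c > 0" and \<rho>: "\<And>v. lip r B v \<le> exp (\<rho> v)"
    and bwd: "\<And>t. \<exists>C. \<forall>q. (\<Sum>i<q. \<rho> (time_shift (t - int r * int i) (path \<omega>))) +
         log_plus (disp r (time_shift (t - int r * int q) (path \<omega>))) \<le> C - c * real q"
    using contr unfolding contracts_on_def by blast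
  obtain C where C: "\<And>q. (\<Sum>i<q. \<rho> (time_shift (t - 1 - int r * int i) (path \<omega>))) +
         log_plus (disp r (time_shift (t - 1 - int r * int q) (path \<omega>))) \<le> C - c * real q"
    using bwd[of "t - 1"] by blast
  let ?x = "\<lambda>q \<theta>. iter (r * q) (t - 1) (path \<omega>) y \<theta>"
  have inc: "norm (?x (Suc q) \<theta> - ?x q \<theta>) \<le> exp C * exp (- c) ^ q" if \<theta>: "\<theta> \<in> \<Theta> \<inter> B" for q \<theta>
  proof -
    let ?s = "t - 1 - int r * int q"
    have \<theta>': "\<theta> \<in> \<Theta>" using \<theta> by simp
    have "?x (Suc q) \<theta> = iter (r * q) (t - 1) (path \<omega>) (iter r ?s (path \<omega>) y \<theta>) \<theta>"
      using iterate_map_add[of path_map "r * q" r "t - 1" "path \<omega>" y \<theta>] by (simp add: add.commute)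
    then have "norm (?x (Suc q) \<theta> - ?x q \<theta>) \<le>
        exp (\<Sum>i<q. \<rho> (time_shift (t - 1 - int r * int i) (path \<omega>))) * \<bar>iter r ?s (path \<omega>) y \<theta> - y\<bar>"
      using iterate_blocks[OF \<omega> B \<theta> \<rho> regular_iter_K[OF \<omega> y \<theta>'] y] by simp
    also have "\<bar>iter r ?s (path \<omega>) y \<theta> - y\<bar> \<le> exp (log_plus (disp r (time_shift ?s (path \<omega>))))"
      using disp_bound[OF \<omega> \<theta>', of r ?s] le_exp_log_plus by (rule order_trans)
    finally have "norm (?x (Suc q) \<theta> - ?x q \<theta>) \<le>
        exp ((\<Sum>i<q. \<rho> (time_shift (t - 1 - int r * int i) (path \<omega>))) + log_plus (disp r (time_shift ?s (path \<omega>))))"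
      by (simp add: exp_add)
    also have "\<dots> \<le> exp (C - c * real q)" using C[of q] by simp
    also have "\<dots> = exp C * exp (- c) ^ q" by (simp add: exp_of_nat_mult[symmetric] exp_add[symmetric] algebra_simps)
    finally show ?thesis .
  qed
  have summ: "summable (\<lambda>q. exp C * exp (- c) ^ q)"
    using c by (intro summable_mult summable_geometric) simp
  have "uniform_limit (\<Theta> \<inter> B) (\<lambda>q \<theta>. \<Sum>i<q. (?x (Suc i) \<theta> - ?x i \<theta>)) (\<lambda>\<theta>. \<Sum>i. (?x (Suc i) \<theta> - ?x i \<theta>)) sequentially"
    by (rule Weierstrass_m_test[OF inc summ])
  then have U: "uniform_limit (\<Theta> \<inter> B) (\<lambda>q \<theta>. y + (\<Sum>i<q. (?x (Suc i) \<theta> - ?x i \<theta>))) (\<lambda>\<theta>. y + (\<Sum>i. (?x (Suc i) \<theta> - ?x i \<theta>))) sequentially"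
    by (intro uniform_limit_add uniform_limit_const)
  have tele: "y + (\<Sum>i<q. (?x (Suc i) \<theta> - ?x i \<theta>)) = ?x q \<theta>" for q \<theta>
    by (subst sum_lessThan_telescope) simp
  have U': "uniform_limit (\<Theta> \<inter> B) ?x (\<lambda>\<theta>. y + (\<Sum>i. (?x (Suc i) \<theta> - ?x i \<theta>))) sequentially"
    using U unfolding tele .
  have eq: "y + (\<Sum>i. (?x (Suc i) \<theta> - ?x i \<theta>)) = backward_limit t \<omega> \<theta>" if "\<theta> \<in> \<Theta> \<inter> B" for \<theta>
    unfolding backward_limit_def using limI[OF tendsto_uniform_limitI[OF U' that]] by simp
  show ?thesis by (rule uniform_limit_cong'[OF refl eq, THEN iffD1, OF _ U'])
qed

text \<open>The maps at the times \<open>j, ..., r * q + j - 1\<close> are applied both to \<open>approx \<phi> f j\<close> and to the backward iterates at time \<open>j\<close>, whose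
values lie in \<open>K\<close>. The limit is taken only afterwards, because the Lipschitz bound is available on \<open>K\<close> but not for the limit.\<close>

lemma approx_near_backward_limit:
  assumes \<omega>: "regular \<omega>" and B: "open B" and contr: "contracts_on B \<omega>" and f: "f \<in> cont_fun_space \<Theta> K"
  shows "\<exists>c>0. \<exists>C. \<forall>q. \<forall>\<theta>\<in>\<Theta> \<inter> B.
    \<bar>approx \<phi> f (r * q + j) \<omega> \<theta> - backward_limit (int (r * q + j)) \<omega> \<theta>\<bar>
      \<le> exp (C - c * real q) * \<bar>approx \<phi> f j \<omega> \<theta> - backward_limit (int j) \<omega> \<theta>\<bar>"
proof -
  obtain c \<rho> where c: "c > 0" and \<rho>: "\<And>v. lip r B v \<le> exp (\<rho> v)"
    and fwd: "\<And>t. \<exists>C. \<forall>q. (\<Sum>i<q. \<rho> (time_shift (t + int r * int i) (path \<omega>))) \<le> C - c * real q"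
    using contr unfolding contracts_on_def by blast
  obtain C where C: "\<And>q. (\<Sum>i<q. \<rho> (time_shift (int j + int r - 1 + int r * int i) (path \<omega>))) \<le> C - c * real q"
    using fwd[of "int j + int r - 1"] by blast
  have "\<bar>approx \<phi> f (r * q + j) \<omega> \<theta> - backward_limit (int (r * q + j)) \<omega> \<theta>\<bar>
      \<le> exp (C - c * real q) * \<bar>approx \<phi> f j \<omega> \<theta> - backward_limit (int j) \<omega> \<theta>\<bar>" if \<theta>: "\<theta> \<in> \<Theta> \<inter> B" for q \<theta>
  proof -
    let ?t = "int (r * q + j) - 1"
    have \<theta>': "\<theta> \<in> \<Theta>" using \<theta> by simp
    have fK: "f \<theta> \<in> K" using f \<theta>' by (auto simp: cont_fun_space_def)
    have apK: "approx \<phi> f j \<omega> \<theta> \<in> K"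
      using \<omega> \<theta>' fK by (induction j) (auto simp: regular_def)
    have ap: "approx \<phi> f (r * q + j) \<omega> \<theta> = iter (r * q) ?t (path \<omega>) (approx \<phi> f j \<omega> \<theta>) \<theta>"
      unfolding approx_eq_iterate_map iterate_map_\<phi> ..
    have sum_eq: "(\<Sum>i<q. \<rho> (time_shift (?t - int r * int i) (path \<omega>))) =
        (\<Sum>i<q. \<rho> (time_shift (int j + int r - 1 + int r * int i) (path \<omega>)))"
    proof -
      have "(\<Sum>i<q. \<rho> (time_shift (int j + int r - 1 + int r * int i) (path \<omega>))) =
        (\<Sum>i<q. \<rho> (time_shift (int j + int r - 1 + int r * int (q - Suc i)) (path \<omega>)))"
        by (rule sum.nat_diff_reindex[symmetric])
      also have "\<dots> = (\<Sum>i<q. \<rho> (time_shift (?t - int r * int i) (path \<omega>)))"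
        by (intro sum.cong refl) (auto simp: of_nat_diff algebra_simps)
      finally show ?thesis by simp
    qed
    have step: "\<bar>approx \<phi> f (r * q + j) \<omega> \<theta> - iter (r * (q + m)) ?t (path \<omega>) y \<theta>\<bar>
        \<le> exp (C - c * real q) * \<bar>approx \<phi> f j \<omega> \<theta> - iter (r * m) (int j - 1) (path \<omega>) y \<theta>\<bar>" for m
    proof -
      have "iter (r * (q + m)) ?t (path \<omega>) y \<theta> = iter (r * q) ?t (path \<omega>) (iter (r * m) (int j - 1) (path \<omega>) y \<theta>) \<theta>"
        using iterate_map_add[of path_map "r * q" "r * m" ?t "path \<omega>" y \<theta>] by (simp add: algebra_simps)
      then have "\<bar>approx \<phi> f (r * q + j) \<omega> \<theta> - iter (r * (q + m)) ?t (path \<omega>) y \<theta>\<bar>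
          \<le> exp (\<Sum>i<q. \<rho> (time_shift (?t - int r * int i) (path \<omega>))) * \<bar>approx \<phi> f j \<omega> \<theta> - iter (r * m) (int j - 1) (path \<omega>) y \<theta>\<bar>"
        unfolding ap by (simp only:) (rule iterate_blocks[OF \<omega> B \<theta> \<rho> apK regular_iter_K[OF \<omega> y \<theta>']])
      also have "\<dots> \<le> exp (C - c * real q) * \<bar>approx \<phi> f j \<omega> \<theta> - iter (r * m) (int j - 1) (path \<omega>) y \<theta>\<bar>"
        unfolding sum_eq using C[of q] by (intro mult_right_mono) auto
      finally show ?thesis .
    qed
    have lim: "(\<lambda>m. iter (r * m) (t - 1) (path \<omega>) y \<theta>) \<longlonglongrightarrow> backward_limit t \<omega> \<theta>" for t
      by (rule tendsto_uniform_limitI[OF backward_iterates_uniform_limit[OF \<omega> B contr] \<theta>])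
    have "(\<lambda>m. iter (r * (q + m)) ?t (path \<omega>) y \<theta>) \<longlonglongrightarrow> backward_limit (int (r * q + j)) \<omega> \<theta>"
      using LIMSEQ_ignore_initial_segment[OF lim[of "int (r * q + j)"], of q] by (simp add: add.commute)
    then have "(\<lambda>m. \<bar>approx \<phi> f (r * q + j) \<omega> \<theta> - iter (r * (q + m)) ?t (path \<omega>) y \<theta>\<bar>)
        \<longlonglongrightarrow> \<bar>approx \<phi> f (r * q + j) \<omega> \<theta> - backward_limit (int (r * q + j)) \<omega> \<theta>\<bar>"
      by (intro tendsto_intros)
    moreover have "(\<lambda>m. exp (C - c * real q) * \<bar>approx \<phi> f j \<omega> \<theta> - iter (r * m) (int j - 1) (path \<omega>) y \<theta>\<bar>)
        \<longlonglongrightarrow> exp (C - c * real q) * \<bar>approx \<phi> f j \<omega> \<theta> - backward_limit (int j) \<omega> \<theta>\<bar>"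
      by (intro tendsto_intros lim)
    ultimately show ?thesis by (rule LIMSEQ_le) (use step in blast)
  qed
  then show ?thesis using c by blast
qed

lemma AE_contracting_cover:
  "\<exists>\<B>. finite \<B> \<and> (\<forall>B\<in>\<B>. open B) \<and> \<Theta> \<subseteq> \<Union>\<B> \<and> (AE \<omega> in M. \<forall>B\<in>\<B>. contracts_on B \<omega>)"
proof -
  have "\<exists>B. open B \<and> \<theta> \<in> B \<and> (AE \<omega> in M. contracts_on B \<omega>)" if \<theta>: "\<theta> \<in> \<Theta>" for \<theta>
  proof -
    obtain k where "(\<integral>\<omega>. log_rate (ball \<theta> (1 / real (Suc k))) k (path \<omega>) \<partial>M) < 0"
      using local_contraction[OF \<theta>] by blast
    then show ?thesis by (intro exI[of _ "ball \<theta> (1 / real (Suc k))"] conjI AE_contracts_on) auto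
  qed
  then obtain B where B: "\<And>\<theta>. \<theta> \<in> \<Theta> \<Longrightarrow> open (B \<theta>) \<and> \<theta> \<in> B \<theta> \<and> (AE \<omega> in M. contracts_on (B \<theta>) \<omega>)" by metis
  obtain T where T: "T \<subseteq> \<Theta>" "finite T" "\<Theta> \<subseteq> (\<Union>\<theta>\<in>T. B \<theta>)"
    using compactE_image[OF compact_\<Theta>, of \<Theta> B] B by blast
  have "AE \<omega> in M. \<forall>B'\<in>B ` T. contracts_on B' \<omega>"
    using T B by (subst AE_finite_all) auto
  then show ?thesis using T B by (intro exI[of _ "B ` T"]) auto
qed

lemma approx_in_cont_fun_space:
  assumes "regular \<omega>" "f \<in> cont_fun_space \<Theta> K" shows "(\<lambda>\<theta>. approx \<phi> f n \<omega> \<theta>) \<in> cont_fun_space \<Theta> K"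
proof (induction n)
  case 0
  have "(\<lambda>\<theta>. approx \<phi> f 0 \<omega> \<theta>) = f" by (rule ext) simp
  then show ?case using assms(2) by (simp only:)
next
  case (Suc n)
  have "(\<lambda>\<theta>. approx \<phi> f (Suc n) \<omega> \<theta>) = (\<lambda>\<theta>. \<phi> (int n) \<omega> (approx \<phi> f n \<omega> \<theta>) \<theta>)"
    by (rule ext) simp
  then show ?case using assms(1) Suc unfolding regular_def by (simp only:)
qed

lemma backward_limit_uniform:
  assumes \<omega>: "regular \<omega>" and fin: "finite \<B>" and op: "\<forall>B\<in>\<B>. open B" and cov: "\<Theta> \<subseteq> \<Union>\<B>"
    and contr: "\<forall>B\<in>\<B>. contracts_on B \<omega>"
  shows "uniform_limit \<Theta> (\<lambda>q \<theta>. iter (r * q) (t - 1) (path \<omega>) y \<theta>) (backward_limit t \<omega>) sequentially"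
    and "continuous_on \<Theta> (backward_limit t \<omega>)"
proof -
  have "uniform_limit (\<Union>((\<lambda>B. \<Theta> \<inter> B) ` \<B>)) (\<lambda>q \<theta>. iter (r * q) (t - 1) (path \<omega>) y \<theta>) (backward_limit t \<omega>) sequentially"
    by (rule uniform_limit_on_UNION[OF fin]) (use backward_iterates_uniform_limit[OF \<omega>] op contr in blast)
  moreover have "\<Union>((\<lambda>B. \<Theta> \<inter> B) ` \<B>) = \<Theta>" using cov by blast
  ultimately show U: "uniform_limit \<Theta> (\<lambda>q \<theta>. iter (r * q) (t - 1) (path \<omega>) y \<theta>) (backward_limit t \<omega>) sequentially" by simp
  show "continuous_on \<Theta> (backward_limit t \<omega>)"
    by (rule uniform_limit_theorem[OF _ U])
      (intro always_eventually allI regular_iter_continuous[OF \<omega> y] trivial_limit_sequentially)+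
qed

lemma approx_converges:
  assumes \<omega>: "regular \<omega>" and fin: "finite \<B>" and op: "\<forall>B\<in>\<B>. open B" and cov: "\<Theta> \<subseteq> \<Union>\<B>"
    and contr: "\<forall>B\<in>\<B>. contracts_on B \<omega>" and f: "f \<in> cont_fun_space \<Theta> K"
  shows "(\<lambda>n. unif_norm \<Theta> (\<lambda>\<theta>. approx \<phi> f n \<omega> \<theta> - backward_limit (int n) \<omega> \<theta>)) \<longlonglongrightarrow> 0"
proof -
  let ?u = "\<lambda>n. unif_norm \<Theta> (\<lambda>\<theta>. approx \<phi> f n \<omega> \<theta> - backward_limit (int n) \<omega> \<theta>)"
  have cont: "continuous_on \<Theta> (\<lambda>\<theta>. approx \<phi> f n \<omega> \<theta> - backward_limit (int n) \<omega> \<theta>)" for n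
    using approx_in_cont_fun_space[OF \<omega> f, of n] backward_limit_uniform(2)[OF \<omega> fin op cov contr, of "int n"]
    by (intro continuous_on_diff) (auto simp: cont_fun_space_def)
  obtain \<theta>\<^sub>1 where \<theta>1: "\<theta>\<^sub>1 \<in> \<Theta>" using \<Theta>_ne by blast
  have u_nonneg: "0 \<le> ?u n" for n
    using unif_norm_upper[OF compact_\<Theta> cont \<theta>1, of n] abs_ge_zero by (rule order_trans[rotated])
  have block: "(\<lambda>q. ?u (r * q + j)) \<longlonglongrightarrow> 0" for j
  proof -
    let ?A = "?u j"
    have "\<forall>B\<in>\<B>. \<exists>c C. 0 < c \<and> (\<forall>q. \<forall>\<theta>\<in>\<Theta> \<inter> B.
      \<bar>approx \<phi> f (r * q + j) \<omega> \<theta> - backward_limit (int (r * q + j)) \<omega> \<theta>\<bar>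
      \<le> exp (C - c * real q) * \<bar>approx \<phi> f j \<omega> \<theta> - backward_limit (int j) \<omega> \<theta>\<bar>)"
      using approx_near_backward_limit[OF \<omega> _ _ f, of _ j] op contr by metis
    then obtain c C where cC: "\<And>B. B \<in> \<B> \<Longrightarrow> 0 < c B"
      "\<And>B q \<theta>. B \<in> \<B> \<Longrightarrow> \<theta> \<in> \<Theta> \<inter> B \<Longrightarrow>
      \<bar>approx \<phi> f (r * q + j) \<omega> \<theta> - backward_limit (int (r * q + j)) \<omega> \<theta>\<bar>
      \<le> exp (C B - c B * real q) * \<bar>approx \<phi> f j \<omega> \<theta> - backward_limit (int j) \<omega> \<theta>\<bar>"
      by metis
    have le: "?u (r * q + j) \<le> (\<Sum>B\<in>\<B>. exp (C B - c B * real q) * ?A)" for q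
      unfolding unif_norm_def[of _ "\<lambda>\<theta>. approx \<phi> f (r * q + j) \<omega> \<theta> - backward_limit (int (r * q + j)) \<omega> \<theta>"]
    proof (rule cSUP_least[OF \<Theta>_ne])
      fix \<theta> assume \<theta>: "\<theta> \<in> \<Theta>"
      then obtain B where B: "B \<in> \<B>" "\<theta> \<in> \<Theta> \<inter> B" using cov by blast
      have "\<bar>approx \<phi> f (r * q + j) \<omega> \<theta> - backward_limit (int (r * q + j)) \<omega> \<theta>\<bar> \<le> exp (C B - c B * real q) * ?A"
        by (rule order_trans[OF cC(2)[OF B]]) (intro mult_left_mono unif_norm_upper[OF compact_\<Theta> cont \<theta>] exp_ge_zero)
      also have "\<dots> \<le> (\<Sum>B\<in>\<B>. exp (C B - c B * real q) * ?A)"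
        by (rule member_le_sum[OF B(1) _ fin]) (use u_nonneg in auto)
      finally show "\<bar>approx \<phi> f (r * q + j) \<omega> \<theta> - backward_limit (int (r * q + j)) \<omega> \<theta>\<bar> \<le> (\<Sum>B\<in>\<B>. exp (C B - c B * real q) * ?A)" .
    qed
    have "(\<lambda>q. exp (C B - c B * real q) * ?A) \<longlonglongrightarrow> 0" if "B \<in> \<B>" for B
    proof -
      have "(\<lambda>q. exp (- c B) ^ q) \<longlonglongrightarrow> 0" using cC(1)[OF that] by (intro LIMSEQ_power_zero) simp
      then have "(\<lambda>q. exp (C B) * exp (- c B) ^ q * ?A) \<longlonglongrightarrow> exp (C B) * 0 * ?A"
        by (intro tendsto_mult tendsto_const)
      moreover have "exp (C B) * exp (- c B) ^ q = exp (C B - c B * real q)" for q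
        by (simp add: exp_of_nat_mult[symmetric] exp_add[symmetric] algebra_simps)
      ultimately show ?thesis by simp
    qed
    then have "(\<lambda>q. \<Sum>B\<in>\<B>. exp (C B - c B * real q) * ?A) \<longlonglongrightarrow> (\<Sum>B\<in>\<B>. 0)" by (intro tendsto_sum)
    then have "(\<lambda>q. \<Sum>B\<in>\<B>. exp (C B - c B * real q) * ?A) \<longlonglongrightarrow> 0" by simp
    moreover have "\<forall>\<^sub>F q in sequentially. 0 \<le> ?u (r * q + j)" by (intro always_eventually allI u_nonneg)
    moreover have "\<forall>\<^sub>F q in sequentially. ?u (r * q + j) \<le> (\<Sum>B\<in>\<B>. exp (C B - c B * real q) * ?A)"
      by (intro always_eventually allI le)
    ultimately show ?thesis by (rule tendsto_sandwich[OF _ _ tendsto_const, rotated 2])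
  qed
  show ?thesis
  proof (rule LIMSEQ_I)
    fix e :: real assume "0 < e"
    then have "\<forall>\<^sub>F q in sequentially. \<forall>j\<in>{..<r}. ?u (r * q + j) < e"
      by (intro eventually_ball_finite ballI order_tendstoD(2)[OF block]) auto
    then obtain Q where Q: "\<And>q j. q \<ge> Q \<Longrightarrow> j < r \<Longrightarrow> ?u (r * q + j) < e"
      unfolding eventually_sequentially by blast
    have "norm (?u n - 0) < e" if "n \<ge> r * Q" for n
    proof -
      have "n div r \<ge> Q" using that r by (simp add: less_eq_div_iff_mult_less_eq mult.commute)
      from Q[OF this, of "n mod r"] have "?u (r * (n div r) + n mod r) < e" using r by simp
      then have "?u n < e" by simp
      then show ?thesis using u_nonneg[of n] by simp
    qed
    then show "\<exists>n0. \<forall>n\<ge>n0. norm (?u n - 0) < e" by blast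
  qed
qed

lemma solution_close_to_backward_iterates:
  assumes \<omega>: "regular \<omega>" and B: "open B" and contr: "contracts_on B \<omega>" and \<theta>: "\<theta> \<in> \<Theta> \<inter> B"
    and z: "\<And>t. z t \<in> K" "\<And>t. z (t + 1) = \<phi> t \<omega> (z t) \<theta>"
  shows "\<exists>c>0. \<exists>C. \<forall>q. \<bar>z t - iter (r * q) (t - 1) (path \<omega>) y \<theta>\<bar> \<le> exp (C - c * real q) * \<bar>z (t - int (r * q)) - y\<bar>"
proof -
  obtain c \<rho> where c: "c > 0" and \<rho>: "\<And>v. lip r B v \<le> exp (\<rho> v)"
    and bwd: "\<And>t. \<exists>C. \<forall>q. (\<Sum>i<q. \<rho> (time_shift (t - int r * int i) (path \<omega>))) +
         log_plus (disp r (time_shift (t - int r * int q) (path \<omega>))) \<le> C - c * real q"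
    using contr unfolding contracts_on_def by blast
  obtain C where C: "\<And>q. (\<Sum>i<q. \<rho> (time_shift (t - 1 - int r * int i) (path \<omega>))) +
         log_plus (disp r (time_shift (t - 1 - int r * int q) (path \<omega>))) \<le> C - c * real q"
    using bwd[of "t - 1"] by blast
  have z_iter: "z t = iter n (t - 1) (path \<omega>) (z (t - int n)) \<theta>" for n t
  proof (induction n arbitrary: t)
    case (Suc n)
    have "z t = \<phi> (t - 1) \<omega> (z (t - 1)) \<theta>" using z(2)[of "t - 1"] by simp
    also have "z (t - 1) = iter n (t - 1 - 1) (path \<omega>) (z (t - 1 - int n)) \<theta>" by (rule Suc)
    also have "\<phi> (t - 1) \<omega> (iter n (t - 1 - 1) (path \<omega>) (z (t - 1 - int n)) \<theta>) \<theta>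
        = iter (Suc n) (t - 1) (path \<omega>) (z (t - int (Suc n))) \<theta>"
      by (simp add: iterate_map_\<phi>[of 1, simplified] algebra_simps)
    finally show ?case .
  qed simp
  have "\<bar>z t - iter (r * q) (t - 1) (path \<omega>) y \<theta>\<bar> \<le> exp (C - c * real q) * \<bar>z (t - int (r * q)) - y\<bar>" for q
  proof -
    have "\<bar>z t - iter (r * q) (t - 1) (path \<omega>) y \<theta>\<bar>
        \<le> exp (\<Sum>i<q. \<rho> (time_shift (t - 1 - int r * int i) (path \<omega>))) * \<bar>z (t - int (r * q)) - y\<bar>"
      by (subst z_iter[of t "r * q"]) (rule iterate_blocks[OF \<omega> B \<theta> \<rho> z(1) y])
    also have "\<dots> \<le> exp (C - c * real q) * \<bar>z (t - int (r * q)) - y\<bar>"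
      using C[of q] log_plus_nonneg[of "disp r (time_shift (t - 1 - int r * int q) (path \<omega>))"]
      by (intro mult_right_mono) auto
    finally show ?thesis .
  qed
  then show ?thesis using c by blast
qed

text \<open>At time \<open>t - r * q\<close> the solution is within distance \<open>R\<close> of \<open>y\<close> with a probability that does not depend on \<open>q\<close>. So
with at least this probability it happens for infinitely many \<open>q\<close>, and then the contraction identifies the solution with the
limit. The probability tends to one as \<open>R\<close> grows.\<close>

lemma stationary_solution_eq_backward_limit:
  assumes sol: "stationary_solution M K (\<lambda>x. x) (\<lambda>t \<omega> x. \<phi> t \<omega> x \<theta>) z"
    and B: "open B" and contr: "AE \<omega> in M. contracts_on B \<omega>" and \<theta>: "\<theta> \<in> \<Theta> \<inter> B"
  shows "AE \<omega> in M. z t \<omega> = backward_limit t \<omega> \<theta>"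
proof -
  have zm[measurable]: "z t \<in> borel_measurable M" for t
    using sol unfolding stationary_solution_def stationary_process_def by blast
  have \<theta>': "\<theta> \<in> \<Theta>" using \<theta> by simp
  have itm[measurable]: "(\<lambda>\<omega>. iter m s (path \<omega>) y \<theta>) \<in> borel_measurable M" for m s
    by (rule measurable_compose[OF path_measurable iter_measurable[OF \<theta>']])
  have blm[measurable]: "(\<lambda>\<omega>. backward_limit t \<omega> \<theta>) \<in> borel_measurable M"
    unfolding backward_limit_def by measurable
  have z_rec: "AE \<omega> in M. \<forall>t. z t \<omega> \<in> K \<and> z (t + 1) \<omega> = \<phi> t \<omega> (z t \<omega>) \<theta>"
    using sol unfolding stationary_solution_def AE_all_countable by blast
  let ?E = "\<lambda>R q. {\<omega> \<in> space M. \<bar>z (t - int (r * q)) \<omega> - y\<bar> \<le> real R}"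
  define p where "p R = measure M {\<omega> \<in> space M. \<bar>z 0 \<omega> - y\<bar> \<le> real R}" for R :: nat
  have E_meas: "measure M (?E R q) = p R" for R q
  proof -
    have 1: "measure M {\<omega> \<in> space M. \<bar>z s \<omega> - y\<bar> \<le> real R} = measure (distr M borel (z s)) {x. \<bar>x - y\<bar> \<le> real R}" for s
      by (subst measure_distr) (auto intro!: arg_cong[where f="measure M"])
    have 2: "distr M borel (z s) = distr M borel (z 0)" for s
      using sol unfolding stationary_solution_def by (intro stationary_process_marginal) blast
    show ?thesis by (simp only: p_def 1 2[of "t - int (r * q)"])
  qed
  have p_lim: "p \<longlonglongrightarrow> 1"
  proof -
    have "(\<Union>R. {\<omega> \<in> space M. \<bar>z 0 \<omega> - y\<bar> \<le> real R}) = space M"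
      using real_arch_simple by blast
    moreover have "(\<lambda>R. measure M {\<omega> \<in> space M. \<bar>z 0 \<omega> - y\<bar> \<le> real R}) \<longlonglongrightarrow> measure M (\<Union>R. {\<omega> \<in> space M. \<bar>z 0 \<omega> - y\<bar> \<le> real R})"
      by (intro finite_Lim_measure_incseq) (auto intro!: incseq_SucI)
    ultimately show ?thesis unfolding p_def[abs_def] by (simp add: prob_space)
  qed
  let ?S = "{\<omega> \<in> space M. z t \<omega> = backward_limit t \<omega> \<theta>}"
  have "p R \<le> measure M ?S" for R
  proof -
    let ?U = "\<lambda>n. \<Union>q\<in>{n..}. ?E R q"
    have Um[measurable]: "?U n \<in> sets M" for n by measurable
    have "(\<lambda>n. measure M (?U n)) \<longlonglongrightarrow> measure M (\<Inter>n. ?U n)"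
    proof (rule finite_Lim_measure_decseq)
      show "decseq ?U" unfolding decseq_def by (intro allI impI UN_mono) auto
    qed auto
    moreover have "p R \<le> measure M (?U n)" for n
    proof -
      have "p R = measure M (?E R n)" by (rule E_meas[symmetric])
      also have "\<dots> \<le> measure M (?U n)" by (intro finite_measure_mono) auto
      finally show ?thesis .
    qed
    ultimately have "p R \<le> measure M (\<Inter>n. ?U n)" by (intro LIMSEQ_le_const) auto
    also have "\<dots> \<le> measure M ?S"
    proof (rule finite_measure_mono_AE)
      show "AE \<omega> in M. \<omega> \<in> (\<Inter>n. ?U n) \<longrightarrow> \<omega> \<in> ?S"
        using AE_regular contr z_rec AE_space
      proof eventually_elim
        case (elim \<omega>)
        show ?case
        proof
          assume io: "\<omega> \<in> (\<Inter>n. ?U n)"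
          let ?x = "\<lambda>q. iter (r * q) (t - 1) (path \<omega>) y \<theta>"
          obtain c C where c: "c > 0" and C: "\<And>q. \<bar>z t \<omega> - ?x q\<bar> \<le> exp (C - c * real q) * \<bar>z (t - int (r * q)) \<omega> - y\<bar>"
            using solution_close_to_backward_iterates[OF elim(1) B elim(2) \<theta>, of "\<lambda>t. z t \<omega>" t] elim(3) by blast
          have xl: "?x \<longlonglongrightarrow> backward_limit t \<omega> \<theta>"
            by (rule tendsto_uniform_limitI[OF backward_iterates_uniform_limit[OF elim(1) B elim(2)] \<theta>])
          have "z t \<omega> = backward_limit t \<omega> \<theta>"
          proof (rule ccontr)
            assume ne: "z t \<omega> \<noteq> backward_limit t \<omega> \<theta>"
            have "(\<lambda>q. exp (- c) ^ q) \<longlonglongrightarrow> 0" using c by (intro LIMSEQ_power_zero) simp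
            then have "(\<lambda>q. \<bar>z t \<omega> - ?x q\<bar> - exp C * exp (- c) ^ q * real R)
                \<longlonglongrightarrow> \<bar>z t \<omega> - backward_limit t \<omega> \<theta>\<bar> - exp C * 0 * real R"
              by (intro tendsto_diff tendsto_rabs tendsto_mult tendsto_const xl)
            then have "\<forall>\<^sub>F q in sequentially. 0 < \<bar>z t \<omega> - ?x q\<bar> - exp C * exp (- c) ^ q * real R"
              by (rule order_tendstoD(1)) (use ne in simp)
            then obtain n where n: "\<And>q. q \<ge> n \<Longrightarrow> exp C * exp (- c) ^ q * real R < \<bar>z t \<omega> - ?x q\<bar>"
              unfolding eventually_sequentially by auto
            obtain q where q: "q \<ge> n" "\<bar>z (t - int (r * q)) \<omega> - y\<bar> \<le> real R" using io by blast
            have e: "exp (C - c * real q) = exp C * exp (- c) ^ q"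
              by (simp add: exp_of_nat_mult[symmetric] exp_add[symmetric] algebra_simps)
            have "exp C * exp (- c) ^ q * \<bar>z (t - int (r * q)) \<omega> - y\<bar> \<le> exp C * exp (- c) ^ q * real R"
              using q(2) by (intro mult_left_mono) auto
            then show False using C[of q] n[OF q(1)] unfolding e by linarith
          qed
          then show "\<omega> \<in> ?S" using elim(4) by simp
        qed
      qed
    qed measurable
    finally show ?thesis .
  qed
  then have "1 \<le> measure M ?S" by (intro LIMSEQ_le_const2[OF p_lim]) blast
  then have "measure M ?S = 1" using prob_le_1[of ?S] by linarith
  then show ?thesis by (subst (asm) prob_Collect_eq_1) auto
qed

text \<open>The common modification is the backward limit, which is set to zero on one null set where the pathwise estimates may fail.\<close>

theorem invertible:
  assumes g: "\<And>\<theta>. \<theta> \<in> \<Theta> \<Longrightarrow> stationary_solution M K (\<lambda>x. x) (\<lambda>t \<omega> x. \<phi> t \<omega> x \<theta>) (\<lambda>t \<omega>. g t \<omega> \<theta>)"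
  shows "continuously_invertible M K \<Theta> \<phi> g"
proof -
  obtain \<B> where \<B>: "finite \<B>" "\<forall>B\<in>\<B>. open B" "\<Theta> \<subseteq> \<Union>\<B>" and contr: "AE \<omega> in M. \<forall>B\<in>\<B>. contracts_on B \<omega>"
    using AE_contracting_cover by blast
  have "AE \<omega> in M. regular \<omega> \<and> (\<forall>B\<in>\<B>. contracts_on B \<omega>)"
    using AE_regular contr by eventually_elim blast
  then obtain N where N: "{\<omega> \<in> space M. \<not> (regular \<omega> \<and> (\<forall>B\<in>\<B>. contracts_on B \<omega>))} \<subseteq> N" "emeasure M N = 0" "N \<in> sets M"
    by (rule AE_E)
  have good: "regular \<omega>" "\<forall>B\<in>\<B>. contracts_on B \<omega>" if "\<omega> \<in> space M" "\<omega> \<notin> N" for \<omega>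
    using N(1) that by blast+
  have AE_N: "AE \<omega> in M. \<omega> \<notin> N" using N by (intro AE_not_in) (auto simp: null_sets_def)
  define g' where "g' t \<omega> \<theta> = (if \<omega> \<in> N then 0 else backward_limit t \<omega> \<theta>)" for t \<omega> \<theta>
  show ?thesis
    unfolding continuously_invertible_def
  proof (intro exI[of _ g'] conjI allI ballI)
    fix t \<theta> assume \<theta>: "\<theta> \<in> \<Theta>"
    have [measurable]: "(\<lambda>\<omega>. iter m s (path \<omega>) y \<theta>) \<in> borel_measurable M" for m s
      by (rule measurable_compose[OF path_measurable iter_measurable[OF \<theta>]])
    have [measurable]: "(\<lambda>\<omega>. backward_limit t \<omega> \<theta>) \<in> borel_measurable M"
      unfolding backward_limit_def by measurable
    have [measurable]: "N \<in> sets M" by (rule N(3))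
    show "(\<lambda>\<omega>. g' t \<omega> \<theta>) \<in> borel_measurable M" unfolding g'_def by measurable
    obtain B where B: "B \<in> \<B>" "\<theta> \<in> \<Theta> \<inter> B" using \<theta> \<B>(3) by blast
    have "AE \<omega> in M. contracts_on B \<omega>" using contr by eventually_elim (use B(1) in blast)
    then have "AE \<omega> in M. g t \<omega> \<theta> = backward_limit t \<omega> \<theta>"
      using stationary_solution_eq_backward_limit[OF g[OF \<theta>] _ _ B(2)] \<B>(2) B(1) by blast
    with AE_N show "AE \<omega> in M. g' t \<omega> \<theta> = g t \<omega> \<theta>" by eventually_elim (simp add: g'_def)
  next
    fix t \<omega> assume \<omega>: "\<omega> \<in> space M"
    show "continuous_on \<Theta> (g' t \<omega>)"
    proof (cases "\<omega> \<in> N")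
      case True
      then have "g' t \<omega> = (\<lambda>_. 0)" by (simp add: g'_def fun_eq_iff)
      then show ?thesis by simp
    next
      case False
      then have "g' t \<omega> = backward_limit t \<omega>" by (simp add: g'_def fun_eq_iff)
      then show ?thesis using backward_limit_uniform(2)[OF good(1)[OF \<omega> False] \<B> good(2)[OF \<omega> False]] by simp
    qed
  next
    fix f assume f: "f \<in> cont_fun_space \<Theta> K"
    show "AE \<omega> in M. (\<lambda>n. unif_norm \<Theta> (\<lambda>\<theta>. approx \<phi> f n \<omega> \<theta> - g' (int n) \<omega> \<theta>)) \<longlonglongrightarrow> 0"
      using AE_N AE_space
    proof eventually_elim
      case (elim \<omega>)
      then have "g' (int n) \<omega> \<theta> = backward_limit (int n) \<omega> \<theta>" for n \<theta> by (simp add: g'_def)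
      then show ?case using approx_converges[OF good(1)[OF elim(2,1)] \<B> good(2)[OF elim(2,1)] f] by simp
    qed
  qed
qed

end

section \<open>Continuous invertibility\<close>

theorem theorem2:
  fixes M :: "'a measure"
    and Z X \<sigma>2 :: "int \<Rightarrow> 'a \<Rightarrow> real"
    and h l :: "real \<Rightarrow> real" and D H K :: "real set"
    and \<psi> :: "real \<Rightarrow> real \<Rightarrow> 'p::euclidean_space \<Rightarrow> real"
    and \<phi> :: "int \<Rightarrow> 'a \<Rightarrow> real \<Rightarrow> 'p \<Rightarrow> real"
    and \<Theta> :: "'p set" and \<theta>0 :: 'p
    and g :: "int \<Rightarrow> 'a \<Rightarrow> 'p \<Rightarrow> real"
    and \<Lambda> :: "nat \<Rightarrow> int \<Rightarrow> 'a \<Rightarrow> 'p \<Rightarrow> real"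
    and y :: real and r :: nat
  assumes "prob_space M"
    and iid: "iid_process M Z"
    and mean: "integrable M (Z 0)" "(\<integral>\<omega>. Z 0 \<omega> \<partial>M) = 0"
    and var: "integrable M (\<lambda>\<omega>. (Z 0 \<omega>)\<^sup>2)" "(\<integral>\<omega>. (Z 0 \<omega>)\<^sup>2 \<partial>M) = 1"
    and link: "D \<subseteq> {0..}" "D \<in> sets borel" "bij_betw h D H" "\<forall>s\<in>D. l (h s) = s" "\<forall>x\<in>H. l x > 0"
    and link_measurable: "h \<in> borel_measurable borel" "l \<in> borel_measurable borel"
    and \<psi>_measurable:
      "\<forall>\<theta>\<in>insert \<theta>0 \<Theta>. (\<lambda>(x, z). \<psi> x z \<theta>) \<in> borel_measurable (borel \<Otimes>\<^sub>M borel)"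
    and X: "X = (\<lambda>t \<omega>. sqrt (\<sigma>2 t \<omega>) * Z t \<omega>)"
    and \<phi>: "\<phi> = inverted_map \<psi> l X"
    and \<Theta>: "compact \<Theta>" "\<Theta> \<noteq> {}"
    and K: "K \<subseteq> H"
    and \<phi>_K: "AE \<omega> in M. \<forall>t. \<forall>x\<in>K. \<forall>\<theta>\<in>\<Theta>. \<phi> t \<omega> x \<theta> \<in> K"
    and \<phi>_C: "AE \<omega> in M. \<forall>t. \<forall>f\<in>cont_fun_space \<Theta> K. (\<lambda>\<theta>. \<phi> t \<omega> (f \<theta>) \<theta>) \<in> cont_fun_space \<Theta> K"
    and \<Lambda>: "\<forall>m\<in>{1, r}. AE \<omega> in M. \<forall>t. lipschitz_coeff K \<Theta> (iterate_map \<phi> m t \<omega>) (\<Lambda> m t \<omega>)"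
    and \<Lambda>_measurable: "\<forall>m\<in>{1, r}. \<forall>t. \<forall>\<theta>\<in>\<Theta>. (\<lambda>\<omega>. \<Lambda> m t \<omega> \<theta>) \<in> borel_measurable M"
    and g: "\<forall>\<theta>\<in>\<Theta>. unique_stationary_solution M K (\<lambda>x. x) (\<lambda>t \<omega> x. \<phi> t \<omega> x \<theta>) (\<lambda>t \<omega>. g t \<omega> \<theta>)"
    and stat: "unique_stationary_solution M D h (\<lambda>t \<omega> x. \<psi> x (Z t \<omega>) \<theta>0) \<sigma>2"
    and causal: "non_anticipative M Z \<sigma>2"
    and \<sigma>2_log: "integrable M (\<lambda>\<omega>. log_plus (\<sigma>2 0 \<omega>))"
    and y: "y \<in> K" "integrable M (\<lambda>\<omega>. log_plus (unif_norm \<Theta> (\<phi> 0 \<omega> y)))"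
    and \<Lambda>_log: "integrable M (\<lambda>\<omega>. log_plus (unif_norm \<Theta> (\<Lambda> 1 0 \<omega>)))"
    and r: "r \<ge> 1"
    and contraction: "\<forall>\<theta>\<in>\<Theta>. ext_expectation M (\<lambda>\<omega>. ext_log (\<Lambda> r 0 \<omega> \<theta>)) < 0"
  shows "continuously_invertible M K \<Theta> \<phi> g"
proof -
  interpret prob_space M by fact
  have "totally_ergodic_process M (\<lambda>t \<omega>. sqrt (\<sigma>2 t \<omega>) * Z t \<omega>)"
  proof (rule unique_causal_solution_ergodic[OF \<open>prob_space M\<close> iid link(2) link(4) link_measurable _ stat causal])
    show "(\<lambda>(x, z). \<psi> x z \<theta>0) \<in> borel_measurable (borel \<Otimes>\<^sub>M borel)" using \<psi>_measurable by simp
    show "(\<lambda>(s, z). sqrt s * z) \<in> borel_measurable (borel \<Otimes>\<^sub>M borel)" by measurable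
  qed
  then have ergodic: "totally_ergodic_process M X" by (simp add: X)
  let ?F = "\<lambda>v x \<theta>. \<psi> x (v / sqrt (l x)) \<theta>"
  have F_measurable: "(\<lambda>(x, v). ?F v x \<theta>) \<in> borel_measurable (borel \<Otimes>\<^sub>M borel)" if "\<theta> \<in> \<Theta>" for \<theta>
  proof -
    note [measurable] = link_measurable(2)
    have "(\<lambda>p. (fst p, snd p / sqrt (l (fst p)))) \<in> borel \<Otimes>\<^sub>M borel \<rightarrow>\<^sub>M borel \<Otimes>\<^sub>M (borel :: real measure)"
      by measurable
    moreover have "(\<lambda>(x, z). \<psi> x z \<theta>) \<in> borel_measurable (borel \<Otimes>\<^sub>M borel)" using \<psi>_measurable that by simp
    ultimately have "(\<lambda>p. (\<lambda>(x, z). \<psi> x z \<theta>) (fst p, snd p / sqrt (l (fst p)))) \<in> borel_measurable (borel \<Otimes>\<^sub>M borel)"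
      by (rule measurable_compose)
    then show ?thesis by (simp add: case_prod_beta')
  qed
  have \<phi>_path: "\<phi> = (\<lambda>t \<omega> x \<theta>. ?F (X t \<omega>) x \<theta>)" by (simp add: \<phi> inverted_map_def fun_eq_iff)
  have \<Lambda>_r_measurable: "(\<lambda>\<omega>. \<Lambda> r 0 \<omega> \<theta>) \<in> borel_measurable M" if "\<theta> \<in> \<Theta>" for \<theta>
    using \<Lambda>_measurable that by simp
  interpret contractive_recursion M X ?F \<phi> K \<Theta> \<Lambda> y r
    by (intro contractive_recursion.intro \<open>prob_space M\<close>
        contractive_recursion_axioms.intro[OF ergodic \<phi>_path F_measurable \<Theta> \<phi>_K \<phi>_C \<Lambda> \<Lambda>_r_measurable y
          \<Lambda>_log r bspec[OF contraction]])
  show ?thesis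
    by (rule invertible) (use g in \<open>simp add: unique_stationary_solution_def\<close>)
qed

end
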